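(* Let $\delta=\delta(n)$ satisfy $\delta=O(1/\sqrt{n})$, and let $\beta=1\pm\delta$. Then the mixing time $t_{\mathrm{mix}}(1/4)$ of the Glauber dynamics for the mean-field Ising model on $n$ vertices with parameter $\beta$ has order $n^{3/2}$, and the dynamics does not exhibit cutoff. In addition, the spectral gap of the dynamics has order $n^{-3/2}$.
   Context: For $n\ge1$ and $\beta\ge0$, the mean-field (Curie–Weiss) Ising measure $\mu_n$ on $\Omega=\{1,-1\}^n$ is $\mu_n(\sigma)\propto\exp\big(\frac{\beta}{n}\sum_{x<y}\sigma(x)\sigma(y)\big)$. The (heat-bath) Glauber dynamics $(X_t)$ is the Markov chain on $\Omega$ which at each step chooses a vertex uniformly at random and replaces its spin by a spin drawn from $\mu_n$ conditioned on the spins at all other vertices. Let $d_n(t)=\max_{\sigma}\|\mathbb{P}_\sigma(X_t\in\cdot)-\mu_n\|_{\mathrm{TV}}$ and $t_{\mathrm{mix}}(\epsilon)=\min\{t:d_n(t)\le\epsilon\}$. The spectral gap is $1-\lambda$, with $\lambda$ the largest absolute value of a nontrivial eigenvalue of the transition kernel. A quantity "has order $f(n)$" if it lies between $cf(n)$ and $Cf(n)$ for constants $0<c<C$ and all large $n$. The family exhibits cutoff if there is a sequence $w_n=o(t_{\mathrm{mix}}(1/4))$ such that for every $0<\epsilon<1$ there is $c_\epsilon>0$ with $t_{\mathrm{mix}}(\epsilon)-t_{\mathrm{mix}}(1-\epsilon)\le c_\epsilon w_n$ for all $n$. *)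

theory Defs
  imports "HOL-Analysis.Analysis" "HOL-Library.Landau_Symbols"
begin

definition config :: "nat \<Rightarrow> int list set" where
  "config n = {\<sigma>. length \<sigma> = n \<and> set \<sigma> \<subseteq> {1, -1}}"

definition cw_energy :: "nat \<Rightarrow> int list \<Rightarrow> real" where
  "cw_energy n \<sigma> = (\<Sum>x<n. \<Sum>y\<in>{Suc x..<n}. real_of_int (\<sigma> ! x * \<sigma> ! y))"

definition cw_weight :: "real \<Rightarrow> nat \<Rightarrow> int list \<Rightarrow> real" where
  "cw_weight \<beta> n \<sigma> = exp (\<beta> / real n * cw_energy n \<sigma>)"

definition cw_mu :: "real \<Rightarrow> nat \<Rightarrow> int list \<Rightarrow> real" where
  "cw_mu \<beta> n \<sigma> = (if \<sigma> \<in> config n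
      then cw_weight \<beta> n \<sigma> / (\<Sum>\<tau>\<in>config n. cw_weight \<beta> n \<tau>) else 0)"

text \<open>Heat-bath Glauber transition kernel: choose vertex v uniformly, resample its spin
  from mu_n conditioned on the other spins.\<close>
definition glauber :: "real \<Rightarrow> nat \<Rightarrow> int list \<Rightarrow> int list \<Rightarrow> real" where
  "glauber \<beta> n \<sigma> \<tau> = (\<Sum>v<n.
      if \<tau> \<in> config n \<and> (\<forall>i<n. i \<noteq> v \<longrightarrow> \<tau> ! i = \<sigma> ! i)
      then cw_mu \<beta> n \<tau> / (cw_mu \<beta> n (\<sigma>[v := 1]) + cw_mu \<beta> n (\<sigma>[v := -1]))
      else 0) / real n"

fun glauber_pow :: "real \<Rightarrow> nat \<Rightarrow> nat \<Rightarrow> int list \<Rightarrow> int list \<Rightarrow> real" where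
  "glauber_pow \<beta> n 0 \<sigma> \<tau> = (if \<tau> = \<sigma> then 1 else 0)"
| "glauber_pow \<beta> n (Suc t) \<sigma> \<tau> =
     (\<Sum>\<rho>\<in>config n. glauber_pow \<beta> n t \<sigma> \<rho> * glauber \<beta> n \<rho> \<tau>)"

definition tv_to_stat :: "real \<Rightarrow> nat \<Rightarrow> nat \<Rightarrow> int list \<Rightarrow> real" where
  "tv_to_stat \<beta> n t \<sigma> = (1/2) * (\<Sum>\<tau>\<in>config n. \<bar>glauber_pow \<beta> n t \<sigma> \<tau> - cw_mu \<beta> n \<tau>\<bar>)"

definition dist_n :: "real \<Rightarrow> nat \<Rightarrow> nat \<Rightarrow> real" where
  "dist_n \<beta> n t = Max ((\<lambda>\<sigma>. tv_to_stat \<beta> n t \<sigma>) ` config n)"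

definition tmix :: "real \<Rightarrow> nat \<Rightarrow> real \<Rightarrow> nat" where
  "tmix \<beta> n \<epsilon> = (LEAST t. dist_n \<beta> n t \<le> \<epsilon>)"

definition glauber_eigenvalue :: "real \<Rightarrow> nat \<Rightarrow> complex \<Rightarrow> bool" where
  "glauber_eigenvalue \<beta> n z \<longleftrightarrow>
     (\<exists>f :: int list \<Rightarrow> complex. (\<exists>\<sigma>\<in>config n. f \<sigma> \<noteq> 0) \<and>
        (\<forall>\<sigma>\<in>config n. (\<Sum>\<tau>\<in>config n. complex_of_real (glauber \<beta> n \<sigma> \<tau>) * f \<tau>) = z * f \<sigma>))"

definition lambda_star :: "real \<Rightarrow> nat \<Rightarrow> real" where
  "lambda_star \<beta> n = Sup {cmod z | z. glauber_eigenvalue \<beta> n z \<and> z \<noteq> 1}"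

definition spectral_gap :: "real \<Rightarrow> nat \<Rightarrow> real" where
  "spectral_gap \<beta> n = 1 - lambda_star \<beta> n"

definition has_order :: "(nat \<Rightarrow> real) \<Rightarrow> (nat \<Rightarrow> real) \<Rightarrow> bool" where
  "has_order f g \<longleftrightarrow> (\<exists>c C. 0 < c \<and> c < C \<and>
      (\<forall>\<^sub>F n in sequentially. c * g n \<le> f n \<and> f n \<le> C * g n))"

definition has_cutoff :: "(nat \<Rightarrow> real) \<Rightarrow> bool" where
  "has_cutoff \<beta> \<longleftrightarrow> (\<exists>w :: nat \<Rightarrow> real.
      w \<in> o(\<lambda>n. real (tmix (\<beta> n) n (1/4))) \<and>
      (\<forall>\<epsilon>. 0 < \<epsilon> \<and> \<epsilon> < 1 \<longrightarrow> (\<exists>c>0. \<forall>n\<ge>1.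
         real (tmix (\<beta> n) n \<epsilon>) - real (tmix (\<beta> n) n (1 - \<epsilon>)) \<le> c * w n)))"

end

theory Submission
  imports Defs "HOL-Real_Asymp.Real_Asymp"
begin

text \<open>
  Everything follows from two facts for large \<open>n\<close>: the distance to stationarity at time \<open>2 t\<close> is at
  most \<open>n (1 - c / n) ^ t + M (1 - 1 / (M n^(3/2))) ^ t\<close>, and some eigenvalue other than 1 is at least
  \<open>1 - C / n^(3/2)\<close>. An eigenvalue \<open>z \<noteq> 1\<close> satisfies \<open>|z| ^ t \<le> 2 d(t)\<close>, which yields the orders of
  the mixing time and of the gap, and also that the mixing time to precision \<open>\<epsilon>\<close> is at least
  \<open>c' n^(3/2) ln (1 / (2 \<epsilon>))\<close>; under cutoff it would be at most twice the mixing time to precision 1/4.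

  Upper bound: two configurations of equal magnetization are connected by swaps of opposite spins, and
  along a swap the oscillation of a function contracts by \<open>1 - c / n\<close>. Two configurations of different
  magnetization move independently; the difference of their magnetizations, on the scale \<open>n^(3/4)\<close> of
  space and \<open>n^(3/2)\<close> of time, has drift at most \<open>K w - c w^3 + C\<close> and nondegenerate noise, and an
  explicit bounded function of it decreases by \<open>n^(-3/2)\<close> in mean until they meet.

  Large eigenvalue: stationarity of the squared magnetization \<open>S\<^sup>2\<close> forces \<open>E S^4\<close> to be at least of
  order \<open>n^3\<close>. The test function \<open>S |S|\<close> has mean zero, second moment \<open>E S^4\<close> and Dirichlet form at most
  \<open>16 (E S\<^sup>2 + 1)\<close>, hence Rayleigh quotient \<open>1 - O(n^(-3/2))\<close>.
\<close>

section \<open>The Glauber operator\<close>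

text \<open>No probability space is built: with \<open>P = glauber_op\<close>, a coupling argument
  is a bound on \<open>|P^t f \<sigma> - P^t f \<tau>|\<close>. In \<open>P^t (P^t f)\<close> the
  inner power makes the function almost constant on magnetization levels, so the outer one only has
  to bring the magnetizations together and can disregard pairs that have met. Independent moves make
  moments of the difference factor into one-chain quantities; the price is that walks at distance 2
  can cross without meeting. The potential must be bounded: if \<open>V \<le> M\<close>, a mean
  decrease by \<open>e\<close> is also a contraction by \<open>1 - e / M\<close>, uniformly over
  starting pairs, so the descent from magnetizations of order \<open>n\<close> needs no separate
  phase. Stationarity of \<open>S^2\<close> bounds from below only a combination of
  \<open>E S^2\<close> and \<open>E S^4\<close>, which would not suffice for the test function
  \<open>S\<close>. Put \<open>R = sqrt (E S^4)\<close>. Since \<open>E S^2 \<le> R\<close>, the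
  combination forces \<open>R\<close> to be large, and once \<open>R \<ge> 1\<close> the quotient of
  \<open>S |S|\<close> falls short of 1 by at most \<open>32 R / R^2 = 32 / R\<close>. Thus a lower
  bound on \<open>R\<close> is enough.\<close>

definition mag :: "nat \<Rightarrow> int list \<Rightarrow> real" where
  "mag n \<sigma> = (\<Sum>v<n. real_of_int (\<sigma> ! v))"

text \<open>Heat-bath probability of choosing +1 at a vertex when the spins at all other vertices
  sum to \<open>y\<close>.\<close>

definition plus_prob :: "real \<Rightarrow> nat \<Rightarrow> real \<Rightarrow> real" where
  "plus_prob \<beta> n y = (1 + tanh (\<beta> * y / real n)) / 2"

definition glauber_op :: "real \<Rightarrow> nat \<Rightarrow> (int list \<Rightarrow> real) \<Rightarrow> int list \<Rightarrow> real" where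
  "glauber_op \<beta> n f \<sigma> = (\<Sum>\<tau>\<in>config n. glauber \<beta> n \<sigma> \<tau> * f \<tau>)"

section \<open>Configurations, the Gibbs measure and its single-spin conditionals\<close>

lemma finite_config: "finite (config n)"
proof -
  have "config n = {\<sigma>. set \<sigma> \<subseteq> {1, -1} \<and> length \<sigma> = n}"
    by (auto simp: config_def)
  then show ?thesis by (simp add: finite_lists_length_eq)
qed

lemma config_nth:
  assumes "\<sigma> \<in> config n" "v < n"
  shows "\<sigma> ! v = 1 \<or> \<sigma> ! v = -1"
proof -
  have "\<sigma> ! v \<in> set \<sigma>" using assms by (simp add: config_def)
  then show ?thesis using assms(1) by (auto simp: config_def)
qed

lemma config_length: "\<sigma> \<in> config n \<Longrightarrow> length \<sigma> = n"
  by (simp add: config_def)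

lemma config_update:
  assumes "\<sigma> \<in> config n" "s = 1 \<or> s = -1"
  shows "\<sigma>[v := s] \<in> config n"
  using assms set_update_subset_insert[of \<sigma> v s] by (auto simp: config_def)

lemma config_nonempty: "config n \<noteq> {}"
proof -
  have "replicate n 1 \<in> config n" by (auto simp: config_def)
  then show ?thesis by blast
qed

lemma mag_update:
  assumes "\<sigma> \<in> config n" "v < n"
  shows "mag n (\<sigma>[v := s]) = mag n \<sigma> - real_of_int (\<sigma> ! v) + real_of_int s"
proof -
  have *: "mag n \<tau> = real_of_int (\<tau> ! v) + (\<Sum>w\<in>{..<n} - {v}. real_of_int (\<tau> ! w))" for \<tau>
    unfolding mag_def using assms(2) by (subst sum.remove[of _ v]) auto
  have "(\<Sum>w\<in>{..<n} - {v}. real_of_int (\<sigma>[v := s] ! w)) = (\<Sum>w\<in>{..<n} - {v}. real_of_int (\<sigma> ! w))"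
    by (rule sum.cong) auto
  then show ?thesis
    using *[of \<sigma>] *[of "\<sigma>[v := s]"] assms by (simp add: config_length)
qed

lemma sum_pairs_eq:
  fixes a :: "nat \<Rightarrow> real"
  shows "(\<Sum>x<n. \<Sum>y\<in>{Suc x..<n}. a x * a y) = ((\<Sum>x<n. a x)\<^sup>2 - (\<Sum>x<n. (a x)\<^sup>2)) / 2"
proof (induction n)
  case (Suc n)
  have "(\<Sum>x<n. \<Sum>y\<in>{Suc x..<Suc n}. a x * a y) = (\<Sum>x<n. (\<Sum>y\<in>{Suc x..<n}. a x * a y) + a x * a n)"
    by (rule sum.cong) auto
  also have "\<dots> = (\<Sum>x<n. \<Sum>y\<in>{Suc x..<n}. a x * a y) + (\<Sum>x<n. a x) * a n"
    by (simp add: sum.distrib sum_distrib_right)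
  finally show ?case
    using Suc by (simp add: power2_eq_square field_simps)
qed simp

lemma cw_energy_eq:
  assumes "\<sigma> \<in> config n"
  shows "cw_energy n \<sigma> = ((mag n \<sigma>)\<^sup>2 - real n) / 2"
proof -
  have "(\<Sum>x<n. (real_of_int (\<sigma> ! x))\<^sup>2) = (\<Sum>x<n. 1)"
    using config_nth[OF assms] by (intro sum.cong) fastforce+
  then show ?thesis
    using sum_pairs_eq[of "\<lambda>x. real_of_int (\<sigma> ! x)" n] by (simp add: cw_energy_def mag_def)
qed

lemma cw_partition_pos: "0 < (\<Sum>\<tau>\<in>config n. cw_weight \<beta> n \<tau>)"
  by (rule sum_pos) (auto simp: finite_config config_nonempty cw_weight_def)

lemma cw_mu_pos: "\<sigma> \<in> config n \<Longrightarrow> 0 < cw_mu \<beta> n \<sigma>"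
  using cw_partition_pos[of \<beta> n] by (simp add: cw_mu_def cw_weight_def)

lemma cw_mu_nonneg: "0 \<le> cw_mu \<beta> n \<sigma>"
  using cw_mu_pos[of \<sigma> n \<beta>] by (cases "\<sigma> \<in> config n") (auto simp: cw_mu_def)

lemma sum_cw_mu: "(\<Sum>\<sigma>\<in>config n. cw_mu \<beta> n \<sigma>) = 1"
proof -
  have "(\<Sum>\<sigma>\<in>config n. cw_mu \<beta> n \<sigma>)
      = (\<Sum>\<sigma>\<in>config n. cw_weight \<beta> n \<sigma> / (\<Sum>\<tau>\<in>config n. cw_weight \<beta> n \<tau>))"
    by (rule sum.cong) (auto simp: cw_mu_def)
  also have "\<dots> = 1"
    using cw_partition_pos[of \<beta> n] by (simp flip: sum_divide_distrib)
  finally show ?thesis .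
qed

text \<open>With \<open>y\<close> the sum of the other spins,
  \<open>(y + s)^2 = y^2 + 1 + 2 y s\<close>, so the weight is a common factor \<open>exp b\<close>
  times \<open>exp (a s)\<close>; the common factor and the partition function cancel in the
  ratio.\<close>

lemma cw_mu_ratio:
  assumes "\<sigma> \<in> config n" "v < n"
  shows "cw_mu \<beta> n (\<sigma>[v := 1]) / (cw_mu \<beta> n (\<sigma>[v := 1]) + cw_mu \<beta> n (\<sigma>[v := -1]))
      = plus_prob \<beta> n (mag n \<sigma> - real_of_int (\<sigma> ! v))"
    and "cw_mu \<beta> n (\<sigma>[v := -1]) / (cw_mu \<beta> n (\<sigma>[v := 1]) + cw_mu \<beta> n (\<sigma>[v := -1]))
      = 1 - plus_prob \<beta> n (mag n \<sigma> - real_of_int (\<sigma> ! v))"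
proof -
  define Z where "Z = (\<Sum>\<tau>\<in>config n. cw_weight \<beta> n \<tau>)"
  define y where "y = mag n \<sigma> - real_of_int (\<sigma> ! v)"
  define a where "a = \<beta> * y / real n"
  define b where "b = \<beta> / real n * ((y\<^sup>2 + 1 - real n) / 2)"
  have Z: "Z > 0" unfolding Z_def by (rule cw_partition_pos)
  have mu: "cw_mu \<beta> n (\<sigma>[v := s]) = exp (b + a * real_of_int s) / Z" if "s = 1 \<or> s = -1" for s
  proof -
    have "\<beta> / real n * cw_energy n (\<sigma>[v := s]) = b + a * real_of_int s"
      using that assms
      by (auto simp: cw_energy_eq config_update mag_update a_def b_def y_def power2_eq_square
          field_simps add_divide_distrib)
    then show ?thesis
      using that assms by (simp add: cw_mu_def config_update cw_weight_def Z_def)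
  qed
  have pos: "exp a + exp (-a) > 0" by (simp add: add_pos_pos)
  have t: "tanh a = (exp a - exp (-a)) / (exp a + exp (-a))"
    by (simp add: tanh_altdef)
  have m: "cw_mu \<beta> n (\<sigma>[v := 1]) = exp b / Z * exp a" "cw_mu \<beta> n (\<sigma>[v := -1]) = exp b / Z * exp (-a)"
    using mu[of 1] mu[of "-1"] by (simp_all flip: exp_add)
  have 1: "cw_mu \<beta> n (\<sigma>[v := 1]) / (cw_mu \<beta> n (\<sigma>[v := 1]) + cw_mu \<beta> n (\<sigma>[v := -1]))
    = exp a / (exp a + exp (-a))"
    unfolding m using Z by (simp flip: distrib_left add_divide_distrib)
  have 2: "cw_mu \<beta> n (\<sigma>[v := -1]) / (cw_mu \<beta> n (\<sigma>[v := 1]) + cw_mu \<beta> n (\<sigma>[v := -1]))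
    = exp (-a) / (exp a + exp (-a))"
    unfolding m using Z by (simp flip: distrib_left add_divide_distrib)
  have p: "plus_prob \<beta> n y = (1 + tanh a) / 2" by (simp add: plus_prob_def a_def)
  have 3: "(1 + tanh a) / 2 = exp a / (exp a + exp (-a))"
    unfolding t using pos by (simp add: divide_simps)
  have 4: "1 - (1 + tanh a) / 2 = exp (-a) / (exp a + exp (-a))"
    unfolding t using pos by (simp add: divide_simps)
  show "cw_mu \<beta> n (\<sigma>[v := 1]) / (cw_mu \<beta> n (\<sigma>[v := 1]) + cw_mu \<beta> n (\<sigma>[v := -1]))
      = plus_prob \<beta> n (mag n \<sigma> - real_of_int (\<sigma> ! v))"
    unfolding 1 y_def[symmetric] p 3 ..
  show "cw_mu \<beta> n (\<sigma>[v := -1]) / (cw_mu \<beta> n (\<sigma>[v := 1]) + cw_mu \<beta> n (\<sigma>[v := -1]))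
      = 1 - plus_prob \<beta> n (mag n \<sigma> - real_of_int (\<sigma> ! v))"
    unfolding 2 y_def[symmetric] p 4 ..
qed

lemma config_agree_off:
  assumes "\<sigma> \<in> config n" "v < n"
  shows "{\<tau> \<in> config n. \<forall>i<n. i \<noteq> v \<longrightarrow> \<tau> ! i = \<sigma> ! i} = {\<sigma>[v := 1], \<sigma>[v := -1]}"
proof (intro equalityI subsetI)
  fix \<tau> assume "\<tau> \<in> {\<tau> \<in> config n. \<forall>i<n. i \<noteq> v \<longrightarrow> \<tau> ! i = \<sigma> ! i}"
  then have t: "\<tau> \<in> config n" "\<forall>i<n. i \<noteq> v \<longrightarrow> \<tau> ! i = \<sigma> ! i" by auto
  have "\<tau> = \<sigma>[v := \<tau> ! v]"
    using t assms by (intro nth_equalityI) (auto simp: config_length nth_list_update)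
  then show "\<tau> \<in> {\<sigma>[v := 1], \<sigma>[v := -1]}"
    using config_nth[OF t(1) assms(2)] by auto
qed (use assms in \<open>auto simp: config_update\<close>)

lemma glauber_op_eq:
  assumes "\<sigma> \<in> config n"
  shows "glauber_op \<beta> n f \<sigma> = (\<Sum>v<n.
      plus_prob \<beta> n (mag n \<sigma> - real_of_int (\<sigma> ! v)) * f (\<sigma>[v := 1])
    + (1 - plus_prob \<beta> n (mag n \<sigma> - real_of_int (\<sigma> ! v))) * f (\<sigma>[v := -1])) / real n"
proof -
  define Z where "Z v = cw_mu \<beta> n (\<sigma>[v := 1]) + cw_mu \<beta> n (\<sigma>[v := -1])" for v
  have inner: "(\<Sum>\<tau>\<in>config n. (if \<tau> \<in> config n \<and> (\<forall>i<n. i \<noteq> v \<longrightarrow> \<tau> ! i = \<sigma> ! i)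
        then cw_mu \<beta> n \<tau> / Z v else 0) * f \<tau>)
      = plus_prob \<beta> n (mag n \<sigma> - real_of_int (\<sigma> ! v)) * f (\<sigma>[v := 1])
      + (1 - plus_prob \<beta> n (mag n \<sigma> - real_of_int (\<sigma> ! v))) * f (\<sigma>[v := -1])"
    if v: "v < n" for v
  proof -
    have "(\<Sum>\<tau>\<in>config n. (if \<tau> \<in> config n \<and> (\<forall>i<n. i \<noteq> v \<longrightarrow> \<tau> ! i = \<sigma> ! i)
        then cw_mu \<beta> n \<tau> / Z v else 0) * f \<tau>)
      = (\<Sum>\<tau>\<in>{\<tau> \<in> config n. \<forall>i<n. i \<noteq> v \<longrightarrow> \<tau> ! i = \<sigma> ! i}. cw_mu \<beta> n \<tau> / Z v * f \<tau>)"
      by (rule sum.mono_neutral_cong_right) (auto simp: finite_config)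
    also have "\<dots> = (\<Sum>\<tau>\<in>{\<sigma>[v := 1], \<sigma>[v := -1]}. cw_mu \<beta> n \<tau> / Z v * f \<tau>)"
      by (simp only: config_agree_off[OF assms v])
    also have "\<dots> = cw_mu \<beta> n (\<sigma>[v := 1]) / Z v * f (\<sigma>[v := 1])
        + cw_mu \<beta> n (\<sigma>[v := -1]) / Z v * f (\<sigma>[v := -1])"
    proof -
      have "\<sigma>[v := 1] ! v \<noteq> \<sigma>[v := -1] ! v" using assms v by (simp add: config_length)
      then have "\<sigma>[v := 1] \<noteq> \<sigma>[v := -1]" by metis
      then show ?thesis by simp
    qed
    finally show ?thesis
      using cw_mu_ratio[OF assms v, of \<beta>] by (simp add: Z_def)
  qed
  have "glauber_op \<beta> n f \<sigma> = (\<Sum>\<tau>\<in>config n. \<Sum>v<n.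
      (if \<tau> \<in> config n \<and> (\<forall>i<n. i \<noteq> v \<longrightarrow> \<tau> ! i = \<sigma> ! i)
        then cw_mu \<beta> n \<tau> / Z v else 0) * f \<tau> / real n)"
    unfolding glauber_op_def glauber_def Z_def
    by (simp add: sum_distrib_right sum_divide_distrib flip: times_divide_eq_left)
  also have "\<dots> = (\<Sum>v<n. (\<Sum>\<tau>\<in>config n. 
      (if \<tau> \<in> config n \<and> (\<forall>i<n. i \<noteq> v \<longrightarrow> \<tau> ! i = \<sigma> ! i)
        then cw_mu \<beta> n \<tau> / Z v else 0) * f \<tau>)) / real n"
    by (subst sum.swap) (simp add: sum_divide_distrib)
  also have "\<dots> = (\<Sum>v<n.
      plus_prob \<beta> n (mag n \<sigma> - real_of_int (\<sigma> ! v)) * f (\<sigma>[v := 1])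
    + (1 - plus_prob \<beta> n (mag n \<sigma> - real_of_int (\<sigma> ! v))) * f (\<sigma>[v := -1])) / real n"
    using inner by simp
  finally show ?thesis .
qed

section \<open>Stochasticity, reversibility and stationarity\<close>

lemma glauber_nonneg: "0 \<le> glauber \<beta> n \<sigma> \<tau>"
  unfolding glauber_def by (intro divide_nonneg_nonneg sum_nonneg) (auto simp: cw_mu_nonneg add_nonneg_nonneg)

lemma glauber_op_const: "\<sigma> \<in> config n \<Longrightarrow> n \<ge> 1 \<Longrightarrow> glauber_op \<beta> n (\<lambda>_. c) \<sigma> = c"
  by (simp add: glauber_op_eq flip: distrib_right)

lemma sum_glauber: "\<sigma> \<in> config n \<Longrightarrow> n \<ge> 1 \<Longrightarrow> (\<Sum>\<tau>\<in>config n. glauber \<beta> n \<sigma> \<tau>) = 1"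
  using glauber_op_const[of \<sigma> n \<beta> 1] by (simp add: glauber_op_def)

text \<open>Detailed balance holds vertex by vertex: configurations that agree off \<open>v\<close>
  share the normalizing denominator, so each summand is symmetric in \<sigma> and \<tau>.\<close>

lemma glauber_reversible:
  assumes "\<sigma> \<in> config n" "\<tau> \<in> config n"
  shows "cw_mu \<beta> n \<sigma> * glauber \<beta> n \<sigma> \<tau> = cw_mu \<beta> n \<tau> * glauber \<beta> n \<tau> \<sigma>"
proof -
  have eq: "\<sigma>[v := s] = \<tau>[v := s]" if "\<forall>i<n. i \<noteq> v \<longrightarrow> \<tau> ! i = \<sigma> ! i" for v s
  proof (rule nth_equalityI)
    fix i assume "i < length (\<sigma>[v := s])"
    then show "\<sigma>[v := s] ! i = \<tau>[v := s] ! i"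
      using that assms by (cases "v = i") (auto simp: config_length)
  qed (use assms in \<open>simp add: config_length\<close>)
  have "cw_mu \<beta> n \<sigma> * (if \<tau> \<in> config n \<and> (\<forall>i<n. i \<noteq> v \<longrightarrow> \<tau> ! i = \<sigma> ! i)
      then cw_mu \<beta> n \<tau> / (cw_mu \<beta> n (\<sigma>[v := 1]) + cw_mu \<beta> n (\<sigma>[v := -1])) else 0)
    = cw_mu \<beta> n \<tau> * (if \<sigma> \<in> config n \<and> (\<forall>i<n. i \<noteq> v \<longrightarrow> \<sigma> ! i = \<tau> ! i)
      then cw_mu \<beta> n \<sigma> / (cw_mu \<beta> n (\<tau>[v := 1]) + cw_mu \<beta> n (\<tau>[v := -1])) else 0)" for v
    using eq[of v] assms by (auto simp: mult.commute)
  then show ?thesis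
    unfolding glauber_def by (simp add: sum_distrib_left)
qed

lemma glauber_stationary:
  assumes "\<tau> \<in> config n" "n \<ge> 1"
  shows "(\<Sum>\<sigma>\<in>config n. cw_mu \<beta> n \<sigma> * glauber \<beta> n \<sigma> \<tau>) = cw_mu \<beta> n \<tau>"
proof -
  have "(\<Sum>\<sigma>\<in>config n. cw_mu \<beta> n \<sigma> * glauber \<beta> n \<sigma> \<tau>) = (\<Sum>\<sigma>\<in>config n. cw_mu \<beta> n \<tau> * glauber \<beta> n \<tau> \<sigma>)"
    by (rule sum.cong) (auto simp: glauber_reversible assms)
  also have "\<dots> = cw_mu \<beta> n \<tau>"
    using sum_glauber[OF assms] by (simp flip: sum_distrib_left)
  finally show ?thesis .
qed

lemma glauber_op_stationary:
  assumes "n \<ge> 1"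
  shows "(\<Sum>\<sigma>\<in>config n. cw_mu \<beta> n \<sigma> * glauber_op \<beta> n f \<sigma>) = (\<Sum>\<sigma>\<in>config n. cw_mu \<beta> n \<sigma> * f \<sigma>)"
proof -
  have "(\<Sum>\<sigma>\<in>config n. cw_mu \<beta> n \<sigma> * glauber_op \<beta> n f \<sigma>)
      = (\<Sum>\<tau>\<in>config n. (\<Sum>\<sigma>\<in>config n. cw_mu \<beta> n \<sigma> * glauber \<beta> n \<sigma> \<tau>) * f \<tau>)"
    unfolding glauber_op_def sum_distrib_left sum_distrib_right
    by (subst sum.swap) (simp add: mult.assoc)
  also have "\<dots> = (\<Sum>\<sigma>\<in>config n. cw_mu \<beta> n \<sigma> * f \<sigma>)"
    by (rule sum.cong) (auto simp: glauber_stationary[OF _ assms])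
  finally show ?thesis .
qed

text \<open>Passes from the evolved law, in which the distances are defined, to the evolved test
  function, on which all estimates are made.\<close>

lemma glauber_pow_op:
  "(\<Sum>\<tau>\<in>config n. glauber_pow \<beta> n t \<sigma> \<tau> * f \<tau>) = (glauber_op \<beta> n ^^ t) f \<sigma>" if "\<sigma> \<in> config n"
proof (induction t arbitrary: f)
  case 0
  show ?case using that finite_config[of n] by (simp add: if_distrib[of "\<lambda>x. x * _"] sum.delta cong: if_cong)
next
  case (Suc t)
  have "(\<Sum>\<tau>\<in>config n. glauber_pow \<beta> n (Suc t) \<sigma> \<tau> * f \<tau>)
      = (\<Sum>\<rho>\<in>config n. glauber_pow \<beta> n t \<sigma> \<rho> * glauber_op \<beta> n f \<rho>)"
    unfolding glauber_op_def glauber_pow.simps sum_distrib_left sum_distrib_right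
    by (subst sum.swap) (simp add: mult.assoc)
  also have "\<dots> = (glauber_op \<beta> n ^^ Suc t) f \<sigma>"
    using Suc by (simp add: funpow_swap1)
  finally show ?case .
qed

section \<open>Magnetization and spin swaps\<close>

lemma mono_id_minus_tanh: "x \<le> y \<Longrightarrow> x - tanh x \<le> y - tanh (y::real)"
proof (rule DERIV_nonneg_imp_nondecreasing[of x y "\<lambda>x. x - tanh x"])
  fix u :: real
  have "((\<lambda>x. x - tanh x) has_real_derivative 1 - (1 - (tanh u)\<^sup>2)) (at u)"
    by (auto intro!: derivative_eq_intros)
  then show "\<exists>d. ((\<lambda>x. x - tanh x) has_real_derivative d) (at u) \<and> 0 \<le> d"
    by (intro exI[of _ "1 - (1 - (tanh u)\<^sup>2)"]) auto
qed

lemma abs_tanh_diff_le: "\<bar>tanh x - tanh y\<bar> \<le> \<bar>x - (y::real)\<bar>"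
proof (induction x y rule: linorder_wlog)
  case (le x y)
  then show ?case using mono_id_minus_tanh[of x y] tanh_real_le_iff[of x y] by linarith
qed (simp add: abs_minus_commute)

lemma tanh_ge_frac: "0 \<le> u \<Longrightarrow> u / (1 + u) \<le> tanh (u::real)"
proof -
  assume u: "0 \<le> u"
  have e: "1 + 2 * u \<le> exp (2 * u)" by (rule exp_ge_add_one_self)
  have "tanh u = (1 - exp (- (2 * u))) / (1 + exp (- (2 * u)))"
    by (simp add: tanh_real_altdef)
  also have "\<dots> = (exp (2 * u) - 1) / (exp (2 * u) + 1)"
  proof -
    have *: "(1 - 1 / E) / (1 + 1 / E) = (E - 1) / (E + 1)" if "E > 0" for E :: real
      using that by (simp add: divide_simps)
    show ?thesis using *[of "exp (2 * u)"] by (simp add: exp_minus inverse_eq_divide)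
  qed
  finally have t: "tanh u = (exp (2 * u) - 1) / (exp (2 * u) + 1)" .
  have p: "exp (2 * u) + 1 > 0" by (simp add: add_pos_pos)
  show ?thesis
  proof -
    have "u * (exp (2 * u) + 1) \<le> (exp (2 * u) - 1) * (1 + u)"
      using e by (simp add: algebra_simps)
    then show ?thesis unfolding t using u p by (simp add: frac_le_eq divide_le_0_iff add_nonneg_pos pos_divide_le_eq pos_le_divide_eq)
  qed
qed

lemma tanh_sq_ge:
  assumes "\<bar>x\<bar> \<le> (2::real)"
  shows "x\<^sup>2 / 9 \<le> (tanh x)\<^sup>2"
proof -
  have "\<bar>x\<bar> / 3 \<le> \<bar>x\<bar> / (1 + \<bar>x\<bar>)"
    using assms by (intro divide_left_mono) auto
  also have "\<dots> \<le> tanh \<bar>x\<bar>" by (rule tanh_ge_frac) simp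
  finally have "\<bar>x\<bar> / 3 \<le> \<bar>tanh x\<bar>" by simp
  then have "(\<bar>x\<bar> / 3)\<^sup>2 \<le> \<bar>tanh x\<bar>\<^sup>2" by (intro power_mono) auto
  then show ?thesis by (simp add: power_divide)
qed

text \<open>Source of the cubic restoring force that remains when the linear drift cancels at
  \<beta> = 1. On \<open>[-2, 2]\<close> the function \<open>x - tanh x - x^3 / 27\<close> is
  nondecreasing, by \<open>tanh_sq_ge\<close>; with \<open>a^3 - b^3 \<ge> (a - b)^3 / 4\<close>
  this gives 108 = 27 * 4.\<close>

lemma tanh_diff_le_cubic:
  fixes a b :: real
  assumes "b \<le> a" "\<bar>a\<bar> \<le> 2" "\<bar>b\<bar> \<le> 2"
  shows "tanh a - tanh b \<le> (a - b) - (a - b) ^ 3 / 108"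
proof -
  have "b - tanh b - b ^ 3 / 27 \<le> a - tanh a - a ^ 3 / 27"
  proof (rule DERIV_nonneg_imp_nondecreasing[OF assms(1)])
    fix u assume u: "b \<le> u" "u \<le> a"
    have "((\<lambda>x. x - tanh x - x ^ 3 / 27) has_real_derivative 1 - (1 - (tanh u)\<^sup>2) - 3 * u\<^sup>2 / 27) (at u)"
      by (auto intro!: derivative_eq_intros)
    moreover have "u\<^sup>2 / 9 \<le> (tanh u)\<^sup>2" using u assms by (intro tanh_sq_ge) auto
    ultimately show "\<exists>d. ((\<lambda>x. x - tanh x - x ^ 3 / 27) has_real_derivative d) (at u) \<and> 0 \<le> d"
      by (intro exI[of _ "1 - (1 - (tanh u)\<^sup>2) - 3 * u\<^sup>2 / 27"]) auto
  qed
  moreover have "(a - b) ^ 3 / 4 \<le> a ^ 3 - b ^ 3"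
  proof -
    have "a ^ 3 - b ^ 3 - (a - b) ^ 3 / 4 = 3 / 4 * ((a - b) * (a + b)\<^sup>2)"
      by (simp add: power3_eq_cube power2_eq_square field_simps)
    moreover have "0 \<le> 3 / 4 * ((a - b) * (a + b)\<^sup>2)" using assms by simp
    ultimately show ?thesis by linarith
  qed
  ultimately show ?thesis by linarith
qed

section \<open>The magnetization as a birth-and-death chain\<close>

definition up_rate :: "real \<Rightarrow> nat \<Rightarrow> real \<Rightarrow> real" where
  "up_rate \<beta> n S = (real n - S) / (2 * real n) * plus_prob \<beta> n (S + 1)"

text \<open>A plus spin is picked with probability \<open>(n + S) / (2 n)\<close>, and the remaining
  spins then sum to \<open>S - 1\<close>. In \<open>up_rate\<close> a minus spin is picked and the
  remaining spins sum to \<open>S + 1\<close>.\<close>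

definition down_rate :: "real \<Rightarrow> nat \<Rightarrow> real \<Rightarrow> real" where
  "down_rate \<beta> n S = (real n + S) / (2 * real n) * (1 - plus_prob \<beta> n (S - 1))"

text \<open>A local field \<open>\<beta> y / n\<close> has modulus at most 4 when \<open>\<beta> \<le> 2\<close> and \<open>|y| \<le> n + 1\<close>, so either spin
  value is chosen with at least this probability.\<close>

definition min_prob :: real where "min_prob = (1 - tanh 4) / 2"

lemma min_prob_pos: "0 < min_prob"
  using tanh_real_lt_1[of 4] by (simp add: min_prob_def)

lemma min_prob_le: "min_prob \<le> 1 / 2"
  by (simp add: min_prob_def)

lemma plus_prob_bounds:
  assumes "0 \<le> \<beta>" "\<beta> \<le> 2" "n \<ge> 1" "\<bar>y\<bar> \<le> real n + 1"
  shows "min_prob \<le> plus_prob \<beta> n y" "plus_prob \<beta> n y \<le> 1 - min_prob"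
proof -
  have "\<bar>\<beta> * y / real n\<bar> = \<beta> * \<bar>y\<bar> / real n" using assms by (simp add: abs_mult)
  also have "\<dots> \<le> 2 * (2 * real n) / real n"
    using assms by (intro divide_right_mono mult_mono) auto
  also have "\<dots> = 4" using assms by simp
  finally have "\<bar>\<beta> * y / real n\<bar> \<le> 4" .
  then have "tanh (-4) \<le> tanh (\<beta> * y / real n)" "tanh (\<beta> * y / real n) \<le> tanh 4"
    by (subst tanh_real_le_iff, linarith)+
  then show "min_prob \<le> plus_prob \<beta> n y" "plus_prob \<beta> n y \<le> 1 - min_prob"
    by (auto simp: plus_prob_def min_prob_def field_simps)
qed

lemma abs_mag_le: "\<sigma> \<in> config n \<Longrightarrow> \<bar>mag n \<sigma>\<bar> \<le> real n"
proof -
  assume s: "\<sigma> \<in> config n"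
  have "\<bar>mag n \<sigma>\<bar> \<le> (\<Sum>v<n. \<bar>real_of_int (\<sigma> ! v)\<bar>)" unfolding mag_def by (rule sum_abs)
  also have "\<dots> \<le> (\<Sum>v<n. 1)" using config_nth[OF s] by (intro sum_mono) fastforce
  finally show ?thesis by simp
qed

lemma mag_parity:
  assumes "\<sigma> \<in> config n"
  obtains k :: int where "mag n \<sigma> = 2 * real_of_int k - real n"
proof -
  have "even (\<Sum>v<n. (\<sigma> ! v + 1))"
    using config_nth[OF assms] by (intro dvd_sum) fastforce
  then obtain k where "(\<Sum>v<n. (\<sigma> ! v + 1)) = 2 * k" by blast
  then have "(\<Sum>v<n. \<sigma> ! v) + int n = 2 * k" by (simp add: sum.distrib)
  then have "real_of_int ((\<Sum>v<n. \<sigma> ! v) + int n) = real_of_int (2 * k)" by simp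
  then show ?thesis by (intro that[of k]) (simp add: mag_def)
qed

text \<open>The magnetization is a Markov chain by itself: the effect of updating \<open>v\<close>
  depends on \<sigma> only through \<open>S\<close> and the spin at \<open>v\<close>, and
  \<open>(1 + s) / 2\<close>, \<open>(1 - s) / 2\<close> are the indicators of the two spin
  values.\<close>

lemma glauber_op_mag:
  assumes s: "\<sigma> \<in> config n" and n: "n \<ge> 1"
  shows "glauber_op \<beta> n (\<lambda>\<rho>. F (mag n \<rho>)) \<sigma> = F (mag n \<sigma>)
    + down_rate \<beta> n (mag n \<sigma>) * (F (mag n \<sigma> - 2) - F (mag n \<sigma>))
    + up_rate \<beta> n (mag n \<sigma>) * (F (mag n \<sigma> + 2) - F (mag n \<sigma>))"
proof -
  define S where "S = mag n \<sigma>"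
  define A where "A = (1 - plus_prob \<beta> n (S - 1)) * (F (S - 2) - F S)"
  define B where "B = plus_prob \<beta> n (S + 1) * (F (S + 2) - F S)"
  have "glauber_op \<beta> n (\<lambda>\<rho>. F (mag n \<rho>)) \<sigma>
      = (\<Sum>v<n. F S + (1 + real_of_int (\<sigma> ! v)) / 2 * A + (1 - real_of_int (\<sigma> ! v)) / 2 * B) / real n"
    unfolding glauber_op_eq[OF s]
  proof (intro arg_cong[where f = "\<lambda>x. x / real n"] sum.cong refl)
    fix v assume "v \<in> {..<n}"
    then have v: "v < n" by simp
    show "plus_prob \<beta> n (mag n \<sigma> - real_of_int (\<sigma> ! v)) * F (mag n (\<sigma>[v := 1])) +
         (1 - plus_prob \<beta> n (mag n \<sigma> - real_of_int (\<sigma> ! v))) * F (mag n (\<sigma>[v := - 1])) =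
         F S + (1 + real_of_int (\<sigma> ! v)) / 2 * A + (1 - real_of_int (\<sigma> ! v)) / 2 * B"
      using config_nth[OF s v] by (auto simp: mag_update[OF s v] S_def[symmetric] A_def B_def algebra_simps)
  qed
  also have "(\<Sum>v<n. F S + (1 + real_of_int (\<sigma> ! v)) / 2 * A + (1 - real_of_int (\<sigma> ! v)) / 2 * B)
      = real n * F S + (real n + S) / 2 * A + (real n - S) / 2 * B"
    unfolding S_def mag_def
    by (simp add: sum.distrib sum_subtractf flip: sum_distrib_right sum_divide_distrib)
  also have "\<dots> / real n = F S + (real n + S) / (2 * real n) * A + (real n - S) / (2 * real n) * B"
    using n by (simp add: field_simps)
  also have "\<dots> = F S + down_rate \<beta> n S * (F (S - 2) - F S) + up_rate \<beta> n S * (F (S + 2) - F S)"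
    by (simp add: down_rate_def up_rate_def A_def B_def mult.assoc)
  finally show ?thesis by (simp add: S_def)
qed

text \<open>The probabilities of picking a plus or a minus spin add up to 1, so the chance to move
  and the chance to stay are both at least \<open>min_prob\<close>, even at extreme magnetizations
  where one of the rates vanishes.\<close>

lemma rate_bounds:
  assumes "0 \<le> \<beta>" "\<beta> \<le> 2" "n \<ge> 1" "\<bar>S\<bar> \<le> real n"
  shows "min_prob * ((real n + S) / (2 * real n)) \<le> down_rate \<beta> n S"
    "min_prob * ((real n - S) / (2 * real n)) \<le> up_rate \<beta> n S"
    "min_prob \<le> down_rate \<beta> n S + up_rate \<beta> n S"
    "down_rate \<beta> n S + up_rate \<beta> n S \<le> 1 - min_prob"
    "0 \<le> down_rate \<beta> n S" "0 \<le> up_rate \<beta> n S"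
proof -
  define a b where "a = (real n + S) / (2 * real n)" and "b = (real n - S) / (2 * real n)"
  have ab: "0 \<le> a" "0 \<le> b" "a + b = 1"
    using assms by (auto simp: a_def b_def field_simps)
  have p: "min_prob \<le> plus_prob \<beta> n (S + 1)" "plus_prob \<beta> n (S + 1) \<le> 1 - min_prob"
    "min_prob \<le> 1 - plus_prob \<beta> n (S - 1)" "1 - plus_prob \<beta> n (S - 1) \<le> 1 - min_prob"
    using plus_prob_bounds[OF assms(1-3), of "S + 1"] plus_prob_bounds[OF assms(1-3), of "S - 1"] assms(4)
    by (smt (verit))+
  have d: "down_rate \<beta> n S = a * (1 - plus_prob \<beta> n (S - 1))" "up_rate \<beta> n S = b * plus_prob \<beta> n (S + 1)"
    by (simp_all add: down_rate_def up_rate_def a_def b_def)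
  have 1: "a * min_prob \<le> down_rate \<beta> n S" "b * min_prob \<le> up_rate \<beta> n S"
    unfolding d using p ab by (auto intro!: mult_left_mono)
  have 2: "down_rate \<beta> n S \<le> a * (1 - min_prob)" "up_rate \<beta> n S \<le> b * (1 - min_prob)"
    unfolding d using p ab by (auto intro!: mult_left_mono)
  show "min_prob * ((real n + S) / (2 * real n)) \<le> down_rate \<beta> n S"
    "min_prob * ((real n - S) / (2 * real n)) \<le> up_rate \<beta> n S"
    using 1 by (simp_all add: a_def b_def mult.commute)
  have "a * min_prob + b * min_prob = min_prob" "a * (1 - min_prob) + b * (1 - min_prob) = 1 - min_prob"
    using ab(3) by (simp_all flip: distrib_right)
  then show "min_prob \<le> down_rate \<beta> n S + up_rate \<beta> n S"
    "down_rate \<beta> n S + up_rate \<beta> n S \<le> 1 - min_prob"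
    using 1 2 by linarith+
  show "0 \<le> down_rate \<beta> n S" "0 \<le> up_rate \<beta> n S"
    unfolding d using ab p min_prob_pos by auto
qed

text \<open>The field at the chosen vertex comes from \<open>S - 1\<close> or \<open>S + 1\<close>
  instead of \<open>S\<close>; as \<open>tanh\<close> is 1-Lipschitz, this shifts the drift by at
  most \<beta> / n.\<close>

lemma glauber_op_mag_drift:
  assumes s: "\<sigma> \<in> config n" and n: "n \<ge> 1" and b: "0 \<le> \<beta>"
  shows "\<bar>(glauber_op \<beta> n (mag n) \<sigma> - mag n \<sigma>) - (tanh (\<beta> * mag n \<sigma> / real n) - mag n \<sigma> / real n)\<bar> \<le> \<beta> / real n"
proof -
  define S where "S = mag n \<sigma>"
  define a b where "a = (real n + S) / (2 * real n)" and "b = (real n - S) / (2 * real n)"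
  define T where "T x = tanh (\<beta> * x / real n)" for x
  have ab: "0 \<le> a" "0 \<le> b" "a + b = 1"
    using abs_mag_le[OF s] n by (auto simp: a_def b_def S_def field_simps)
  have ab': "a - b = S / real n" using n by (simp add: a_def b_def field_simps)
  have T: "\<bar>T x - T y\<bar> \<le> \<beta> / real n * \<bar>x - y\<bar>" for x y
  proof -
    have "\<bar>T x - T y\<bar> \<le> \<bar>\<beta> * x / real n - \<beta> * y / real n\<bar>" unfolding T_def by (rule abs_tanh_diff_le)
    also have "\<beta> * x / real n - \<beta> * y / real n = \<beta> / real n * (x - y)"
      by (simp add: diff_divide_distrib right_diff_distrib)
    also have "\<bar>\<dots>\<bar> = \<beta> / real n * \<bar>x - y\<bar>" using assms by (simp add: abs_mult)
    finally show ?thesis .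
  qed
  have "glauber_op \<beta> n (mag n) \<sigma> - S = 2 * up_rate \<beta> n S - 2 * down_rate \<beta> n S"
    using glauber_op_mag[OF s n, of \<beta> "\<lambda>x. x"] by (simp add: S_def)
  also have "\<dots> = a * T (S - 1) + b * T (S + 1) - (a - b)"
    unfolding up_rate_def down_rate_def plus_prob_def a_def[symmetric] b_def[symmetric] T_def[symmetric]
    by (simp add: field_simps)
  finally have "(glauber_op \<beta> n (mag n) \<sigma> - S) - (T S - S / real n)
      = a * T (S - 1) + b * T (S + 1) - (a + b) * T S"
    using ab ab' by simp
  also have "\<dots> = a * (T (S - 1) - T S) + b * (T (S + 1) - T S)" by (simp add: algebra_simps)
  also have "\<bar>\<dots>\<bar> \<le> a * (\<beta> / real n) + b * (\<beta> / real n)"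
  proof -
    have "\<bar>a * (T (S - 1) - T S)\<bar> \<le> a * (\<beta> / real n)" "\<bar>b * (T (S + 1) - T S)\<bar> \<le> b * (\<beta> / real n)"
      unfolding abs_mult using ab T[of "S - 1" S] T[of "S + 1" S]
      by (auto intro!: mult_left_mono simp del: times_divide_eq_right)
    then show ?thesis by linarith
  qed
  also have "\<dots> = \<beta> / real n" unfolding distrib_right[symmetric] ab(3) by simp
  finally show ?thesis by (simp add: S_def T_def)
qed

section \<open>Contraction along swaps of opposite spins\<close>

definition swap_lipschitz :: "nat \<Rightarrow> real \<Rightarrow> (int list \<Rightarrow> real) \<Rightarrow> bool" where
  "swap_lipschitz n L f \<longleftrightarrow> (\<forall>\<sigma>\<in>config n. \<forall>v<n. \<forall>w<n. \<sigma> ! v = 1 \<longrightarrow> \<sigma> ! w = -1 \<longrightarrow>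
     \<bar>f \<sigma> - f (\<sigma>[v := -1, w := 1])\<bar> \<le> L)"

lemma mag_swap:
  assumes "\<sigma> \<in> config n" "v < n" "w < n" "\<sigma> ! v = 1" "\<sigma> ! w = -1"
  shows "mag n (\<sigma>[v := -1, w := 1]) = mag n \<sigma>"
proof -
  have "v \<noteq> w" using assms by auto
  then show ?thesis using assms by (simp add: mag_update config_update)
qed

text \<open>Path coupling for one swap. Both configurations have the same magnetization, hence equal
  fields off \<open>v\<close> and \<open>w\<close>, and an update there preserves the swap relation.
  The loss comes from the two swapped vertices.\<close>

lemma swap_lipschitz_glauber_op:
  assumes b: "0 \<le> \<beta>" "\<beta> \<le> 2" and L: "swap_lipschitz n L f"
  shows "swap_lipschitz n (L * (1 - 2 * min_prob / real n)) (glauber_op \<beta> n f)"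
  unfolding swap_lipschitz_def
proof (intro ballI allI impI)
  fix \<sigma> v w assume s: "\<sigma> \<in> config n" and v: "v < n" and w: "w < n" and sv: "\<sigma> ! v = 1" and sw: "\<sigma> ! w = -1"
  define \<tau> where "\<tau> = \<sigma>[v := -1, w := 1]"
  have vw: "v \<noteq> w" using sv sw by auto
  have n: "n \<ge> 1" using v by simp
  have len: "length \<sigma> = n" using s by (rule config_length)
  have t: "\<tau> \<in> config n" unfolding \<tau>_def using s by (intro config_update) auto
  have mt: "mag n \<tau> = mag n \<sigma>" unfolding \<tau>_def using s v w sv sw by (rule mag_swap)
  define A where "A \<sigma> u = plus_prob \<beta> n (mag n \<sigma> - real_of_int (\<sigma> ! u)) * f (\<sigma>[u := 1])
    + (1 - plus_prob \<beta> n (mag n \<sigma> - real_of_int (\<sigma> ! u))) * f (\<sigma>[u := -1])" for \<sigma> u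
  have lip: "\<bar>f \<rho> - f (\<rho>[v := -1, w := 1])\<bar> \<le> L" if "\<rho> \<in> config n" "\<rho> ! v = 1" "\<rho> ! w = -1" for \<rho>
    using L that v w unfolding swap_lipschitz_def by blast
  have L0: "0 \<le> L" using lip[OF s sv sw] by linarith
  have split: "(\<Sum>u<n. g u) = (\<Sum>u\<in>{..<n} - {v, w}. g u) + (g v + g w)" for g :: "nat \<Rightarrow> real"
  proof -
    have "{..<n} = ({..<n} - {v, w}) \<union> {v, w}" using v w by auto
    then have "(\<Sum>u<n. g u) = (\<Sum>u\<in>({..<n} - {v, w}) \<union> {v, w}. g u)" by simp
    also have "\<dots> = (\<Sum>u\<in>{..<n} - {v, w}. g u) + (\<Sum>u\<in>{v, w}. g u)"
      by (rule sum.union_disjoint) auto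
    finally show ?thesis using vw by simp
  qed
  have rest: "\<bar>A \<sigma> u - A \<tau> u\<bar> \<le> L" if u: "u < n" "u \<noteq> v" "u \<noteq> w" for u
  proof -
    define p where "p = plus_prob \<beta> n (mag n \<sigma> - real_of_int (\<sigma> ! u))"
    have "\<bar>mag n \<sigma> - real_of_int (\<sigma> ! u)\<bar> \<le> real n + 1"
      using abs_mag_le[OF s] config_nth[OF s u(1)] by auto
    then have p: "0 \<le> p" "p \<le> 1"
      using plus_prob_bounds[OF b n] min_prob_pos unfolding p_def by (smt (verit))+
    have tu: "\<tau> ! u = \<sigma> ! u" using u by (simp add: \<tau>_def)
    have tus: "\<tau>[u := x] = (\<sigma>[u := x])[v := -1, w := 1]" for x
      unfolding \<tau>_def using u by (metis list_update_swap)
    have d: "\<bar>f (\<sigma>[u := x]) - f (\<tau>[u := x])\<bar> \<le> L" if "x = 1 \<or> x = -1" for x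
      unfolding tus using u s that sv sw by (intro lip) (auto simp: config_update)
    have "A \<sigma> u - A \<tau> u = p * (f (\<sigma>[u := 1]) - f (\<tau>[u := 1])) + (1 - p) * (f (\<sigma>[u := -1]) - f (\<tau>[u := -1]))"
      unfolding A_def mt tu p_def by (simp add: algebra_simps)
    also have "\<bar>\<dots>\<bar> \<le> p * L + (1 - p) * L"
    proof -
      have "\<bar>p * (f (\<sigma>[u := 1]) - f (\<tau>[u := 1]))\<bar> \<le> p * L"
        "\<bar>(1 - p) * (f (\<sigma>[u := -1]) - f (\<tau>[u := -1]))\<bar> \<le> (1 - p) * L"
        unfolding abs_mult using p d[of 1] d[of "-1"] by (auto intro!: mult_left_mono)
      then show ?thesis by linarith
    qed
    finally show ?thesis by (simp add: algebra_simps)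
  qed
  \<comment> \<open>Updating \<open>v\<close> in \<sigma> is matched with updating \<open>w\<close>
    in \<tau>, and \<open>w\<close> with \<open>v\<close>: the matched fields agree, and when the
    spin changes both configurations become the same one. They stay distinct only with weights
    \<open>p1\<close> and \<open>1 - p2\<close>.\<close>
  have pair: "\<bar>(A \<sigma> v + A \<sigma> w) - (A \<tau> v + A \<tau> w)\<bar> \<le> L * (2 - 2 * min_prob)"
  proof -
    define p1 p2 where "p1 = plus_prob \<beta> n (mag n \<sigma> - 1)" and "p2 = plus_prob \<beta> n (mag n \<sigma> + 1)"
    have p: "0 \<le> p1" "p1 \<le> 1 - min_prob" "min_prob \<le> p2" "p2 \<le> 1"
      using plus_prob_bounds[OF b n, of "mag n \<sigma> - 1"] plus_prob_bounds[OF b n, of "mag n \<sigma> + 1"]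
        abs_mag_le[OF s] min_prob_pos unfolding p1_def p2_def by linarith+
    have eqs: "\<sigma>[v := 1] = \<sigma>" "\<sigma>[w := -1] = \<sigma>" "\<tau>[w := 1] = \<tau>" "\<tau>[v := -1] = \<tau>"
      "\<tau>[w := -1] = \<sigma>[v := -1]" "\<tau>[v := 1] = \<sigma>[w := 1]" "\<tau> ! v = -1" "\<tau> ! w = 1"
      unfolding \<tau>_def using vw sv sw v w len
      by (auto intro!: nth_equalityI simp: nth_list_update)
    have "(A \<sigma> v + A \<sigma> w) - (A \<tau> v + A \<tau> w) = (p1 + (1 - p2)) * (f \<sigma> - f \<tau>)"
      unfolding A_def mt sv sw eqs p1_def p2_def by (simp add: algebra_simps)
    also have "\<bar>\<dots>\<bar> \<le> (2 - 2 * min_prob) * L"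
      unfolding abs_mult using p lip[OF s sv sw] by (intro mult_mono) (auto simp: \<tau>_def)
    finally show ?thesis by (simp add: mult.commute)
  qed
  have "\<bar>(\<Sum>u<n. A \<sigma> u) - (\<Sum>u<n. A \<tau> u)\<bar>
      = \<bar>(\<Sum>u\<in>{..<n} - {v, w}. A \<sigma> u - A \<tau> u) + ((A \<sigma> v + A \<sigma> w) - (A \<tau> v + A \<tau> w))\<bar>"
    unfolding split[of "A \<sigma>"] split[of "A \<tau>"] by (simp add: sum_subtractf algebra_simps)
  also have "\<dots> \<le> (\<Sum>u\<in>{..<n} - {v, w}. L) + L * (2 - 2 * min_prob)"
  proof -
    have "\<bar>\<Sum>u\<in>{..<n} - {v, w}. A \<sigma> u - A \<tau> u\<bar> \<le> (\<Sum>u\<in>{..<n} - {v, w}. \<bar>A \<sigma> u - A \<tau> u\<bar>)"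
      by (rule sum_abs)
    also have "\<dots> \<le> (\<Sum>u\<in>{..<n} - {v, w}. L)" using rest by (intro sum_mono) auto
    finally show ?thesis using pair by linarith
  qed
  also have "(\<Sum>u\<in>{..<n} - {v, w}. L) + L * (2 - 2 * min_prob) = (\<Sum>u<n. L) - 2 * L * min_prob"
    unfolding split[of "\<lambda>_. L"] by (simp add: algebra_simps)
  finally have D: "\<bar>(\<Sum>u<n. A \<sigma> u) - (\<Sum>u<n. A \<tau> u)\<bar> \<le> real n * L - 2 * L * min_prob" by simp
  have "glauber_op \<beta> n f \<sigma> - glauber_op \<beta> n f \<tau> = ((\<Sum>u<n. A \<sigma> u) - (\<Sum>u<n. A \<tau> u)) / real n"
    unfolding glauber_op_eq[OF s] glauber_op_eq[OF t] A_def by (simp add: diff_divide_distrib)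
  also have "\<bar>\<dots>\<bar> \<le> (real n * L - 2 * L * min_prob) / real n"
    using D n by (simp add: divide_right_mono)
  also have "\<dots> = L * (1 - 2 * min_prob / real n)" using n by (simp add: field_simps)
  finally show "\<bar>glauber_op \<beta> n f \<sigma> - glauber_op \<beta> n f (\<sigma>[v := - 1, w := 1])\<bar> \<le> L * (1 - 2 * min_prob / real n)"
    by (simp add: \<tau>_def)
qed

text \<open>Induction on the Hamming distance. Equal magnetizations with a disagreement force
  disagreements of both signs, since otherwise one configuration would dominate the other strictly;
  swapping such a pair lowers the distance.\<close>

lemma swap_lipschitz_eq_mag:
  assumes L: "swap_lipschitz n L f" "0 \<le> L"
    and "\<sigma> \<in> config n" "\<tau> \<in> config n" "mag n \<sigma> = mag n \<tau>"
  shows "\<bar>f \<sigma> - f \<tau>\<bar> \<le> L * real (card {v. v < n \<and> \<sigma> ! v \<noteq> \<tau> ! v})"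
  using assms(3-5)
proof (induction "card {v. v < n \<and> \<sigma> ! v \<noteq> \<tau> ! v}" arbitrary: \<sigma> rule: less_induct)
  case less
  define D where "D \<sigma> = {v. v < n \<and> \<sigma> ! v \<noteq> \<tau> ! v}" for \<sigma>
  have fin: "finite (D \<sigma>)" for \<sigma> unfolding D_def by simp
  show ?case
  proof (cases "\<sigma> = \<tau>")
    case True
    then show ?thesis by simp
  next
    case False
    have diff: "(\<Sum>v<n. real_of_int (\<sigma> ! v) - real_of_int (\<tau> ! v)) = 0"
      using less.prems(3) by (simp add: mag_def sum_subtractf)
    have ex: "\<exists>u<n. \<sigma> ! u \<noteq> \<tau> ! u"
      using False less.prems config_length by (metis nth_equalityI)
    have "\<exists>v<n. \<sigma> ! v = 1 \<and> \<tau> ! v = -1"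
    proof (rule ccontr)
      assume "\<not> ?thesis"
      then have le: "\<sigma> ! v \<le> \<tau> ! v" if "v < n" for v
        using that config_nth[OF less.prems(1) that] config_nth[OF less.prems(2) that] by fastforce
      obtain u where u: "u < n" "\<sigma> ! u \<noteq> \<tau> ! u" using ex by blast
      have "(\<Sum>v<n. real_of_int (\<sigma> ! v)) < (\<Sum>v<n. real_of_int (\<tau> ! v))"
        using le u order.not_eq_order_implies_strict[OF u(2) le[OF u(1)]]
        by (intro sum_strict_mono_ex1) (auto intro!: bexI[of _ u])
      then show False using diff by (simp add: sum_subtractf)
    qed
    then obtain v where v: "v < n" "\<sigma> ! v = 1" "\<tau> ! v = -1" by blast
    have "\<exists>w<n. \<sigma> ! w = -1 \<and> \<tau> ! w = 1"
    proof (rule ccontr)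
      assume "\<not> ?thesis"
      then have le: "\<tau> ! v \<le> \<sigma> ! v" if "v < n" for v
        using that config_nth[OF less.prems(1) that] config_nth[OF less.prems(2) that] by fastforce
      obtain u where u: "u < n" "\<sigma> ! u \<noteq> \<tau> ! u" using ex by blast
      have "(\<Sum>v<n. real_of_int (\<tau> ! v)) < (\<Sum>v<n. real_of_int (\<sigma> ! v))"
        using le u order.not_eq_order_implies_strict[OF u(2)[symmetric] le[OF u(1)]]
        by (intro sum_strict_mono_ex1) (auto intro!: bexI[of _ u])
      then show False using diff by (simp add: sum_subtractf)
    qed
    then obtain w where w: "w < n" "\<sigma> ! w = -1" "\<tau> ! w = 1" by blast
    define \<rho> where "\<rho> = \<sigma>[v := -1, w := 1]"
    have vw: "v \<noteq> w" using v w by auto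
    have r: "\<rho> \<in> config n" unfolding \<rho>_def using less.prems by (intro config_update) auto
    have m: "mag n \<rho> = mag n \<tau>" unfolding \<rho>_def using mag_swap[OF less.prems(1) v(1) w(1) v(2) w(2)] less.prems(3) by simp
    have sub: "D \<rho> \<subseteq> D \<sigma> - {v}" unfolding D_def \<rho>_def
      using v w vw config_length[OF less.prems(1)] by (auto simp: nth_list_update split: if_splits)
    have vD: "v \<in> D \<sigma>" using v by (simp add: D_def)
    have "card (D \<rho>) \<le> card (D \<sigma> - {v})" using sub fin by (intro card_mono) auto
    also have "\<dots> = card (D \<sigma>) - 1" using vD by simp
    finally have c: "card (D \<rho>) + 1 \<le> card (D \<sigma>)"
      using vD fin[of \<sigma>] by (metis One_nat_def Suc_eq_plus1 Suc_leI card_gt_0_iff empty_iff le_diff_conv2)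
    have "\<bar>f \<rho> - f \<tau>\<bar> \<le> L * real (card (D \<rho>))"
      unfolding D_def using c r m less.prems by (intro less.hyps) (auto simp: D_def)
    moreover have "\<bar>f \<sigma> - f \<rho>\<bar> \<le> L"
      using L less.prems v w unfolding swap_lipschitz_def \<rho>_def by blast
    moreover have "L * (real (card (D \<rho>)) + 1) \<le> L * real (card (D \<sigma>))"
      using c L(2) by (intro mult_left_mono) auto
    ultimately have "\<bar>f \<sigma> - f \<tau>\<bar> \<le> L * real (card (D \<sigma>))" by (simp add: algebra_simps)
    then show ?thesis by (simp add: D_def)
  qed
qed

lemma swap_lipschitz_funpow:
  assumes "0 \<le> \<beta>" "\<beta> \<le> 2" "swap_lipschitz n L f"
  shows "swap_lipschitz n (L * (1 - 2 * min_prob / real n) ^ t) ((glauber_op \<beta> n ^^ t) f)"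
proof (induction t)
  case (Suc t)
  then show ?case
    using swap_lipschitz_glauber_op[OF assms(1,2) Suc] by (simp add: mult_ac)
qed (use assms in simp)

lemma glauber_op_funpow_eq_mag:
  assumes b: "0 \<le> \<beta>" "\<beta> \<le> 2" and n: "n \<ge> 1" and f: "\<And>\<sigma>. \<sigma> \<in> config n \<Longrightarrow> \<bar>f \<sigma>\<bar> \<le> 1"
    and "\<sigma> \<in> config n" "\<tau> \<in> config n" "mag n \<sigma> = mag n \<tau>"
  shows "\<bar>(glauber_op \<beta> n ^^ t) f \<sigma> - (glauber_op \<beta> n ^^ t) f \<tau>\<bar> \<le> 2 * real n * (1 - 2 * min_prob / real n) ^ t"
proof -
  have "swap_lipschitz n 2 f" unfolding swap_lipschitz_def
  proof (intro ballI allI impI)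
    fix \<sigma> v w assume "\<sigma> \<in> config n"
    then have "\<bar>f \<sigma>\<bar> \<le> 1" "\<bar>f (\<sigma>[v := -1, w := 1])\<bar> \<le> 1" by (auto intro!: f config_update)
    then show "\<bar>f \<sigma> - f (\<sigma>[v := -1, w := 1])\<bar> \<le> 2" by linarith
  qed
  note L = swap_lipschitz_funpow[OF b this, of t]
  have "2 * min_prob / real n \<le> 1" using min_prob_le n by (simp add: field_simps)
  then have pos: "0 \<le> (1 - 2 * min_prob / real n) ^ t" by simp
  have "card {v. v < n \<and> \<sigma> ! v \<noteq> \<tau> ! v} \<le> card {..<n}" by (intro card_mono) auto
  then have c: "real (card {v. v < n \<and> \<sigma> ! v \<noteq> \<tau> ! v}) \<le> real n" by simp
  have "\<bar>(glauber_op \<beta> n ^^ t) f \<sigma> - (glauber_op \<beta> n ^^ t) f \<tau>\<bar>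
      \<le> 2 * (1 - 2 * min_prob / real n) ^ t * real (card {v. v < n \<and> \<sigma> ! v \<noteq> \<tau> ! v})"
    using L pos assms by (intro swap_lipschitz_eq_mag) auto
  also have "\<dots> \<le> 2 * (1 - 2 * min_prob / real n) ^ t * real n"
    using c pos by (intro mult_left_mono) auto
  finally show ?thesis by (simp add: mult_ac)
qed

section \<open>Coupling the magnetizations\<close>

lemma frac_concave:
  fixes w e :: real
  assumes "0 \<le> w" "0 \<le> w + e"
  shows "(w + e) / (1 + (w + e)) \<le> w / (1 + w) + e / (1 + w)\<^sup>2"
proof -
  have "w / (1 + w) + e / (1 + w)\<^sup>2 - (w + e) / (1 + (w + e)) = e\<^sup>2 / ((1 + w)\<^sup>2 * (1 + (w + e)))"
    using assms by (simp add: divide_simps power2_eq_square) (simp add: algebra_simps)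
  moreover have "0 \<le> e\<^sup>2 / ((1 + w)\<^sup>2 * (1 + (w + e)))" using assms by simp
  ultimately show ?thesis by linarith
qed

text \<open>Keeping a positive multiple of \<open>x^2\<close> for both signs of \<open>x\<close> is
  what converts the variance of an increment into a strict decrease.\<close>

lemma exp_ge_quadratic:
  fixes x :: real
  assumes "\<bar>x\<bar> \<le> 1 / 4"
  shows "1 - x + x\<^sup>2 / 4 \<le> exp (- x)"
proof (cases "x \<le> 0")
  case True
  then have "1 + (- x) + (- x)\<^sup>2 / 2 \<le> exp (- x)" by (intro exp_lower_Taylor_quadratic) simp
  moreover have "0 \<le> x\<^sup>2" by simp
  ultimately show ?thesis unfolding power2_minus by linarith
next
  case False
  have "exp (- 0) - 1 + 0 - 0\<^sup>2 / 4 \<le> exp (- x) - 1 + x - x\<^sup>2 / (4::real)"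
  proof (rule DERIV_nonneg_imp_nondecreasing[of 0 x "\<lambda>x. exp (- x) - 1 + x - x\<^sup>2 / 4"])
    fix u :: real assume u: "0 \<le> u" "u \<le> x"
    have "exp (- u) = 1 / exp u" by (simp add: exp_minus inverse_eq_divide)
    also have "\<dots> \<le> 1 / (1 + u)" using u exp_ge_add_one_self[of u] by (intro divide_left_mono) auto
    also have "\<dots> \<le> 1 - u / 2"
    proof -
      have "0 \<le> u * (1 - u)" using u assms by (intro mult_nonneg_nonneg) auto
      then show ?thesis using u by (simp add: divide_simps) (simp add: algebra_simps)
    qed
    finally have "0 \<le> - exp (- u) + 1 - u / 2" by simp
    moreover have "((\<lambda>x. exp (- x) - 1 + x - x\<^sup>2 / 4) has_real_derivative - exp (- u) + 1 - u / 2) (at u)"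
      by (auto intro!: derivative_eq_intros)
    ultimately show "\<exists>d. ((\<lambda>x. exp (- x) - 1 + x - x\<^sup>2 / 4) has_real_derivative d) (at u) \<and> 0 \<le> d"
      by blast
  qed (use False in simp)
  then show ?thesis by simp
qed

text \<open>The exponential term is concave enough to beat the bounded drift near 0; the bounded rational term
  has derivative \<open>1 / (1 + w)\<^sup>2\<close>, which the cubic drift turns into a decrease of order 1 for large \<open>w\<close>.\<close>

definition profile :: "real \<Rightarrow> real \<Rightarrow> real \<Rightarrow> real" where
  "profile A l w = A * (1 - exp (- (l * w))) + w / (1 + w)"

lemma profile_bounds:
  assumes "0 \<le> A" "0 \<le> l" "0 \<le> w"
  shows "0 \<le> profile A l w" "profile A l w \<le> A + 1"
proof -
  have "0 \<le> A * (1 - exp (- (l * w)))" using assms by (intro mult_nonneg_nonneg) auto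
  then show "0 \<le> profile A l w" using assms by (simp add: profile_def)
  have "A * (1 - exp (- (l * w))) \<le> A * 1" using assms by (intro mult_left_mono) auto
  moreover have "w / (1 + w) \<le> 1" using assms by simp
  ultimately show "profile A l w \<le> A + 1" by (simp add: profile_def)
qed

text \<open>The weights \<open>q\<close> are the law of one increment \<eta>, and \<open>e\<close>
  is the duration of a step in rescaled time. Second-order expansion of the exponential part and the
  tangent line of the rational part reduce the claim to the scalar inequality
  \<open>c b + A l E (b - l s / 4) \<le> -1\<close> for the drift bound \<open>b\<close>.\<close>

lemma contracting_profile:
  fixes K s :: real
  assumes K: "0 \<le> K" and s: "0 < s"
  obtains A l where "0 \<le> A" "0 < l"
    "\<And>(I :: 'a set) q \<eta> w e. finite I \<Longrightarrow> (\<And>i. i \<in> I \<Longrightarrow> 0 \<le> q i) \<Longrightarrow> (\<Sum>i\<in>I. q i) = 1 \<Longrightarrow> 0 \<le> w \<Longrightarrow>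
      (\<And>i. i \<in> I \<Longrightarrow> q i \<noteq> 0 \<Longrightarrow> 0 \<le> w + \<eta> i \<and> l * \<bar>\<eta> i\<bar> \<le> 1 / 4) \<Longrightarrow> 0 \<le> e \<Longrightarrow>
      (\<Sum>i\<in>I. q i * \<eta> i) \<le> e * (K * w - w ^ 3 / 864 + 4) \<Longrightarrow>
      e * s \<le> (\<Sum>i\<in>I. q i * (\<eta> i)\<^sup>2) \<Longrightarrow>
      (\<Sum>i\<in>I. q i * profile A l (w + \<eta> i)) \<le> profile A l w - e"
proof -
  define b where "b w = K * w - w ^ 3 / 864 + 4" for w :: real
  \<comment> \<open>Beyond \<open>w1\<close> the cubic term exceeds \<open>(K + 10) w^2\<close>,
    which beats \<open>K w\<close>, the constant 4 and \<open>(1 + w)^2 \<le> 4 w^2\<close>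
    together.\<close>
  define w1 where "w1 = 864 * (K + 10)"
  define B where "B = K * w1 + 4"
  \<comment> \<open>Makes the second-order gain \<open>l s / 4\<close> equal to
    \<open>B + 1\<close>, one more than the largest possible drift \<open>B\<close>.\<close>
  define l where "l = 4 * (B + 1) / s"
  \<comment> \<open>Makes \<open>A l exp (- (l w)) \<ge> B + 1\<close> for every
    \<open>w \<le> w1\<close>.\<close>
  define A where "A = (B + 1) * exp (l * w1) / l"
  have w1: "w1 \<ge> 1" using K by (simp add: w1_def)
  have B: "B \<ge> 0" using K w1 by (simp add: B_def)
  have l: "l > 0" using B s by (simp add: l_def)
  have A: "A \<ge> 0" using B l by (simp add: A_def)
  have b_large: "b w \<le> - (1 + w)\<^sup>2" if w: "w1 \<le> w" for w
  proof -
    have w': "1 \<le> w" using w w1 by simp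
    have "w\<^sup>2 * (864 * (K + 10)) \<le> w\<^sup>2 * w" using w by (intro mult_left_mono) (auto simp: w1_def)
    then have "(K + 10) * w\<^sup>2 \<le> w ^ 3 / 864" by (simp add: power2_eq_square power3_eq_cube algebra_simps)
    moreover have "w \<le> w\<^sup>2" "1 \<le> w\<^sup>2" using w' by (simp_all add: self_le_power)
    moreover have "K * w \<le> K * w\<^sup>2" using K \<open>w \<le> w\<^sup>2\<close> by (rule mult_left_mono[rotated])
    ultimately show ?thesis by (simp add: b_def power2_sum algebra_simps)
  qed
  have b_le: "b w \<le> B" if w: "0 \<le> w" for w
  proof (cases "w1 \<le> w")
    case True
    have "b w \<le> 0" using b_large[OF True] by (smt (verit) zero_le_power2)
    then show ?thesis using B by simp
  next
    case False
    then have "K * w \<le> K * w1" using K by (intro mult_left_mono) auto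
    moreover have "0 \<le> w ^ 3" using w by simp
    ultimately show ?thesis unfolding b_def B_def by linarith
  qed
  have main: "(\<Sum>i\<in>I. q i * profile A l (w + \<eta> i)) \<le> profile A l w - e"
    if I: "finite I" "\<And>i. i \<in> I \<Longrightarrow> 0 \<le> q i" "(\<Sum>i\<in>I. q i) = 1" and w: "0 \<le> w"
      and eta: "\<And>i. i \<in> I \<Longrightarrow> q i \<noteq> 0 \<Longrightarrow> 0 \<le> w + \<eta> i \<and> l * \<bar>\<eta> i\<bar> \<le> 1 / 4" and e: "0 \<le> e"
      and m1: "(\<Sum>i\<in>I. q i * \<eta> i) \<le> e * (K * w - w ^ 3 / 864 + 4)"
      and m2: "e * s \<le> (\<Sum>i\<in>I. q i * (\<eta> i)\<^sup>2)"
    for I :: "'a set" and q \<eta> w e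
  proof -
    define E where "E = exp (- (l * w))"
    define x y where "x = (\<Sum>i\<in>I. q i * \<eta> i)" and "y = (\<Sum>i\<in>I. q i * (\<eta> i)\<^sup>2)"
    define c where "c = 1 / (1 + w)\<^sup>2"
    have E: "E > 0" by (simp add: E_def)
    have c: "c > 0" "c \<le> 1" using w by (auto simp: c_def divide_simps)
    have pw: "q i * profile A l (w + \<eta> i) \<le> q i * (profile A l w + c * \<eta> i + A * E * (l * \<eta> i - l\<^sup>2 * (\<eta> i)\<^sup>2 / 4))"
      if i: "i \<in> I" for i
    proof (cases "q i = 0")
      case False
      have h: "0 \<le> w + \<eta> i" "l * \<bar>\<eta> i\<bar> \<le> 1 / 4" using eta[OF i False] by auto
      have "1 - l * \<eta> i + (l * \<eta> i)\<^sup>2 / 4 \<le> exp (- (l * \<eta> i))"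
        using h l by (intro exp_ge_quadratic) (simp add: abs_mult)
      then have "A * E * (1 - l * \<eta> i + (l * \<eta> i)\<^sup>2 / 4) \<le> A * E * exp (- (l * \<eta> i))"
        using A E by (intro mult_left_mono) auto
      also have "\<dots> = A * exp (- (l * (w + \<eta> i)))"
        by (simp add: E_def algebra_simps flip: exp_add)
      finally have 1: "A * E * (1 - l * \<eta> i + (l * \<eta> i)\<^sup>2 / 4) \<le> A * exp (- (l * (w + \<eta> i)))" .
      have 2: "(w + \<eta> i) / (1 + (w + \<eta> i)) \<le> w / (1 + w) + c * \<eta> i"
        using frac_concave[OF w h(1)] by (simp add: c_def)
      have "profile A l (w + \<eta> i) \<le> profile A l w + c * \<eta> i + A * E * (l * \<eta> i - l\<^sup>2 * (\<eta> i)\<^sup>2 / 4)"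
        using 1 2 by (simp add: profile_def E_def[symmetric] power_mult_distrib algebra_simps)
      then show ?thesis using I(2)[OF i] by (rule mult_left_mono)
    qed simp
    have "(\<Sum>i\<in>I. q i * profile A l (w + \<eta> i))
        \<le> (\<Sum>i\<in>I. q i * (profile A l w + c * \<eta> i + A * E * (l * \<eta> i - l\<^sup>2 * (\<eta> i)\<^sup>2 / 4)))"
      using pw by (rule sum_mono)
    also have "\<dots> = (\<Sum>i\<in>I. profile A l w * q i + c * (q i * \<eta> i) + A * E * l * (q i * \<eta> i) - A * E * l\<^sup>2 / 4 * (q i * (\<eta> i)\<^sup>2))"
      by (rule sum.cong) (auto simp: algebra_simps)
    also have "\<dots> = profile A l w + c * x + A * E * l * x - A * E * l\<^sup>2 / 4 * y"
      unfolding sum.distrib sum_subtractf x_def y_def sum_distrib_left[symmetric] I(3) by simp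
    also have "\<dots> \<le> profile A l w + c * (e * b w) + A * E * l * (e * b w) - A * E * l\<^sup>2 / 4 * (e * s)"
    proof -
      have "c * x \<le> c * (e * b w)" using m1 c by (intro mult_left_mono) (auto simp: x_def b_def)
      moreover have "A * E * l * x \<le> A * E * l * (e * b w)"
        using m1 A E l by (intro mult_left_mono) (auto simp: x_def b_def)
      moreover have "A * E * l\<^sup>2 / 4 * (e * s) \<le> A * E * l\<^sup>2 / 4 * y"
        using m2 A E l by (intro mult_left_mono) (auto simp: y_def)
      ultimately show ?thesis by linarith
    qed
    also have "\<dots> = profile A l w + e * (c * b w + A * l * E * (b w - l * s / 4))"
      by (simp add: algebra_simps power2_eq_square)
    also have "\<dots> \<le> profile A l w + e * (-1)"
    proof -
      have ls: "l * s / 4 = B + 1" using s by (simp add: l_def)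
      have Al: "A * l = (B + 1) * exp (l * w1)" using l by (simp add: A_def)
      have "A * l * E * (b w - l * s / 4) \<le> A * l * E * (-1)"
        unfolding ls using A l E b_le[OF w] by (intro mult_left_mono) auto
      moreover have "c * b w - A * l * E \<le> -1"
      \<comment> \<open>For large \<open>w\<close> the rational part alone contributes -1; for small
        \<open>w\<close> its contribution is at most \<open>B\<close> and is absorbed by the
        exponential part.\<close>
      proof (cases "w1 \<le> w")
        case True
        have "c * b w \<le> c * (- (1 + w)\<^sup>2)" using b_large[OF True] c by (intro mult_left_mono) auto
        also have "\<dots> = -1" using w by (simp add: c_def)
        finally show ?thesis using A l E by (smt (verit) mult_nonneg_nonneg)
      next
        case False
        have "c * b w \<le> c * B" using b_le[OF w] c by (intro mult_left_mono) auto
        also have "\<dots> \<le> 1 * B" using B c by (intro mult_right_mono) auto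
        finally have 1: "c * b w \<le> B" by simp
        have "A * l * E = (B + 1) * exp (l * (w1 - w))"
          unfolding Al E_def by (simp add: algebra_simps flip: exp_add)
        moreover have "1 \<le> exp (l * (w1 - w))" using False l by simp
        ultimately have "B + 1 \<le> A * l * E" using B mult_left_mono[of 1 "exp (l * (w1 - w))" "B + 1"] by simp
        then show ?thesis using 1 by linarith
      qed
      ultimately have "c * b w + A * l * E * (b w - l * s / 4) \<le> -1" by linarith
      then show ?thesis using e by (intro add_left_mono mult_left_mono)
    qed
    finally show ?thesis by simp
  qed
  show ?thesis using that[OF A l] main by blast
qed

text \<open>The operator annihilates, at \<sigma>, the indicator of jumps larger than 2; all terms
  of that sum are nonnegative, so each of them vanishes.\<close>

lemma glauber_mag_support:
  assumes "\<sigma> \<in> config n" "n \<ge> 1" "\<rho> \<in> config n" "glauber \<beta> n \<sigma> \<rho> \<noteq> 0"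
  shows "\<bar>mag n \<rho> - mag n \<sigma>\<bar> \<le> 2"
proof (rule ccontr)
  assume far: "\<not> ?thesis"
  define F where "F x = (if \<bar>x - mag n \<sigma>\<bar> \<le> 2 then 0 else 1 :: real)" for x
  have "glauber_op \<beta> n (\<lambda>\<rho>. F (mag n \<rho>)) \<sigma> = 0"
    unfolding glauber_op_mag[OF assms(1,2)] by (simp add: F_def)
  then have "glauber \<beta> n \<sigma> \<rho> * F (mag n \<rho>) = 0"
    unfolding glauber_op_def
    by (subst (asm) sum_nonneg_eq_0_iff) (auto simp: finite_config assms(3) F_def glauber_nonneg)
  then show False using assms(4) far by (simp add: F_def)
qed

section \<open>Two independent copies of the chain\<close>

definition pair_op :: "real \<Rightarrow> nat \<Rightarrow> (int list \<Rightarrow> int list \<Rightarrow> real) \<Rightarrow> int list \<Rightarrow> int list \<Rightarrow> real" where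
  "pair_op \<beta> n G \<sigma> \<tau> = (\<Sum>(\<rho>, \<rho>')\<in>config n \<times> config n. glauber \<beta> n \<sigma> \<rho> * glauber \<beta> n \<tau> \<rho>' * G \<rho> \<rho>')"

text \<open>Independence enters here: expectations of products factor, which reduces meeting
  probabilities and moments of the difference to single-chain computations.\<close>

lemma pair_op_prod: "pair_op \<beta> n (\<lambda>\<rho> \<rho>'. f \<rho> * g \<rho>') \<sigma> \<tau> = glauber_op \<beta> n f \<sigma> * glauber_op \<beta> n g \<tau>"
  unfolding pair_op_def glauber_op_def sum_product sum.cartesian_product
  by (rule sum.cong) auto

lemma pair_op_add: "pair_op \<beta> n (\<lambda>\<rho> \<rho>'. f \<rho> \<rho>' + g \<rho> \<rho>') \<sigma> \<tau> = pair_op \<beta> n f \<sigma> \<tau> + pair_op \<beta> n g \<sigma> \<tau>"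
  unfolding pair_op_def by (simp add: algebra_simps case_prod_unfold sum.distrib)

lemma pair_op_cmult: "pair_op \<beta> n (\<lambda>\<rho> \<rho>'. c * f \<rho> \<rho>') \<sigma> \<tau> = c * pair_op \<beta> n f \<sigma> \<tau>"
  unfolding pair_op_def sum_distrib_left by (rule sum.cong) auto

lemma pair_op_diff:
  assumes "\<sigma> \<in> config n" "\<tau> \<in> config n" "n \<ge> 1"
  shows "pair_op \<beta> n (\<lambda>\<rho> \<rho>'. f \<rho> - g \<rho>') \<sigma> \<tau> = glauber_op \<beta> n f \<sigma> - glauber_op \<beta> n g \<tau>"
proof -
  have "pair_op \<beta> n (\<lambda>\<rho> \<rho>'. f \<rho> * 1 + (-1) * g \<rho>') \<sigma> \<tau>
      = glauber_op \<beta> n f \<sigma> * 1 + glauber_op \<beta> n (\<lambda>_. -1) \<sigma> * glauber_op \<beta> n g \<tau>"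
    unfolding pair_op_add pair_op_prod[of \<beta> n f "\<lambda>_. 1"] pair_op_prod[of \<beta> n "\<lambda>_. -1" g]
    using assms by (simp add: glauber_op_const)
  then show ?thesis using assms by (simp add: glauber_op_const)
qed

lemma pair_op_const:
  assumes "\<sigma> \<in> config n" "\<tau> \<in> config n" "n \<ge> 1"
  shows "pair_op \<beta> n (\<lambda>\<rho> \<rho>'. c) \<sigma> \<tau> = c"
  using pair_op_prod[of \<beta> n "\<lambda>_. c" "\<lambda>_. 1" \<sigma> \<tau>] assms by (simp add: glauber_op_const)

lemma pair_op_mono:
  assumes "\<And>\<rho> \<rho>'. \<rho> \<in> config n \<Longrightarrow> \<rho>' \<in> config n \<Longrightarrow> glauber \<beta> n \<sigma> \<rho> \<noteq> 0 \<Longrightarrow> glauber \<beta> n \<tau> \<rho>' \<noteq> 0 \<Longrightarrow>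
    f \<rho> \<rho>' \<le> g \<rho> \<rho>'"
  shows "pair_op \<beta> n f \<sigma> \<tau> \<le> pair_op \<beta> n g \<sigma> \<tau>"
  unfolding pair_op_def
proof (rule sum_mono, clarify)
  fix \<rho> \<rho>' assume "\<rho> \<in> config n" "\<rho>' \<in> config n"
  then show "glauber \<beta> n \<sigma> \<rho> * glauber \<beta> n \<tau> \<rho>' * f \<rho> \<rho>' \<le> glauber \<beta> n \<sigma> \<rho> * glauber \<beta> n \<tau> \<rho>' * g \<rho> \<rho>'"
    using assms[of \<rho> \<rho>'] glauber_nonneg[of \<beta> n \<sigma> \<rho>] glauber_nonneg[of \<beta> n \<tau> \<rho>']
    by (cases "glauber \<beta> n \<sigma> \<rho> = 0"; cases "glauber \<beta> n \<tau> \<rho>' = 0") (simp_all add: mult_left_mono)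
qed

lemma prob_mag_eq:
  assumes s: "\<sigma> \<in> config n" and n: "n \<ge> 1"
  shows "glauber_op \<beta> n (\<lambda>\<rho>. of_bool (mag n \<rho> = mag n \<sigma>)) \<sigma> = 1 - down_rate \<beta> n (mag n \<sigma>) - up_rate \<beta> n (mag n \<sigma>)"
    "glauber_op \<beta> n (\<lambda>\<rho>. of_bool (mag n \<rho> \<noteq> mag n \<sigma>)) \<sigma> = down_rate \<beta> n (mag n \<sigma>) + up_rate \<beta> n (mag n \<sigma>)"
    "glauber_op \<beta> n (\<lambda>\<rho>. of_bool (mag n \<rho> = mag n \<sigma> - 2)) \<sigma> = down_rate \<beta> n (mag n \<sigma>)"
    "glauber_op \<beta> n (\<lambda>\<rho>. of_bool (mag n \<rho> = mag n \<sigma> + 2)) \<sigma> = up_rate \<beta> n (mag n \<sigma>)"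
  using glauber_op_mag[OF s n, of \<beta> "\<lambda>x. of_bool (x = mag n \<sigma>)"]
    glauber_op_mag[OF s n, of \<beta> "\<lambda>x. of_bool (x \<noteq> mag n \<sigma>)"]
    glauber_op_mag[OF s n, of \<beta> "\<lambda>x. of_bool (x = mag n \<sigma> - 2)"]
    glauber_op_mag[OF s n, of \<beta> "\<lambda>x. of_bool (x = mag n \<sigma> + 2)"]
  by auto

lemma mag_eq_or_ge_2:
  assumes "\<rho> \<in> config n" "\<sigma> \<in> config n" "mag n \<rho> \<noteq> mag n \<sigma>"
  shows "\<bar>mag n \<rho> - mag n \<sigma>\<bar> \<ge> 2"
proof -
  obtain j k where "mag n \<rho> = 2 * real_of_int j - real n" "mag n \<sigma> = 2 * real_of_int k - real n"
    using assms mag_parity by metis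
  moreover from this have "j \<noteq> k" using assms(3) by auto
  then have "1 \<le> \<bar>j - k\<bar>" by linarith
  then have "1 \<le> \<bar>real_of_int j - real_of_int k\<bar>" by linarith
  ultimately show ?thesis by auto
qed

text \<open>The difference changes by at most 4 in a joint step, so from 4 onwards the order cannot
  be reversed; distance 2 is the only case that needs separate treatment.\<close>

lemma mag_diff_cases:
  assumes "\<rho> \<in> config n" "\<sigma> \<in> config n" "mag n \<rho> > mag n \<sigma>"
  shows "mag n \<rho> = mag n \<sigma> + 2 \<or> mag n \<rho> \<ge> mag n \<sigma> + 4"
proof -
  obtain j k where jk: "mag n \<rho> = 2 * real_of_int j - real n" "mag n \<sigma> = 2 * real_of_int k - real n"
    using assms mag_parity by metis
  then have "j > k" using assms(3) by auto
  then have "j = k + 1 \<or> j \<ge> k + 2" by linarith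
  then have "real_of_int j = real_of_int k + 1 \<or> real_of_int j \<ge> real_of_int k + 2" by linarith
  then show ?thesis using jk by auto
qed

text \<open>Only the event that the first chain moves while the second stays is counted: it has
  probability at least \<open>min_prob^2\<close>, and by parity the move is at least 2.\<close>

lemma pair_mag_second_moment:
  assumes b: "0 \<le> \<beta>" "\<beta> \<le> 2" and n: "n \<ge> 1" and s: "\<sigma> \<in> config n" and t: "\<tau> \<in> config n"
  shows "4 * min_prob\<^sup>2 \<le> pair_op \<beta> n (\<lambda>\<rho> \<rho>'. ((mag n \<rho> - mag n \<rho>') - (mag n \<sigma> - mag n \<tau>))\<^sup>2) \<sigma> \<tau>"
proof -
  have "min_prob * min_prob \<le> glauber_op \<beta> n (\<lambda>\<rho>. of_bool (mag n \<rho> \<noteq> mag n \<sigma>)) \<sigma>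
      * glauber_op \<beta> n (\<lambda>\<rho>. of_bool (mag n \<rho> = mag n \<tau>)) \<tau>"
    unfolding prob_mag_eq[OF s n] prob_mag_eq[OF t n]
    using rate_bounds[OF b n abs_mag_le[OF s]] rate_bounds[OF b n abs_mag_le[OF t]] min_prob_pos
    by (intro mult_mono) auto
  then have "4 * min_prob\<^sup>2 \<le> 4 * pair_op \<beta> n (\<lambda>\<rho> \<rho>'. of_bool (mag n \<rho> \<noteq> mag n \<sigma>) * of_bool (mag n \<rho>' = mag n \<tau>)) \<sigma> \<tau>"
    unfolding pair_op_prod by (simp add: power2_eq_square)
  also have "\<dots> = pair_op \<beta> n (\<lambda>\<rho> \<rho>'. 4 * (of_bool (mag n \<rho> \<noteq> mag n \<sigma>) * of_bool (mag n \<rho>' = mag n \<tau>))) \<sigma> \<tau>"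
    by (rule pair_op_cmult[symmetric])
  also have "\<dots> \<le> pair_op \<beta> n (\<lambda>\<rho> \<rho>'. ((mag n \<rho> - mag n \<rho>') - (mag n \<sigma> - mag n \<tau>))\<^sup>2) \<sigma> \<tau>"
  proof (rule pair_op_mono)
    fix \<rho> \<rho>' assume r: "\<rho> \<in> config n" "\<rho>' \<in> config n"
    show "4 * (of_bool (mag n \<rho> \<noteq> mag n \<sigma>) * of_bool (mag n \<rho>' = mag n \<tau>))
        \<le> ((mag n \<rho> - mag n \<rho>') - (mag n \<sigma> - mag n \<tau>))\<^sup>2"
    proof (cases "mag n \<rho> \<noteq> mag n \<sigma> \<and> mag n \<rho>' = mag n \<tau>")
      case True
      then have "2\<^sup>2 \<le> \<bar>mag n \<rho> - mag n \<sigma>\<bar>\<^sup>2" using mag_eq_or_ge_2[OF r(1) s] by (intro power_mono) auto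
      then show ?thesis using True by simp
    qed auto
  qed
  finally show ?thesis .
qed

text \<open>Subtract the drifts of the two chains. Here 864 = 108 * 8, since \<beta> \<ge> 1/2 gives
  \<open>\<beta>^3 \<ge> 1/8\<close>, and 4 bounds twice \<beta>, one drift error per chain.\<close>

lemma pair_mag_drift:
  assumes b: "1 / 2 \<le> \<beta>" "\<beta> \<le> 2" and n: "n \<ge> 1" and s: "\<sigma> \<in> config n" and t: "\<tau> \<in> config n"
    and st: "mag n \<tau> \<le> mag n \<sigma>"
  defines "z \<equiv> mag n \<sigma> - mag n \<tau>"
  shows "pair_op \<beta> n (\<lambda>\<rho> \<rho>'. mag n \<rho> - mag n \<rho>' - z) \<sigma> \<tau>
    \<le> (\<beta> - 1) * z / real n - (z / real n) ^ 3 / 864 + 4 / real n"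
proof -
  define a c where "a = \<beta> * mag n \<sigma> / real n" and "c = \<beta> * mag n \<tau> / real n"
  have bd: "\<bar>\<beta> * mag n \<rho> / real n\<bar> \<le> 2" if "\<rho> \<in> config n" for \<rho>
  proof -
    have "\<bar>\<beta> * mag n \<rho> / real n\<bar> = \<beta> * \<bar>mag n \<rho>\<bar> / real n" using b by (simp add: abs_mult)
    also have "\<dots> \<le> 2 * real n / real n"
      using b abs_mag_le[OF that] by (intro divide_right_mono mult_mono) auto
    finally show ?thesis using n by simp
  qed
  have z: "0 \<le> z" using st by (simp add: z_def)
  have ac: "a - c = \<beta> * (z / real n)" by (simp add: a_def c_def z_def diff_divide_distrib algebra_simps)
  have "0 \<le> \<beta> * (z / real n)" using z b by simp
  then have "c \<le> a" using ac by linarith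
  then have th: "tanh a - tanh c \<le> \<beta> * (z / real n) - (\<beta> * (z / real n)) ^ 3 / 108"
    using tanh_diff_le_cubic[of c a] bd[OF s] bd[OF t] unfolding ac by (simp add: a_def c_def)
  have "(1 / 2) ^ 3 * (z / real n) ^ 3 \<le> \<beta> ^ 3 * (z / real n) ^ 3"
    using b z by (intro mult_right_mono power_mono) auto
  then have cube: "(z / real n) ^ 3 / 8 \<le> (\<beta> * (z / real n)) ^ 3"
    by (simp add: power_mult_distrib power_divide)
  have "pair_op \<beta> n (\<lambda>\<rho> \<rho>'. mag n \<rho> - mag n \<rho>' - z) \<sigma> \<tau>
      = pair_op \<beta> n (\<lambda>\<rho> \<rho>'. (mag n \<rho> - mag n \<rho>') + (- z)) \<sigma> \<tau>" by simp
  also have "\<dots> = (glauber_op \<beta> n (mag n) \<sigma> - glauber_op \<beta> n (mag n) \<tau>) - z"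
    unfolding pair_op_add using s t n by (simp add: pair_op_diff pair_op_const)
  also have "\<dots> = (glauber_op \<beta> n (mag n) \<sigma> - mag n \<sigma>) - (glauber_op \<beta> n (mag n) \<tau> - mag n \<tau>)"
    by (simp add: z_def)
  also have "\<dots> \<le> (tanh a - mag n \<sigma> / real n + \<beta> / real n) - (tanh c - mag n \<tau> / real n - \<beta> / real n)"
    using glauber_op_mag_drift[OF s n, of \<beta>] glauber_op_mag_drift[OF t n, of \<beta>] b
    unfolding a_def c_def by linarith
  also have "\<dots> = (tanh a - tanh c) - z / real n + 2 * \<beta> / real n"
    by (simp add: z_def diff_divide_distrib)
  also have "\<dots> \<le> \<beta> * (z / real n) - (z / real n) ^ 3 / 864 - z / real n + 4 / real n"
  proof -
    have "2 * \<beta> / real n \<le> 4 / real n" using b by (intro divide_right_mono) auto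
    then show ?thesis using th cube by linarith
  qed
  also have "\<dots> = (\<beta> - 1) * z / real n - (z / real n) ^ 3 / 864 + 4 / real n"
    by (simp add: algebra_simps diff_divide_distrib)
  finally show ?thesis .
qed

text \<open>The jump \<open>J\<close> at 0 pays for independent walks at distance 2 crossing without meeting, and makes the
  potential dominate the indicator of different magnetizations.\<close>

definition potential :: "real \<Rightarrow> real \<Rightarrow> real \<Rightarrow> nat \<Rightarrow> real \<Rightarrow> real" where
  "potential J A l n z = (if z = 0 then 0 else J) + profile A l (\<bar>z\<bar> / real n powr (3/4))"

lemma potential_contracts:
  fixes K :: real
  assumes K: "0 \<le> K"
  obtains J A l N where "1 \<le> J" "0 \<le> A" "0 < l" "1 \<le> N"
    "\<And>n \<beta> \<sigma> \<tau>. n \<ge> N \<Longrightarrow> \<bar>\<beta> - 1\<bar> \<le> K / sqrt (real n) \<Longrightarrow> 1 / 2 \<le> \<beta> \<Longrightarrow> \<beta> \<le> 2 \<Longrightarrow>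
      \<sigma> \<in> config n \<Longrightarrow> \<tau> \<in> config n \<Longrightarrow> mag n \<sigma> \<noteq> mag n \<tau> \<Longrightarrow>
      pair_op \<beta> n (\<lambda>\<rho> \<rho>'. potential J A l n (mag n \<rho> - mag n \<rho>')) \<sigma> \<tau>
        \<le> potential J A l n (mag n \<sigma> - mag n \<tau>) - real n powr (-(3/2))"
proof (rule contracting_profile[OF K, of "4 * min_prob\<^sup>2", where 'a = "int list \<times> int list"])
  show "0 < 4 * min_prob\<^sup>2" using min_prob_pos by simp
next
  fix A l :: real
  assume A: "0 \<le> A" and l: "0 < l" and prof:
    "\<And>(I :: (int list \<times> int list) set) q \<eta> w e. finite I \<Longrightarrow> (\<And>i. i \<in> I \<Longrightarrow> 0 \<le> q i) \<Longrightarrow> (\<Sum>i\<in>I. q i) = 1 \<Longrightarrow> 0 \<le> w \<Longrightarrow>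
      (\<And>i. i \<in> I \<Longrightarrow> q i \<noteq> 0 \<Longrightarrow> 0 \<le> w + \<eta> i \<and> l * \<bar>\<eta> i\<bar> \<le> 1 / 4) \<Longrightarrow> 0 \<le> e \<Longrightarrow>
      (\<Sum>i\<in>I. q i * \<eta> i) \<le> e * (K * w - w ^ 3 / 864 + 4) \<Longrightarrow>
      e * (4 * min_prob\<^sup>2) \<le> (\<Sum>i\<in>I. q i * (\<eta> i)\<^sup>2) \<Longrightarrow>
      (\<Sum>i\<in>I. q i * profile A l (w + \<eta> i)) \<le> profile A l w - e"
  \<comment> \<open>From distance 2 the walks meet with probability at least
    \<open>min_prob^2\<close>; this chance of losing \<open>J\<close> has to outweigh a profile of
    at most \<open>A + 1\<close> and the demanded decrease of at most 1.\<close>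
  define J where "J = max 1 ((A + 2) / min_prob\<^sup>2)"
  have J: "1 \<le> J" "A + 2 \<le> J * min_prob\<^sup>2"
  proof -
    show "1 \<le> J" by (simp add: J_def)
    have "(A + 2) / min_prob\<^sup>2 \<le> J" by (simp add: J_def)
    then show "A + 2 \<le> J * min_prob\<^sup>2" using min_prob_pos by (simp add: pos_divide_le_eq)
  qed
  \<comment> \<open>A joint step changes the rescaled difference by at most \<open>4 / L\<close>, so
    \<open>16 l \<le> L\<close> guarantees \<open>l |\<eta>| \<le> 1/4\<close>.\<close>
  have "filterlim (\<lambda>n. real n powr (3/4)) at_top sequentially" by real_asymp
  then have "eventually (\<lambda>n. 16 * l \<le> real n powr (3/4)) sequentially"
    by (simp add: filterlim_at_top)
  then obtain N0 where N0: "\<And>n. n \<ge> N0 \<Longrightarrow> 16 * l \<le> real n powr (3/4)"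
    by (auto simp: eventually_sequentially)
  define N where "N = max 1 N0"
  have pos_case: "pair_op \<beta> n (\<lambda>\<rho> \<rho>'. potential J A l n (mag n \<rho> - mag n \<rho>')) \<sigma> \<tau>
        \<le> potential J A l n (mag n \<sigma> - mag n \<tau>) - real n powr (-(3/2))"
    if nN: "n \<ge> N" and bK: "\<bar>\<beta> - 1\<bar> \<le> K / sqrt (real n)" and b: "1 / 2 \<le> \<beta>" "\<beta> \<le> 2"
      and s: "\<sigma> \<in> config n" and t: "\<tau> \<in> config n" and st: "mag n \<sigma> > mag n \<tau>" for n \<beta> \<sigma> \<tau>
  proof -
    have n: "n \<ge> 1" using nN by (simp add: N_def)
    \<comment> \<open>The scales balance noise, linear drift and cubic drift:
      \<open>L^2 = 1 / e\<close> puts the variance of a step at order \<open>e\<close>, the linear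
      coefficient is at most \<open>K / (n sqrt n) = K e\<close>, and \<open>L^4 = n^3\<close> turns
      \<open>(z / n)^3 / L\<close> into \<open>e w^3\<close>.\<close>
    define L where "L = real n powr (3/4)"
    define e where "e = real n powr (-(3/2))"
    define z where "z = mag n \<sigma> - mag n \<tau>"
    have L: "L > 0" "16 * l \<le> L" using n N0[of n] nN by (auto simp: L_def N_def)
    have L2: "e * L\<^sup>2 = 1" using n by (simp add: L_def e_def power2_eq_square flip: powr_add)
    have L4: "L ^ 4 = real n ^ 3"
    proof -
      have "L ^ 4 = real n powr 3" unfolding L_def using n by (simp add: powr_power)
      then show ?thesis using n by simp
    qed
    have Ln: "L \<le> real n" using powr_mono[of "3/4" 1 "real n"] n by (simp add: L_def)
    have e: "0 < e" "e \<le> 1" using n ge_one_powr_ge_zero[of "real n" "3/2"] by (auto simp: e_def powr_minus divide_simps)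
    have supp: "\<bar>mag n \<rho> - mag n \<sigma>\<bar> \<le> 2" "\<bar>mag n \<rho>' - mag n \<tau>\<bar> \<le> 2"
      if "\<rho> \<in> config n" "\<rho>' \<in> config n" "glauber \<beta> n \<sigma> \<rho> \<noteq> 0" "glauber \<beta> n \<tau> \<rho>' \<noteq> 0" for \<rho> \<rho>'
      using glauber_mag_support[OF s n that(1,3)] glauber_mag_support[OF t n that(2,4)] by auto
    consider "z = 2" | "z \<ge> 4" using mag_diff_cases[OF s t st] unfolding z_def by linarith
    then show ?thesis
    proof cases
      case 1
      \<comment> \<open>The two disjoint ways to meet from distance 2: the upper walk steps down
        while the lower one stays, or the lower walk steps up while the upper one stays.\<close>
      define G where "G \<rho> \<rho>' = of_bool (mag n \<rho> = mag n \<sigma> - 2) * of_bool (mag n \<rho>' = mag n \<tau>)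
        + of_bool (mag n \<rho> = mag n \<sigma>) * (of_bool (mag n \<rho>' = mag n \<tau> + 2) :: real)" for \<rho> \<rho>'
      have "pair_op \<beta> n (\<lambda>\<rho> \<rho>'. potential J A l n (mag n \<rho> - mag n \<rho>')) \<sigma> \<tau>
          \<le> pair_op \<beta> n (\<lambda>\<rho> \<rho>'. (J + A + 1) + (- (J + A + 1)) * G \<rho> \<rho>') \<sigma> \<tau>"
      proof (rule pair_op_mono)
        fix \<rho> \<rho>'
        have P: "profile A l (\<bar>x\<bar> / real n powr (3/4)) \<le> A + 1" for x
          using A l by (intro profile_bounds) auto
        have "mag n \<tau> = mag n \<sigma> - 2" using 1 by (simp add: z_def)
        then show "potential J A l n (mag n \<rho> - mag n \<rho>') \<le> (J + A + 1) + (- (J + A + 1)) * G \<rho> \<rho>'"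
          using P[of "mag n \<rho> - mag n \<rho>'"] J A by (auto simp: potential_def G_def profile_def)
      qed
      also have "\<dots> = (J + A + 1) - (J + A + 1) * pair_op \<beta> n G \<sigma> \<tau>"
        unfolding pair_op_add pair_op_cmult pair_op_const[OF s t n] by (simp add: algebra_simps)
      also have "\<dots> \<le> (J + A + 1) - J * min_prob\<^sup>2"
      proof -
        define d h u h' where "d = down_rate \<beta> n (mag n \<sigma>)" and "h = 1 - down_rate \<beta> n (mag n \<tau>) - up_rate \<beta> n (mag n \<tau>)"
          and "u = up_rate \<beta> n (mag n \<tau>)" and "h' = 1 - down_rate \<beta> n (mag n \<sigma>) - up_rate \<beta> n (mag n \<sigma>)"
        have b0: "0 \<le> \<beta>" using b by simp
        note rs = rate_bounds[OF b0 b(2) n abs_mag_le[OF s]] and rt = rate_bounds[OF b0 b(2) n abs_mag_le[OF t]]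
        have "pair_op \<beta> n G \<sigma> \<tau> = d * h + h' * u"
          unfolding G_def pair_op_add pair_op_prod prob_mag_eq[OF s n] prob_mag_eq[OF t n]
          by (simp add: d_def h_def u_def h'_def)
        moreover have "d * min_prob \<le> d * h" "min_prob * u \<le> h' * u"
          using rs rt by (auto simp: d_def h_def u_def h'_def intro!: mult_left_mono mult_right_mono)
        \<comment> \<open>Either rate may be small near an extreme magnetization, but not both: the
          chances to pick a plus spin in the upper and a minus spin in the lower configuration sum
          to at least 1.\<close>
        moreover have "min_prob \<le> d + u"
        proof -
          have "min_prob * 1 \<le> min_prob * ((real n + mag n \<sigma>) / (2 * real n) + (real n - mag n \<tau>) / (2 * real n))"
            using min_prob_pos st n by (intro mult_left_mono) (auto simp: field_simps)
          then show ?thesis using rs(1) rt(2) by (simp add: d_def u_def distrib_left)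
        qed
        then have "min_prob * min_prob \<le> min_prob * (d + u)" using min_prob_pos by (intro mult_left_mono) auto
        ultimately have "min_prob\<^sup>2 \<le> pair_op \<beta> n G \<sigma> \<tau>" by (simp add: power2_eq_square algebra_simps)
        then have "J * min_prob\<^sup>2 \<le> (J + A + 1) * pair_op \<beta> n G \<sigma> \<tau>"
          using J A by (intro mult_mono) auto
        then show ?thesis by simp
      qed
      also have "\<dots> \<le> J - e" using J e by linarith
      also have "\<dots> \<le> potential J A l n z - e"
        using 1 profile_bounds[of A l "\<bar>z\<bar> / real n powr (3/4)"] A l by (simp add: potential_def)
      finally show ?thesis by (simp add: z_def e_def)
    next
      case 2
      define w where "w = z / L"
      define q where "q = (\<lambda>(\<rho>, \<rho>'). glauber \<beta> n \<sigma> \<rho> * glauber \<beta> n \<tau> \<rho>')"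
      define \<eta> where "\<eta> = (\<lambda>(\<rho>, \<rho>'). (mag n \<rho> - mag n \<rho>' - z) / L)"
      define I where "I = config n \<times> config n"
      have w: "0 \<le> w" using 2 L by (simp add: w_def)
      have pair: "pair_op \<beta> n G \<sigma> \<tau> = (\<Sum>i\<in>I. q i * (case i of (\<rho>, \<rho>') \<Rightarrow> G \<rho> \<rho>'))" for G
        unfolding pair_op_def I_def q_def by (rule sum.cong) auto
      have "(\<Sum>i\<in>I. q i * profile A l (w + \<eta> i)) \<le> profile A l w - e"
      proof (rule prof)
        show "finite I" by (simp add: I_def finite_config)
        show "0 \<le> q i" for i by (auto simp: q_def glauber_nonneg split: prod.split)
        show "(\<Sum>i\<in>I. q i) = 1"
          using pair[of "\<lambda>_ _. 1"] pair_op_const[OF s t n, of \<beta> 1] by (simp add: case_prod_unfold)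
        show "0 \<le> w" "0 \<le> e" using w e by auto
        show "0 \<le> w + \<eta> i \<and> l * \<bar>\<eta> i\<bar> \<le> 1 / 4" if i: "i \<in> I" "q i \<noteq> 0" for i
        proof -
          obtain \<rho> \<rho>' where ii: "i = (\<rho>, \<rho>')" by (cases i)
          have sp: "\<bar>mag n \<rho> - mag n \<sigma>\<bar> \<le> 2" "\<bar>mag n \<rho>' - mag n \<tau>\<bar> \<le> 2"
            using supp[of \<rho> \<rho>'] i by (auto simp: ii I_def q_def)
          have 3: "w + \<eta> i = (mag n \<rho> - mag n \<rho>') / L"
            by (simp add: w_def \<eta>_def ii add_divide_distrib[symmetric])
          have "0 \<le> mag n \<rho> - mag n \<rho>'" using sp 2 by (simp add: z_def)
          then have "0 \<le> w + \<eta> i" unfolding 3 using L by simp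
          moreover have "l * \<bar>\<eta> i\<bar> \<le> 1 / 4"
          proof -
            have "\<bar>mag n \<rho> - mag n \<rho>' - z\<bar> \<le> 4" using sp by (simp add: z_def)
            then have "\<bar>\<eta> i\<bar> \<le> 4 / L" using L by (simp add: \<eta>_def ii divide_right_mono)
            then have "l * \<bar>\<eta> i\<bar> \<le> l * (4 / L)" using l by (intro mult_left_mono) auto
            also have "\<dots> \<le> 1 / 4" using L by (simp add: field_simps)
            finally show ?thesis .
          qed
          ultimately show ?thesis by blast
        qed
        show "(\<Sum>i\<in>I. q i * \<eta> i) \<le> e * (K * w - w ^ 3 / 864 + 4)"
        proof -
          have "(\<Sum>i\<in>I. q i * \<eta> i) = pair_op \<beta> n (\<lambda>\<rho> \<rho>'. mag n \<rho> - mag n \<rho>' - z) \<sigma> \<tau> / L"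
            unfolding pair sum_divide_distrib by (rule sum.cong) (auto simp: \<eta>_def)
          also have "\<dots> \<le> ((\<beta> - 1) * z / real n - (z / real n) ^ 3 / 864 + 4 / real n) / L"
            using pair_mag_drift[OF b n s t] st L unfolding z_def by (intro divide_right_mono) auto
          also have "\<dots> = (\<beta> - 1) * w / real n - (z / real n) ^ 3 / L / 864 + 4 / (real n * L)"
            using L by (simp add: w_def diff_divide_distrib add_divide_distrib mult.commute)
          also have "(z / real n) ^ 3 / L = e * w ^ 3"
          proof -
            have "(z / real n) ^ 3 / L = w ^ 3 * L ^ 2 / real n ^ 3"
              using L by (simp add: w_def power_divide power3_eq_cube power2_eq_square)
            also have "\<dots> = w ^ 3 * (L ^ 2 / L ^ 4)" by (simp add: L4)
            also have "L ^ 2 / L ^ 4 = e"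
              using L L2 by (simp add: field_simps power2_eq_square power4_eq_xxxx)
            finally show ?thesis by simp
          qed
          also have "(\<beta> - 1) * w / real n - e * w ^ 3 / 864 + 4 / (real n * L) \<le> e * K * w - e * w ^ 3 / 864 + 4 * e"
          proof -
            have ek: "K / sqrt (real n) / real n = e * K"
            proof -
              have "real n powr (3/2) = real n powr 1 * real n powr (1/2)"
                by (subst powr_add[symmetric]) simp
              then have "real n powr (3/2) = real n * sqrt (real n)" by (simp add: powr_half_sqrt)
              then have "e = 1 / (real n * sqrt (real n))"
                unfolding e_def powr_minus by (simp only: inverse_eq_divide)
              then show ?thesis by simp
            qed
            have "(\<beta> - 1) * w / real n \<le> K / sqrt (real n) * w / real n"
              using bK w by (intro divide_right_mono mult_right_mono) auto
            also have "\<dots> = K / sqrt (real n) / real n * w" by simp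
            finally have 4: "(\<beta> - 1) * w / real n \<le> e * K * w" unfolding ek .
            have "L * L \<le> real n * L" using Ln L by (intro mult_right_mono) auto
            then have "1 / (real n * L) \<le> 1 / (L * L)" using L n by (intro divide_left_mono) auto
            also have "\<dots> = e" using L L2 by (simp add: field_simps power2_eq_square)
            finally show ?thesis using 4 by simp
          qed
          finally show ?thesis by (simp add: algebra_simps)
        qed
        show "e * (4 * min_prob\<^sup>2) \<le> (\<Sum>i\<in>I. q i * (\<eta> i)\<^sup>2)"
        proof -
          have "(\<Sum>i\<in>I. q i * (\<eta> i)\<^sup>2) = e * pair_op \<beta> n (\<lambda>\<rho> \<rho>'. (mag n \<rho> - mag n \<rho>' - z)\<^sup>2) \<sigma> \<tau>"
            unfolding pair sum_distrib_left
          proof (rule sum.cong)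
            have el: "x / L\<^sup>2 = e * x" for x using L L2 by (simp add: field_simps)
            show "q i * (\<eta> i)\<^sup>2 = e * (q i * (case i of (\<rho>, \<rho>') \<Rightarrow> (mag n \<rho> - mag n \<rho>' - z)\<^sup>2))" for i
              by (simp add: \<eta>_def power_divide el split: prod.split)
          qed simp
          moreover have "4 * min_prob\<^sup>2 \<le> pair_op \<beta> n (\<lambda>\<rho> \<rho>'. (mag n \<rho> - mag n \<rho>' - z)\<^sup>2) \<sigma> \<tau>"
            unfolding z_def using b n s t by (intro pair_mag_second_moment) auto
          ultimately show ?thesis using e by (simp add: mult_left_mono)
        qed
      qed
      moreover have "pair_op \<beta> n (\<lambda>\<rho> \<rho>'. potential J A l n (mag n \<rho> - mag n \<rho>')) \<sigma> \<tau>
          \<le> pair_op \<beta> n (\<lambda>\<rho> \<rho>'. J + profile A l (w + \<eta> (\<rho>, \<rho>'))) \<sigma> \<tau>"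
      proof (rule pair_op_mono)
        fix \<rho> \<rho>' assume r: "\<rho> \<in> config n" "\<rho>' \<in> config n" "glauber \<beta> n \<sigma> \<rho> \<noteq> 0" "glauber \<beta> n \<tau> \<rho>' \<noteq> 0"
        have 3: "w + \<eta> (\<rho>, \<rho>') = (mag n \<rho> - mag n \<rho>') / L"
          by (simp add: w_def \<eta>_def add_divide_distrib[symmetric])
        have "0 \<le> mag n \<rho> - mag n \<rho>'" using supp[OF r] 2 by (simp add: z_def)
        then show "potential J A l n (mag n \<rho> - mag n \<rho>') \<le> J + profile A l (w + \<eta> (\<rho>, \<rho>'))"
          unfolding 3 using J by (simp add: potential_def L_def)
      qed
      moreover have "pair_op \<beta> n (\<lambda>\<rho> \<rho>'. J + profile A l (w + \<eta> (\<rho>, \<rho>'))) \<sigma> \<tau>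
          = J + (\<Sum>i\<in>I. q i * profile A l (w + \<eta> i))"
        unfolding pair_op_add pair_op_const[OF s t n] unfolding pair by (simp add: case_prod_unfold)
      moreover have "potential J A l n z = J + profile A l w"
        using 2 by (simp add: potential_def w_def L_def)
      ultimately show ?thesis unfolding z_def[symmetric] e_def[symmetric] by linarith
    qed
  qed
  have flip: "pair_op \<beta> n (\<lambda>\<rho> \<rho>'. potential J A l n (mag n \<rho> - mag n \<rho>')) \<tau> \<sigma>
      = pair_op \<beta> n (\<lambda>\<rho> \<rho>'. potential J A l n (mag n \<rho> - mag n \<rho>')) \<sigma> \<tau>" for \<beta> n \<sigma> \<tau>
    unfolding pair_op_def sum.cartesian_product[symmetric]
    by (subst sum.swap) (auto intro!: sum.cong simp: potential_def abs_minus_commute)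
  have flip': "potential J A l n (x - y) = potential J A l n (y - x)" for n x y
    by (simp add: potential_def abs_minus_commute)
  show thesis
  proof (rule that[OF J(1) A l, of N])
    show "1 \<le> N" by (simp add: N_def)
    fix n \<beta> \<sigma> \<tau> assume H: "n \<ge> N" "\<bar>\<beta> - 1\<bar> \<le> K / sqrt (real n)" "1 / 2 \<le> \<beta>" "\<beta> \<le> 2"
      "\<sigma> \<in> config n" "\<tau> \<in> config n" "mag n \<sigma> \<noteq> mag n \<tau>"
    show "pair_op \<beta> n (\<lambda>\<rho> \<rho>'. potential J A l n (mag n \<rho> - mag n \<rho>')) \<sigma> \<tau>
        \<le> potential J A l n (mag n \<sigma> - mag n \<tau>) - real n powr (-(3/2))"
    proof (cases "mag n \<sigma> > mag n \<tau>")
      case True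
      then show ?thesis using pos_case H by blast
    next
      case False
      then show ?thesis using pos_case[OF H(1-4) H(6,5)] H(7) flip[of \<beta> n \<sigma> \<tau>] flip'[of n "mag n \<sigma>" "mag n \<tau>"]
        by simp
    qed
  qed
qed

section \<open>Total variation distance\<close>

lemma glauber_op_funpow_bounded:
  assumes "n \<ge> 1" "\<And>\<sigma>. \<sigma> \<in> config n \<Longrightarrow> \<bar>f \<sigma>\<bar> \<le> 1" "\<sigma> \<in> config n"
  shows "\<bar>(glauber_op \<beta> n ^^ t) f \<sigma>\<bar> \<le> 1"
  using assms(3)
proof (induction t arbitrary: \<sigma>)
  case (Suc t)
  define g where "g = (glauber_op \<beta> n ^^ t) f"
  have "\<bar>glauber_op \<beta> n g \<sigma>\<bar> \<le> (\<Sum>\<tau>\<in>config n. \<bar>glauber \<beta> n \<sigma> \<tau> * g \<tau>\<bar>)"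
    unfolding glauber_op_def by (rule sum_abs)
  also have "\<dots> \<le> (\<Sum>\<tau>\<in>config n. glauber \<beta> n \<sigma> \<tau> * 1)"
    unfolding abs_mult using Suc.IH by (intro sum_mono mult_mono) (auto simp: glauber_nonneg g_def)
  also have "\<dots> = 1" using sum_glauber[OF Suc.prems assms(1)] by simp
  finally show ?case by (simp add: g_def)
qed (use assms(2) in simp)

lemma potential_bounds:
  assumes "1 \<le> J" "0 \<le> A" "0 < l"
  shows "0 \<le> potential J A l n z" "potential J A l n z \<le> J + A + 1" "z \<noteq> 0 \<Longrightarrow> 1 \<le> potential J A l n z"
proof -
  have "0 \<le> profile A l (\<bar>z\<bar> / real n powr (3/4))" "profile A l (\<bar>z\<bar> / real n powr (3/4)) \<le> A + 1"
    using assms by (intro profile_bounds; simp)+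
  then show "0 \<le> potential J A l n z" "potential J A l n z \<le> J + A + 1" "z \<noteq> 0 \<Longrightarrow> 1 \<le> potential J A l n z"
    using assms by (auto simp: potential_def)
qed

text \<open>\<open>E\<close> absorbs pairs of equal magnetization, where the potential vanishes and
  cannot contract because independent walks separate again. For other pairs the bound of the
  potential by \<open>J + A + 1\<close> makes its additive decrease multiplicative, and the
  induction averages the previous bound over an independent joint step.\<close>

lemma glauber_op_funpow_contracts:
  assumes n: "n \<ge> 1" and J: "1 \<le> J" "0 \<le> A" "0 < l"
    and contr: "\<And>\<sigma> \<tau>. \<sigma> \<in> config n \<Longrightarrow> \<tau> \<in> config n \<Longrightarrow> mag n \<sigma> \<noteq> mag n \<tau> \<Longrightarrow>
      pair_op \<beta> n (\<lambda>\<rho> \<rho>'. potential J A l n (mag n \<rho> - mag n \<rho>')) \<sigma> \<tau>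
        \<le> potential J A l n (mag n \<sigma> - mag n \<tau>) - e"
    and e: "0 \<le> e" "e \<le> 1"
    and g: "\<And>\<sigma>. \<sigma> \<in> config n \<Longrightarrow> \<bar>g \<sigma>\<bar> \<le> 1"
    and same: "\<And>t \<sigma> \<tau>. \<sigma> \<in> config n \<Longrightarrow> \<tau> \<in> config n \<Longrightarrow> mag n \<sigma> = mag n \<tau> \<Longrightarrow>
      \<bar>(glauber_op \<beta> n ^^ t) g \<sigma> - (glauber_op \<beta> n ^^ t) g \<tau>\<bar> \<le> E"
    and E: "0 \<le> E"
    and "\<sigma> \<in> config n" "\<tau> \<in> config n"
  shows "\<bar>(glauber_op \<beta> n ^^ t) g \<sigma> - (glauber_op \<beta> n ^^ t) g \<tau>\<bar>
    \<le> E + 2 * (1 - e / (J + A + 1)) ^ t * potential J A l n (mag n \<sigma> - mag n \<tau>)"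
  using assms(11,12)
proof (induction t arbitrary: \<sigma> \<tau>)
  case 0
  show ?case
  proof (cases "mag n \<sigma> = mag n \<tau>")
    case True
    then show ?thesis using same[OF 0 True, of 0] potential_bounds(1)[OF J, of n 0] by simp
  next
    case False
    then show ?thesis using g[OF 0(1)] g[OF 0(2)] E potential_bounds(3)[OF J, of "mag n \<sigma> - mag n \<tau>" n] by simp
  qed
next
  case (Suc t)
  note s = Suc.prems(1) and t = Suc.prems(2)
  define M where "M = J + A + 1"
  define r where "r = 1 - e / M"
  have M: "M \<ge> 1" using J by (simp add: M_def)
  have r: "0 \<le> r" using e M by (simp add: r_def)
  define V where "V \<sigma> \<tau> = potential J A l n (mag n \<sigma> - mag n \<tau>)" for \<sigma> \<tau>
  define h where "h = (glauber_op \<beta> n ^^ t) g"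
  show ?case
  proof (cases "mag n \<sigma> = mag n \<tau>")
    case True
    have "0 \<le> 2 * r ^ Suc t * potential J A l n (mag n \<sigma> - mag n \<tau>)"
      using r potential_bounds(1)[OF J] by simp
    then show ?thesis using same[OF s t True, of "Suc t"] unfolding r_def M_def by linarith
  next
    case False
    have IH: "\<bar>h \<rho> - h \<rho>'\<bar> \<le> E + 2 * r ^ t * V \<rho> \<rho>'" if "\<rho> \<in> config n" "\<rho>' \<in> config n" for \<rho> \<rho>'
      using Suc.IH[OF that] by (simp add: h_def r_def M_def V_def)
    have "pair_op \<beta> n V \<sigma> \<tau> \<le> V \<sigma> \<tau> - e" unfolding V_def by (rule contr[OF s t False])
    also have "\<dots> \<le> r * V \<sigma> \<tau>"
    proof -
      have "V \<sigma> \<tau> / M \<le> 1" using potential_bounds(2)[OF J] M by (simp add: V_def M_def)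
      then have "e * (V \<sigma> \<tau> / M) \<le> e * 1" using e by (intro mult_left_mono) auto
      then show ?thesis by (simp add: r_def algebra_simps)
    qed
    finally have V: "pair_op \<beta> n V \<sigma> \<tau> \<le> r * V \<sigma> \<tau>" .
    have bnd: "pair_op \<beta> n (\<lambda>\<rho> \<rho>'. E + 2 * r ^ t * V \<rho> \<rho>') \<sigma> \<tau> \<le> E + 2 * r ^ Suc t * V \<sigma> \<tau>"
    proof -
      have "pair_op \<beta> n (\<lambda>\<rho> \<rho>'. E + 2 * r ^ t * V \<rho> \<rho>') \<sigma> \<tau> = E + 2 * r ^ t * pair_op \<beta> n V \<sigma> \<tau>"
        unfolding pair_op_add pair_op_cmult pair_op_const[OF s t n] ..
      also have "\<dots> \<le> E + 2 * r ^ t * (r * V \<sigma> \<tau>)"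
        using V r by (intro add_left_mono mult_left_mono) auto
      finally show ?thesis by (simp add: mult_ac)
    qed
    have 1: "glauber_op \<beta> n h \<sigma> - glauber_op \<beta> n h \<tau> \<le> E + 2 * r ^ Suc t * V \<sigma> \<tau>"
    proof -
      have "glauber_op \<beta> n h \<sigma> - glauber_op \<beta> n h \<tau> = pair_op \<beta> n (\<lambda>\<rho> \<rho>'. h \<rho> - h \<rho>') \<sigma> \<tau>"
        by (rule pair_op_diff[OF s t n, symmetric])
      also have "\<dots> \<le> pair_op \<beta> n (\<lambda>\<rho> \<rho>'. E + 2 * r ^ t * V \<rho> \<rho>') \<sigma> \<tau>"
        using IH by (intro pair_op_mono) (auto simp: abs_le_iff)
      finally show ?thesis using bnd by linarith
    qed
    have 2: "- (glauber_op \<beta> n h \<sigma> - glauber_op \<beta> n h \<tau>) \<le> E + 2 * r ^ Suc t * V \<sigma> \<tau>"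
    proof -
      have "- (glauber_op \<beta> n h \<sigma> - glauber_op \<beta> n h \<tau>) = pair_op \<beta> n (\<lambda>\<rho> \<rho>'. (-1) * (h \<rho> - h \<rho>')) \<sigma> \<tau>"
        unfolding pair_op_cmult pair_op_diff[OF s t n] by simp
      also have "\<dots> \<le> pair_op \<beta> n (\<lambda>\<rho> \<rho>'. E + 2 * r ^ t * V \<rho> \<rho>') \<sigma> \<tau>"
        using IH by (intro pair_op_mono) (auto simp: abs_le_iff)
      finally show ?thesis using bnd by linarith
    qed
    show ?thesis using 1 2 by (simp add: h_def V_def r_def M_def abs_le_iff)
  qed
qed

text \<open>The \<open>L^1\<close> distance is attained by the sign of the difference as test
  function; by stationarity the \<mu>-mean of this function is a mean of its evolved values, so
  their oscillation suffices.\<close>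

lemma tv_to_stat_le:
  assumes n: "n \<ge> 1" and s: "\<sigma> \<in> config n"
    and B: "\<And>f \<tau>. (\<And>\<rho>. \<rho> \<in> config n \<Longrightarrow> \<bar>f \<rho>\<bar> \<le> 1) \<Longrightarrow> \<tau> \<in> config n \<Longrightarrow>
      \<bar>(glauber_op \<beta> n ^^ t) f \<sigma> - (glauber_op \<beta> n ^^ t) f \<tau>\<bar> \<le> B"
  shows "tv_to_stat \<beta> n t \<sigma> \<le> B / 2"
proof -
  define f where "f \<tau> = sgn (glauber_pow \<beta> n t \<sigma> \<tau> - cw_mu \<beta> n \<tau>)" for \<tau>
  define P where "P = (glauber_op \<beta> n ^^ t) f"
  have f: "\<bar>f \<rho>\<bar> \<le> 1" for \<rho> by (simp add: f_def sgn_real_def)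
  have stat: "(\<Sum>\<tau>\<in>config n. cw_mu \<beta> n \<tau> * (glauber_op \<beta> n ^^ t) f \<tau>) = (\<Sum>\<tau>\<in>config n. cw_mu \<beta> n \<tau> * f \<tau>)"
  proof (induction t)
    case (Suc t)
    then show ?case using glauber_op_stationary[OF n] by simp
  qed simp
  have "(\<Sum>\<tau>\<in>config n. \<bar>glauber_pow \<beta> n t \<sigma> \<tau> - cw_mu \<beta> n \<tau>\<bar>)
      = (\<Sum>\<tau>\<in>config n. glauber_pow \<beta> n t \<sigma> \<tau> * f \<tau> - cw_mu \<beta> n \<tau> * f \<tau>)"
    by (rule sum.cong) (auto simp: f_def sgn_real_def)
  also have "\<dots> = P \<sigma> - (\<Sum>\<tau>\<in>config n. cw_mu \<beta> n \<tau> * P \<tau>)"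
    unfolding sum_subtractf glauber_pow_op[OF s] P_def stat ..
  also have "\<dots> = (\<Sum>\<tau>\<in>config n. cw_mu \<beta> n \<tau> * (P \<sigma> - P \<tau>))"
    using sum_cw_mu[of \<beta> n] by (simp add: right_diff_distrib sum_subtractf flip: sum_distrib_right)
  also have "\<dots> \<le> (\<Sum>\<tau>\<in>config n. cw_mu \<beta> n \<tau> * B)"
  proof (intro sum_mono mult_left_mono cw_mu_nonneg)
    fix \<tau> assume "\<tau> \<in> config n"
    then show "P \<sigma> - P \<tau> \<le> B" using B[of f \<tau>] f unfolding P_def by (auto simp: abs_le_iff)
  qed
  also have "\<dots> = B" using sum_cw_mu[of \<beta> n] by (simp flip: sum_distrib_right)
  finally show ?thesis by (simp add: tv_to_stat_def)
qed

lemma dist_n_le: "(\<And>\<sigma>. \<sigma> \<in> config n \<Longrightarrow> tv_to_stat \<beta> n t \<sigma> \<le> B) \<Longrightarrow> dist_n \<beta> n t \<le> B"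
  unfolding dist_n_def using finite_config config_nonempty by (subst Max_le_iff) auto

lemma tv_to_stat_le_dist_n: "\<sigma> \<in> config n \<Longrightarrow> tv_to_stat \<beta> n t \<sigma> \<le> dist_n \<beta> n t"
  unfolding dist_n_def using finite_config by (intro Max_ge) auto

text \<open>Half of the \<open>t + t\<close> steps smooth the test function within magnetization
  levels; the other half contract the potential.\<close>

lemma dist_n_upper:
  assumes K: "0 \<le> K"
  obtains M N where "1 \<le> M" "1 \<le> N"
    "\<And>n \<beta> t. n \<ge> N \<Longrightarrow> \<bar>\<beta> - 1\<bar> \<le> K / sqrt (real n) \<Longrightarrow> 1 / 2 \<le> \<beta> \<Longrightarrow> \<beta> \<le> 2 \<Longrightarrow>
      dist_n \<beta> n (t + t) \<le> real n * (1 - 2 * min_prob / real n) ^ t + M * (1 - real n powr (-(3/2)) / M) ^ t"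
proof (rule potential_contracts[OF K])
  fix J A l :: real and N
  assume J: "1 \<le> J" "0 \<le> A" "0 < l" and N: "1 \<le> N"
    and contr: "\<And>n \<beta> \<sigma> \<tau>. n \<ge> N \<Longrightarrow> \<bar>\<beta> - 1\<bar> \<le> K / sqrt (real n) \<Longrightarrow> 1 / 2 \<le> \<beta> \<Longrightarrow> \<beta> \<le> 2 \<Longrightarrow>
      \<sigma> \<in> config n \<Longrightarrow> \<tau> \<in> config n \<Longrightarrow> mag n \<sigma> \<noteq> mag n \<tau> \<Longrightarrow>
      pair_op \<beta> n (\<lambda>\<rho> \<rho>'. potential J A l n (mag n \<rho> - mag n \<rho>')) \<sigma> \<tau>
        \<le> potential J A l n (mag n \<sigma> - mag n \<tau>) - real n powr (-(3/2))"
  define M where "M = J + A + 1"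
  have M: "1 \<le> M" using J by (simp add: M_def)
  show thesis
  proof (rule that[OF M N])
    fix n \<beta> t assume nN: "n \<ge> N" and b: "\<bar>\<beta> - 1\<bar> \<le> K / sqrt (real n)" "1 / 2 \<le> \<beta>" "\<beta> \<le> 2"
    have n: "n \<ge> 1" using nN N by simp
    define e where "e = real n powr (-(3/2))"
    have e: "0 \<le> e" "e \<le> 1" using n ge_one_powr_ge_zero[of "real n" "3/2"] by (auto simp: e_def powr_minus divide_simps)
    define c where "c = 1 - 2 * min_prob / real n"
    have "2 * min_prob / real n \<le> 1" using min_prob_le n by (simp add: field_simps)
    then have c: "0 \<le> c" "c \<le> 1" using min_prob_pos by (auto simp: c_def)
    have r: "0 \<le> 1 - e / M" using e M by simp
    have "tv_to_stat \<beta> n (t + t) \<sigma> \<le> (2 * real n * c ^ t + 2 * (1 - e / M) ^ t * M) / 2" if s: "\<sigma> \<in> config n" for \<sigma>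
    proof (rule tv_to_stat_le[OF n s])
      fix f \<tau> assume f: "\<And>\<rho>. \<rho> \<in> config n \<Longrightarrow> \<bar>f \<rho>\<bar> \<le> (1::real)" and t: "\<tau> \<in> config n"
      define g where "g = (glauber_op \<beta> n ^^ t) f"
      have pw: "(glauber_op \<beta> n ^^ (k + t)) f = (glauber_op \<beta> n ^^ k) g" for k
        by (simp add: g_def funpow_add)
      have "\<bar>(glauber_op \<beta> n ^^ t) g \<sigma> - (glauber_op \<beta> n ^^ t) g \<tau>\<bar>
          \<le> 2 * real n * c ^ t + 2 * (1 - e / (J + A + 1)) ^ t * potential J A l n (mag n \<sigma> - mag n \<tau>)"
      proof (rule glauber_op_funpow_contracts[OF n J _ e _ _ _ s t])
        fix \<sigma> \<tau> assume st: "\<sigma> \<in> config n" "\<tau> \<in> config n"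
        show "pair_op \<beta> n (\<lambda>\<rho> \<rho>'. potential J A l n (mag n \<rho> - mag n \<rho>')) \<sigma> \<tau>
          \<le> potential J A l n (mag n \<sigma> - mag n \<tau>) - e" if "mag n \<sigma> \<noteq> mag n \<tau>"
          unfolding e_def using nN b st that by (rule contr)
        show "\<bar>(glauber_op \<beta> n ^^ k) g \<sigma> - (glauber_op \<beta> n ^^ k) g \<tau>\<bar> \<le> 2 * real n * c ^ t"
          if "mag n \<sigma> = mag n \<tau>" for k
        proof -
          have "\<bar>(glauber_op \<beta> n ^^ (k + t)) f \<sigma> - (glauber_op \<beta> n ^^ (k + t)) f \<tau>\<bar> \<le> 2 * real n * c ^ (k + t)"
            unfolding c_def using b n f st that by (intro glauber_op_funpow_eq_mag) auto
          \<comment> \<open>Further steps only improve the smoothing, so one error term serves all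
            \<open>k\<close> as the induction requires.\<close>
          also have "\<dots> \<le> 2 * real n * c ^ t" using c by (intro mult_left_mono power_decreasing) auto
          finally show ?thesis by (simp add: pw)
        qed
      next
        show "\<bar>g \<sigma>\<bar> \<le> 1" if "\<sigma> \<in> config n" for \<sigma>
          unfolding g_def using n f that by (rule glauber_op_funpow_bounded)
        show "0 \<le> 2 * real n * c ^ t" using c by simp
      qed
      also have "\<dots> \<le> 2 * real n * c ^ t + 2 * (1 - e / M) ^ t * M"
        unfolding M_def[symmetric] using potential_bounds(2)[OF J] r
        by (intro add_left_mono mult_left_mono) (auto simp: M_def)
      finally show "\<bar>(glauber_op \<beta> n ^^ (t + t)) f \<sigma> - (glauber_op \<beta> n ^^ (t + t)) f \<tau>\<bar>
          \<le> 2 * real n * c ^ t + 2 * (1 - e / M) ^ t * M" by (simp add: pw)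
    qed
    then have "dist_n \<beta> n (t + t) \<le> (2 * real n * c ^ t + 2 * (1 - e / M) ^ t * M) / 2"
      by (rule dist_n_le)
    then show "dist_n \<beta> n (t + t) \<le> real n * (1 - 2 * min_prob / real n) ^ t + M * (1 - real n powr (-(3/2)) / M) ^ t"
      by (simp add: c_def e_def mult_ac)
  qed
qed

text \<open>Evaluate \<open>P^t f = z^t f\<close> where \<open>|f|\<close> is maximal. The mean
  being zero, \<mu> may be subtracted from the evolved law at no cost.\<close>

lemma mean_zero_eigenvalue_le:
  fixes f :: "int list \<Rightarrow> complex"
  assumes n: "n \<ge> 1" and nz: "\<exists>\<sigma>\<in>config n. f \<sigma> \<noteq> 0"
    and eig: "\<And>\<sigma>. \<sigma> \<in> config n \<Longrightarrow> (\<Sum>\<tau>\<in>config n. complex_of_real (glauber \<beta> n \<sigma> \<tau>) * f \<tau>) = z * f \<sigma>"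
    and mean: "(\<Sum>\<sigma>\<in>config n. complex_of_real (cw_mu \<beta> n \<sigma>) * f \<sigma>) = 0"
  shows "cmod z ^ t \<le> 2 * dist_n \<beta> n t"
proof -
  define m where "m = Max ((\<lambda>\<sigma>. cmod (f \<sigma>)) ` config n)"
  have "m \<in> (\<lambda>\<sigma>. cmod (f \<sigma>)) ` config n"
    unfolding m_def using finite_config config_nonempty by (intro Max_in) auto
  then obtain \<sigma> where s: "\<sigma> \<in> config n" "cmod (f \<sigma>) = m" by auto
  have fm: "cmod (f \<tau>) \<le> m" if "\<tau> \<in> config n" for \<tau>
    unfolding m_def using that finite_config by (intro Max_ge) auto
  have m: "0 < m" using nz fm by (smt (verit) zero_less_norm_iff)
  have pow: "(\<Sum>\<tau>\<in>config n. complex_of_real (glauber_pow \<beta> n t \<sigma> \<tau>) * f \<tau>) = z ^ t * f \<sigma>"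
  proof (induction t)
    case 0
    have "(\<Sum>\<tau>\<in>config n. complex_of_real (glauber_pow \<beta> n 0 \<sigma> \<tau>) * f \<tau>) = (\<Sum>\<tau>\<in>config n. if \<tau> = \<sigma> then f \<tau> else 0)"
      by (rule sum.cong) auto
    then show ?case using s finite_config by (simp add: sum.delta)
  next
    case (Suc t)
    have "(\<Sum>\<tau>\<in>config n. complex_of_real (glauber_pow \<beta> n (Suc t) \<sigma> \<tau>) * f \<tau>)
        = (\<Sum>\<rho>\<in>config n. complex_of_real (glauber_pow \<beta> n t \<sigma> \<rho>) * (\<Sum>\<tau>\<in>config n. complex_of_real (glauber \<beta> n \<rho> \<tau>) * f \<tau>))"
      unfolding glauber_pow.simps of_real_sum sum_distrib_left sum_distrib_right
      by (subst sum.swap) (simp add: mult.assoc)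
    also have "\<dots> = (\<Sum>\<rho>\<in>config n. z * (complex_of_real (glauber_pow \<beta> n t \<sigma> \<rho>) * f \<rho>))"
      by (rule sum.cong) (auto simp: eig)
    also have "\<dots> = z ^ Suc t * f \<sigma>"
      unfolding sum_distrib_left[symmetric] Suc by simp
    finally show ?case .
  qed
  have "cmod z ^ t * m = cmod (\<Sum>\<tau>\<in>config n. complex_of_real (glauber_pow \<beta> n t \<sigma> \<tau> - cw_mu \<beta> n \<tau>) * f \<tau>)"
    using pow mean s by (simp add: left_diff_distrib sum_subtractf norm_mult norm_power)
  also have "\<dots> \<le> (\<Sum>\<tau>\<in>config n. cmod (complex_of_real (glauber_pow \<beta> n t \<sigma> \<tau> - cw_mu \<beta> n \<tau>) * f \<tau>))"
    by (rule norm_sum)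
  also have "\<dots> \<le> (\<Sum>\<tau>\<in>config n. \<bar>glauber_pow \<beta> n t \<sigma> \<tau> - cw_mu \<beta> n \<tau>\<bar> * m)"
    unfolding norm_mult norm_of_real using fm by (intro sum_mono mult_left_mono) auto
  also have "\<dots> = 2 * tv_to_stat \<beta> n t \<sigma> * m"
    by (simp add: tv_to_stat_def sum_distrib_right)
  also have "\<dots> \<le> 2 * dist_n \<beta> n t * m"
    using tv_to_stat_le_dist_n[OF s(1)] m by (intro mult_right_mono) auto
  finally show ?thesis using m by simp
qed

text \<open>Averaging the eigenvalue equation over the stationary measure gives
  \<open>z m = m\<close> for the mean \<open>m\<close>.\<close>

lemma eigenvalue_mean_zero:
  fixes f :: "int list \<Rightarrow> complex"
  assumes n: "n \<ge> 1" and z: "z \<noteq> 1"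
    and eig: "\<And>\<sigma>. \<sigma> \<in> config n \<Longrightarrow> (\<Sum>\<tau>\<in>config n. complex_of_real (glauber \<beta> n \<sigma> \<tau>) * f \<tau>) = z * f \<sigma>"
  shows "(\<Sum>\<sigma>\<in>config n. complex_of_real (cw_mu \<beta> n \<sigma>) * f \<sigma>) = 0"
proof -
  define m where "m = (\<Sum>\<sigma>\<in>config n. complex_of_real (cw_mu \<beta> n \<sigma>) * f \<sigma>)"
  have "z * m = (\<Sum>\<sigma>\<in>config n. complex_of_real (cw_mu \<beta> n \<sigma>) * (z * f \<sigma>))"
    unfolding m_def sum_distrib_left by (simp add: mult_ac)
  also have "\<dots> = (\<Sum>\<sigma>\<in>config n. complex_of_real (cw_mu \<beta> n \<sigma>) * (\<Sum>\<tau>\<in>config n. complex_of_real (glauber \<beta> n \<sigma> \<tau>) * f \<tau>))"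
    by (rule sum.cong) (auto simp: eig)
  also have "\<dots> = (\<Sum>\<tau>\<in>config n. complex_of_real (\<Sum>\<sigma>\<in>config n. cw_mu \<beta> n \<sigma> * glauber \<beta> n \<sigma> \<tau>) * f \<tau>)"
    unfolding of_real_sum sum_distrib_left sum_distrib_right
    by (subst sum.swap) (simp add: mult.assoc)
  also have "\<dots> = m" unfolding m_def by (rule sum.cong) (auto simp: glauber_stationary[OF _ n])
  finally have "(z - 1) * m = 0" by (simp add: algebra_simps)
  then show ?thesis using z by (simp add: m_def)
qed

section \<open>Existence of a large eigenvalue\<close>

lemma compact_PiE_UNIV:
  fixes S :: "'a \<Rightarrow> real set"
  assumes "\<And>x. compact (S x)"
  shows "compact (PiE UNIV S)"
  using assms compactin_PiE[of "\<lambda>_. euclidean" UNIV S] by (simp add: euclidean_product_topology)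

text \<open>Maximize the quadratic form \<open>Q\<close> over normalized mean-zero functions; by
  reversibility \<open>Q\<close> is symmetric, so a maximizer is an eigenfunction, and its
  eigenvalue \<open>r\<close> dominates the Rayleigh quotient of \<open>f\<close>.\<close>

lemma reversible_top_eigenfunction:
  fixes A :: "'a set" and w :: "'a \<Rightarrow> real" and P :: "'a \<Rightarrow> 'a \<Rightarrow> real"
  assumes A: "finite A" and w: "\<And>x. x \<in> A \<Longrightarrow> 0 < w x"
    and rev: "\<And>x y. x \<in> A \<Longrightarrow> y \<in> A \<Longrightarrow> w x * P x y = w y * P y x"
    and rows: "\<And>x. x \<in> A \<Longrightarrow> (\<Sum>y\<in>A. P x y) = 1"
    and f0: "(\<Sum>x\<in>A. w x * f x) = 0" "0 < (\<Sum>x\<in>A. w x * (f x)\<^sup>2)"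
  obtains g r where "(\<Sum>x\<in>A. w x * g x) = 0" "\<exists>x\<in>A. g x \<noteq> 0"
    "\<And>x. x \<in> A \<Longrightarrow> (\<Sum>y\<in>A. P x y * g y) = r * g x"
    "(\<Sum>x\<in>A. w x * f x * (\<Sum>y\<in>A. P x y * f y)) \<le> r * (\<Sum>x\<in>A. w x * (f x)\<^sup>2)"
proof -
  define Q where "Q f g = (\<Sum>x\<in>A. w x * f x * (\<Sum>y\<in>A. P x y * g y))" for f g
  define B where "B f g = (\<Sum>x\<in>A. w x * f x * g x)" for f g
  define E where "E f = (\<Sum>x\<in>A. w x * f x)" for f
  have wsq: "0 \<le> w x * (c * c)" if "x \<in> A" for x c
    using w[OF that] by simp
  have Bpos: "0 \<le> B h h" for h
    unfolding B_def mult.assoc by (intro sum_nonneg wsq)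
  have B0: "h x = 0" if "B h h = 0" "x \<in> A" for h x
  proof -
    have "w x * h x * h x = 0"
      using that A w unfolding B_def mult.assoc
      by (subst (asm) sum_nonneg_eq_0_iff) (auto intro!: wsq)
    then show ?thesis using w[OF that(2)] by simp
  qed
  have Qsym: "Q f g = Q g f" for f g
  proof -
    have "Q f g = (\<Sum>x\<in>A. \<Sum>y\<in>A. (w x * P x y) * f x * g y)"
      unfolding Q_def sum_distrib_left by (simp add: mult_ac)
    also have "\<dots> = (\<Sum>x\<in>A. \<Sum>y\<in>A. (w y * P y x) * f x * g y)"
      by (intro sum.cong refl) (simp add: rev)
    also have "\<dots> = (\<Sum>y\<in>A. \<Sum>x\<in>A. (w y * P y x) * f x * g y)" by (rule sum.swap)
    also have "\<dots> = Q g f"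
      unfolding Q_def sum_distrib_left by (simp add: mult_ac)
    finally show ?thesis .
  qed
  \<comment> \<open>Functions are pinned to 0 off \<open>A\<close> to identify them with a
    finite-dimensional space. The box supplies compactness only: a unit function satisfies
    \<open>w x * (h x)^2 \<le> 1\<close>, and \<open>|h| \<le> 1 + h^2\<close>.\<close>
  define C where "C = PiE UNIV (\<lambda>x. if x \<in> A then {- (1 + 1 / w x)..1 + 1 / w x} else {0})
    \<inter> ({g. E g = 0} \<inter> {g. B g g = 1})"
  have coord: "continuous_on UNIV (\<lambda>g :: 'a \<Rightarrow> real. g x)" for x by simp
  have contQ: "continuous_on UNIV (\<lambda>g. Q g g)" unfolding Q_def by (intro continuous_intros coord)
  have "closed {g. E g = 0}" unfolding E_def by (intro closed_Collect_eq continuous_intros coord)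
  moreover have "closed {g. B g g = 1}" unfolding B_def by (intro closed_Collect_eq continuous_intros coord)
  ultimately have C: "compact C" unfolding C_def
    by (intro compact_Int_closed closed_Int compact_PiE_UNIV) auto
  define nrm where "nrm h = (\<lambda>x. if x \<in> A then h x / sqrt (B h h) else 0)" for h
  have nrm: "nrm h \<in> C" "Q (nrm h) (nrm h) = Q h h / B h h" if h: "E h = 0" "0 < B h h" for h
  proof -
    have s: "sqrt (B h h) > 0" "sqrt (B h h) * sqrt (B h h) = B h h" using h by auto
    have 1: "E (nrm h) = 0"
    proof -
      have "E (nrm h) = E h / sqrt (B h h)"
        unfolding E_def sum_divide_distrib by (rule sum.cong) (auto simp: nrm_def)
      then show ?thesis using h by simp
    qed
    have 2: "B (nrm h) (nrm h) = 1"
    proof -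
      have "B (nrm h) (nrm h) = B h h / (sqrt (B h h) * sqrt (B h h))"
        unfolding B_def[of "nrm h"] B_def[of h h, THEN arg_cong[where f = "\<lambda>x. x / _"]] sum_divide_distrib
        by (rule sum.cong) (auto simp: nrm_def)
      then show ?thesis using h s by simp
    qed
    have 3: "Q (nrm h) (nrm h) = Q h h / B h h"
    proof -
      define v S where "v = sqrt (B h h)" and "S x = (\<Sum>y\<in>A. P x y * h y)" for x
      have in1: "(\<Sum>y\<in>A. P x y * nrm h y) = S x / v" for x
        unfolding S_def v_def sum_divide_distrib by (rule sum.cong) (auto simp: nrm_def)
      have "Q (nrm h) (nrm h) = (\<Sum>x\<in>A. w x * h x * S x / (v * v))"
        unfolding Q_def in1 by (rule sum.cong) (auto simp: nrm_def v_def[symmetric])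
      also have "\<dots> = Q h h / (v * v)" unfolding Q_def S_def sum_divide_distrib ..
      finally show ?thesis using s by (simp add: v_def)
    qed
    have 4: "\<bar>nrm h x\<bar> \<le> 1 + 1 / w x" if x: "x \<in> A" for x
    proof -
      have "w x * nrm h x * nrm h x \<le> B (nrm h) (nrm h)"
        unfolding B_def mult.assoc using A x by (intro member_le_sum wsq) auto
      then have "(nrm h x)\<^sup>2 \<le> 1 / w x" using 2 w[OF x] by (simp add: field_simps power2_eq_square)
      moreover have "\<bar>nrm h x\<bar> \<le> 1 + (nrm h x)\<^sup>2"
        using zero_le_power2[of "\<bar>nrm h x\<bar> - 1"] by (simp add: power2_diff)
      ultimately show ?thesis by linarith
    qed
    show "nrm h \<in> C" 
    proof -
      have "nrm h x \<in> (if x \<in> A then {- (1 + 1 / w x)..1 + 1 / w x} else {0})" for x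
        using 4[of x] by (cases "x \<in> A") (simp_all add: abs_le_iff, simp add: nrm_def)
      then show ?thesis unfolding C_def using 1 2 by auto
    qed
    show "Q (nrm h) (nrm h) = Q h h / B h h" by (rule 3)
  qed
  have f0': "E f = 0" "0 < B f f" using f0 by (simp_all add: E_def B_def power2_eq_square mult.assoc)
  then have "C \<noteq> {}" using nrm by blast
  moreover have "continuous_on C (\<lambda>g. Q g g)" using contQ by (rule continuous_on_subset) simp
  ultimately have "\<exists>g\<in>C. \<forall>h\<in>C. Q h h \<le> Q g g" by (rule continuous_attains_sup[OF C])
  then obtain g where g: "g \<in> C" "\<And>h. h \<in> C \<Longrightarrow> Q h h \<le> Q g g" by blast
  define r where "r = Q g g"
  have gE: "E g = 0" and gB: "B g g = 1" using g(1) by (auto simp: C_def)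
  have max: "Q h h \<le> r * B h h" if "E h = 0" for h
  proof (cases "B h h = 0")
    case True
    then have "Q h h = 0" unfolding Q_def using B0[OF True] by simp
    then show ?thesis using True by simp
  next
    case False
    then have p: "0 < B h h" using Bpos[of h] by simp
    have "Q h h / B h h \<le> r" using g(2)[OF nrm(1)[OF that p]] nrm(2)[OF that p] by (simp add: r_def)
    then show ?thesis using p by (simp add: pos_divide_le_eq)
  qed
  \<comment> \<open>The residual of the eigenvalue equation. It has mean zero, so it is an
    admissible direction in which to perturb \<open>g\<close>.\<close>
  define h where "h x = (\<Sum>y\<in>A. P x y * g y) - r * g x" for x
  have Eh: "E h = 0"
  proof -
    have "(\<Sum>x\<in>A. w x * (\<Sum>y\<in>A. P x y * g y)) = Q (\<lambda>_. 1) g" by (simp add: Q_def)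
    also have "\<dots> = Q g (\<lambda>_. 1)" by (rule Qsym)
    also have "\<dots> = E g" unfolding Q_def E_def using rows by simp
    finally have "(\<Sum>x\<in>A. w x * (\<Sum>y\<in>A. P x y * g y)) = 0" using gE by simp
    moreover have "E h = (\<Sum>x\<in>A. w x * (\<Sum>y\<in>A. P x y * g y)) - r * E g"
      unfolding E_def h_def by (simp add: right_diff_distrib sum_subtractf sum_distrib_left mult_ac)
    ultimately show ?thesis using gE by simp
  qed
  have Qh: "Q h g - r * B h g = B h h"
  proof -
    have hx: "(\<Sum>y\<in>A. P x y * g y) = h x + r * g x" for x by (simp add: h_def)
    show ?thesis unfolding Q_def B_def sum_distrib_left[of r _ A] sum_subtractf[symmetric] hx
      by (intro sum.cong refl) (simp add: algebra_simps)
  qed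
  \<comment> \<open>Compare \<open>g + t h\<close> with the maximum: the first-order term is
    \<open>2 t B h h\<close>, and only a term of order \<open>t^2\<close> is available to compensate
    it. Small \<open>t\<close> then forces the residual to vanish.\<close>
  have quad: "2 * B h h \<le> t * (r * B h h - Q h h)" if t: "t > 0" for t
  proof -
    define k where "k = (\<lambda>x. g x + t * h x)"
    have "E k = E g + t * E h"
      unfolding E_def k_def by (simp add: distrib_left sum.distrib sum_distrib_left mult_ac)
    then have k1: "Q k k \<le> r * B k k" using gE Eh by (intro max) simp
    have k2: "B k k = B g g + 2 * t * B h g + t\<^sup>2 * B h h"
      unfolding B_def sum_distrib_left sum.distrib[symmetric]
      by (intro sum.cong refl) (simp add: k_def algebra_simps power2_eq_square)
    have k3: "Q k k = Q g g + t * Q g h + t * Q h g + t\<^sup>2 * Q h h"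
    proof -
      have in1: "(\<Sum>y\<in>A. P x y * k y) = (\<Sum>y\<in>A. P x y * g y) + t * (\<Sum>y\<in>A. P x y * h y)" for x
        unfolding k_def by (simp add: distrib_left sum.distrib sum_distrib_left mult_ac)
      define G H where "G x = (\<Sum>y\<in>A. P x y * g y)" and "H x = (\<Sum>y\<in>A. P x y * h y)" for x
      show ?thesis
        unfolding Q_def in1 unfolding G_def[symmetric] H_def[symmetric]
        unfolding sum_distrib_left sum.distrib[symmetric]
        by (intro sum.cong refl) (simp add: k_def algebra_simps power2_eq_square)
    qed
    have "t * (2 * B h h) \<le> t * (t * (r * B h h - Q h h))"
    proof -
      have q: "Q h g = B h h + r * B h g" using Qh by simp
      show ?thesis using k1 unfolding k2 k3 Qsym[of g h] q gB r_def[symmetric]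
        by (simp add: algebra_simps power2_eq_square)
    qed
    then show ?thesis using t by simp
  qed
  have "B h h \<le> 0"
  proof (rule ccontr)
    assume "\<not> B h h \<le> 0"
    then have p: "0 < B h h" by simp
    define d where "d = r * B h h - Q h h"
    have d: "0 \<le> d" using max[OF Eh] by (simp add: d_def)
    have "2 * B h h \<le> B h h / (d + 1) * d" using quad[of "B h h / (d + 1)"] p d by (simp add: d_def)
    also have "\<dots> \<le> B h h" using p d by (simp add: field_simps)
    finally show False using p by simp
  qed
  then have "B h h = 0" using Bpos[of h] by simp
  then have eig: "(\<Sum>y\<in>A. P x y * g y) = r * g x" if "x \<in> A" for x
    using B0[of h x] that by (simp add: h_def)
  show ?thesis
  proof (rule that[of g r])
    show "(\<Sum>x\<in>A. w x * g x) = 0" using gE by (simp add: E_def)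
    show "\<exists>x\<in>A. g x \<noteq> 0"
    proof (rule ccontr)
      assume "\<not> ?thesis"
      then have "B g g = 0" by (simp add: B_def)
      then show False using gB by simp
    qed
    show "(\<Sum>x\<in>A. w x * f x * (\<Sum>y\<in>A. P x y * f y)) \<le> r * (\<Sum>x\<in>A. w x * (f x)\<^sup>2)"
      using max[OF f0'(1)] by (simp add: Q_def B_def power2_eq_square mult.assoc)
  qed (use eig in auto)
qed

section \<open>Stationary moments of the magnetization\<close>

lemma mult_tanh_ge: "y\<^sup>2 - y ^ 4 / 3 \<le> y * tanh (y::real)"
proof -
  define u where "u = \<bar>y\<bar>"
  have u: "0 \<le> u" by (simp add: u_def)
  have "u ^ 3 / 3 - (u - tanh u) \<ge> 0 ^ 3 / 3 - (0 - tanh (0::real))"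
  proof (rule DERIV_nonneg_imp_nondecreasing[OF u])
    fix x :: real assume x: "0 \<le> x" "x \<le> u"
    have "((\<lambda>x. x ^ 3 / 3 - (x - tanh x)) has_real_derivative (x\<^sup>2 - (1 - (1 - (tanh x)\<^sup>2)))) (at x)"
      by (auto intro!: derivative_eq_intros)
    moreover have "(tanh x)\<^sup>2 \<le> x\<^sup>2" using abs_tanh_diff_le[of x 0] by (simp add: abs_le_square_iff)
    ultimately show "\<exists>d. ((\<lambda>x. x ^ 3 / 3 - (x - tanh x)) has_real_derivative d) (at x) \<and> 0 \<le> d"
      by (intro exI[of _ "x\<^sup>2 - (1 - (1 - (tanh x)\<^sup>2))"]) auto
  qed
  then have "u - u ^ 3 / 3 \<le> tanh u" by simp
  then have "u * (u - u ^ 3 / 3) \<le> u * tanh u" using u by (rule mult_left_mono)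
  moreover have "u * tanh u = y * tanh y" by (simp add: u_def abs_if)
  moreover have "u * (u - u ^ 3 / 3) = y\<^sup>2 - y ^ 4 / 3"
    by (simp add: u_def abs_if power2_eq_square power3_eq_cube power4_eq_xxxx algebra_simps)
  ultimately show ?thesis by simp
qed

definition moment :: "real \<Rightarrow> nat \<Rightarrow> nat \<Rightarrow> real" where
  "moment \<beta> n k = (\<Sum>\<sigma>\<in>config n. cw_mu \<beta> n \<sigma> * mag n \<sigma> ^ k)"

lemma moment_2_sq_le_4: "(moment \<beta> n 2)\<^sup>2 \<le> moment \<beta> n 4"
proof -
  define m where "m = moment \<beta> n 2"
  have "0 \<le> (\<Sum>\<sigma>\<in>config n. cw_mu \<beta> n \<sigma> * ((mag n \<sigma>)\<^sup>2 - m)\<^sup>2)"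
    by (intro sum_nonneg mult_nonneg_nonneg cw_mu_nonneg) auto
  also have "\<dots> = (\<Sum>\<sigma>\<in>config n. cw_mu \<beta> n \<sigma> * mag n \<sigma> ^ 4 - 2 * m * (cw_mu \<beta> n \<sigma> * (mag n \<sigma>)\<^sup>2) + m\<^sup>2 * cw_mu \<beta> n \<sigma>)"
    by (rule sum.cong) (auto simp: power2_diff algebra_simps power2_eq_square power4_eq_xxxx)
  also have "\<dots> = moment \<beta> n 4 - 2 * m * m + m\<^sup>2"
    unfolding sum.distrib sum_subtractf sum_distrib_left[symmetric] sum_cw_mu by (simp add: moment_def m_def)
  finally show ?thesis by (simp add: m_def power2_eq_square)
qed

lemma moment_2_nonneg: "0 \<le> moment \<beta> n 2"
  unfolding moment_def by (intro sum_nonneg mult_nonneg_nonneg cw_mu_nonneg) auto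

lemma moment_2_le_sqrt: "moment \<beta> n 2 \<le> sqrt (moment \<beta> n 4)"
  using moment_2_sq_le_4[of \<beta> n] moment_2_nonneg by (simp add: real_le_rsqrt)

text \<open>One step changes \<open>S^2\<close> in mean by \<open>4 (d + u) + 2 S D\<close>. The
  first term is noise, bounded below by \<open>4 * min_prob\<close>; the drift \<open>D\<close>
  costs at most a linear and a cubic part plus the local-field error.\<close>

lemma glauber_op_mag_sq_ge:
  assumes s: "\<sigma> \<in> config n" and n: "n \<ge> 1" and b: "0 \<le> \<beta>" "\<beta> \<le> 2" and bK: "\<bar>\<beta> - 1\<bar> \<le> K / sqrt (real n)"
  defines "e \<equiv> 1 / (real n * sqrt (real n))" and "S \<equiv> mag n \<sigma>"
  shows "4 * min_prob - 2 / sqrt (real n) - (2 * K + 2) * e * S\<^sup>2 - 6 * e\<^sup>2 * S ^ 4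
    \<le> glauber_op \<beta> n (\<lambda>\<rho>. (mag n \<rho>)\<^sup>2) \<sigma> - S\<^sup>2"
proof -
  define u d where "u = up_rate \<beta> n S" and "d = down_rate \<beta> n S"
  define D where "D = glauber_op \<beta> n (mag n) \<sigma> - S"
  define T where "T = tanh (\<beta> * S / real n)"
  have sq: "sqrt (real n) > 0" "sqrt (real n) * sqrt (real n) = real n" using n by auto
  have e: "e > 0" using n by (simp add: e_def)
  have e2: "e\<^sup>2 = 1 / real n ^ 3"
    using sq by (simp add: e_def power2_eq_square power3_eq_cube)
  have D: "D = 2 * u - 2 * d"
    using glauber_op_mag[OF s n, of \<beta> "\<lambda>x. x"] by (simp add: D_def u_def d_def S_def)
  have "glauber_op \<beta> n (\<lambda>\<rho>. (mag n \<rho>)\<^sup>2) \<sigma> - S\<^sup>2 = d * ((S - 2)\<^sup>2 - S\<^sup>2) + u * ((S + 2)\<^sup>2 - S\<^sup>2)"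
    using glauber_op_mag[OF s n, of \<beta> "\<lambda>x. x\<^sup>2"] by (simp add: u_def d_def S_def)
  also have "\<dots> = 4 * (d + u) + 2 * S * D"
    by (simp add: D power2_eq_square algebra_simps)
  finally have main: "glauber_op \<beta> n (\<lambda>\<rho>. (mag n \<rho>)\<^sup>2) \<sigma> - S\<^sup>2 = 4 * (d + u) + 2 * S * D" .
  have ud: "min_prob \<le> d + u"
    using rate_bounds(3)[OF b n abs_mag_le[OF s]] by (simp add: d_def u_def S_def)
  have "\<bar>D - (T - S / real n)\<bar> \<le> \<beta> / real n"
    using glauber_op_mag_drift[OF s n b(1)] by (simp add: D_def T_def S_def)
  also have "\<dots> \<le> 2 / real n" using b by (simp add: divide_right_mono)
  finally have "\<bar>S\<bar> * \<bar>D - (T - S / real n)\<bar> \<le> \<bar>S\<bar> * (2 / real n)" by (intro mult_left_mono) auto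
  then have err: "S * (T - S / real n) - \<bar>S\<bar> * (2 / real n) \<le> S * D"
    by (simp add: abs_mult[symmetric] algebra_simps abs_le_iff)
  \<comment> \<open>The field error is split so that its growing part has the scale
    \<open>e S^2\<close> of the linear drift and the rest tends to 0.\<close>
  have amgm: "\<bar>S\<bar> * (2 / real n) \<le> 1 / sqrt (real n) + e * S\<^sup>2"
  proof -
    have "2 * (1 / sqrt (real n)) * (\<bar>S\<bar> / sqrt (real n)) \<le> 1 / sqrt (real n) * (1 + S\<^sup>2 / real n)"
    proof -
      have "0 \<le> (1 - \<bar>S\<bar> / sqrt (real n))\<^sup>2" by simp
      then have "2 * (\<bar>S\<bar> / sqrt (real n)) \<le> 1 + S\<^sup>2 / real n"
        by (simp add: power2_diff power_divide)
      then have "1 / sqrt (real n) * (2 * (\<bar>S\<bar> / sqrt (real n))) \<le> 1 / sqrt (real n) * (1 + S\<^sup>2 / real n)"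
        using sq by (intro mult_left_mono) auto
      then show ?thesis by (simp add: mult_ac)
    qed
    then show ?thesis by (simp add: e_def algebra_simps)
  qed
  \<comment> \<open>From \<open>mult_tanh_ge\<close> at \<open>y = \<beta> S / n\<close>, multiplied
    by \<open>n / \<beta>\<close>; this is why \<beta> = 0 is split off. The 8 bounds
    \<open>\<beta>^3\<close>.\<close>
  have cub: "\<beta> * S\<^sup>2 / real n - 8 / 3 * e\<^sup>2 * S ^ 4 \<le> S * T"
  proof (cases "\<beta> = 0")
    case True
    then show ?thesis by (simp add: T_def)
  next
    case False
    then have bp: "\<beta> > 0" using b by simp
    define y where "y = \<beta> * S / real n"
    have "y\<^sup>2 - y ^ 4 / 3 \<le> y * T" unfolding T_def y_def[symmetric] by (rule mult_tanh_ge)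
    then have "real n / \<beta> * (y\<^sup>2 - y ^ 4 / 3) \<le> real n / \<beta> * (y * T)"
      using bp n by (intro mult_left_mono) auto
    also have "real n / \<beta> * (y * T) = S * T" using bp n by (simp add: y_def)
    also have "real n / \<beta> * (y\<^sup>2 - y ^ 4 / 3) = \<beta> * S\<^sup>2 / real n - \<beta> ^ 3 * S ^ 4 / (3 * real n ^ 3)"
      using bp n by (simp add: y_def field_simps power2_eq_square power3_eq_cube power4_eq_xxxx)
    finally have 1: "\<beta> * S\<^sup>2 / real n - \<beta> ^ 3 * S ^ 4 / (3 * real n ^ 3) \<le> S * T" .
    have "\<beta> ^ 3 * S ^ 4 \<le> 2 ^ 3 * S ^ 4" using b by (intro mult_right_mono power_mono) auto
    then have "\<beta> ^ 3 * S ^ 4 / (3 * real n ^ 3) \<le> 8 * S ^ 4 / (3 * real n ^ 3)"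
      by (intro divide_right_mono) auto
    also have "\<dots> = 8 / 3 * e\<^sup>2 * S ^ 4" by (simp add: e2)
    finally show ?thesis using 1 by linarith
  qed
  have lin: "- (K * e * S\<^sup>2) \<le> (\<beta> - 1) * S\<^sup>2 / real n"
  proof -
    have "(1 - \<beta>) * (S\<^sup>2 / real n) \<le> K / sqrt (real n) * (S\<^sup>2 / real n)"
      using bK by (intro mult_right_mono) auto
    also have "\<dots> = K * e * S\<^sup>2" by (simp add: e_def)
    finally show ?thesis by (simp add: algebra_simps diff_divide_distrib)
  qed
  have e4: "0 \<le> e\<^sup>2 * S ^ 4" by simp
  have "S * D \<ge> S * T - S\<^sup>2 / real n - 1 / sqrt (real n) - e * S\<^sup>2"
    using err amgm by (simp add: right_diff_distrib power2_eq_square)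
  moreover have "(\<beta> - 1) * S\<^sup>2 / real n = \<beta> * S\<^sup>2 / real n - S\<^sup>2 / real n"
    by (simp add: algebra_simps diff_divide_distrib)
  ultimately have SD: "S * D \<ge> - (K * e * S\<^sup>2) - 8 / 3 * (e\<^sup>2 * S ^ 4) - 1 / sqrt (real n) - e * S\<^sup>2"
    using cub lin by linarith
  have "4 * (d + u) + 2 * (S * D) \<ge> 4 * min_prob - 2 / sqrt (real n) - 2 * (K * e * S\<^sup>2) - 2 * (e * S\<^sup>2) - 6 * (e\<^sup>2 * S ^ 4)"
  proof -
    \<comment> \<open>The coefficient 6 rounds up \<open>2 * 8 / 3\<close>.\<close>
    have "4 * m - 2 * q - 2 * a - 2 * b - 6 * x \<le> 4 * y + 2 * z"
      if "m \<le> y" "0 \<le> x" "- a - 8 / 3 * x - q - b \<le> z" for m q a b x y z :: real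
      using that by linarith
    from this[OF ud e4 SD] show ?thesis by simp
  qed
  then show ?thesis unfolding main by (simp add: algebra_simps)
qed

lemma moment_inequality:
  assumes n: "n \<ge> 1" and b: "0 \<le> \<beta>" "\<beta> \<le> 2" and bK: "\<bar>\<beta> - 1\<bar> \<le> K / sqrt (real n)"
  defines "e \<equiv> 1 / (real n * sqrt (real n))"
  shows "4 * min_prob - 2 / sqrt (real n) \<le> (2 * K + 2) * e * moment \<beta> n 2 + 6 * e\<^sup>2 * moment \<beta> n 4"
proof -
  define c where "c = 4 * min_prob - 2 / sqrt (real n)"
  have "c - (2 * K + 2) * e * moment \<beta> n 2 - 6 * e\<^sup>2 * moment \<beta> n 4
      = (\<Sum>\<sigma>\<in>config n. c * cw_mu \<beta> n \<sigma> - (2 * K + 2) * e * (cw_mu \<beta> n \<sigma> * (mag n \<sigma>)\<^sup>2) - 6 * e\<^sup>2 * (cw_mu \<beta> n \<sigma> * mag n \<sigma> ^ 4))"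
    unfolding sum_subtractf sum_distrib_left[symmetric] sum_cw_mu by (simp add: moment_def)
  also have "\<dots> = (\<Sum>\<sigma>\<in>config n. cw_mu \<beta> n \<sigma> * (c - (2 * K + 2) * e * (mag n \<sigma>)\<^sup>2 - 6 * e\<^sup>2 * mag n \<sigma> ^ 4))"
    by (rule sum.cong) (auto simp: algebra_simps)
  also have "\<dots> \<le> (\<Sum>\<sigma>\<in>config n. cw_mu \<beta> n \<sigma> * (glauber_op \<beta> n (\<lambda>\<rho>. (mag n \<rho>)\<^sup>2) \<sigma> - (mag n \<sigma>)\<^sup>2))"
    using glauber_op_mag_sq_ge[OF _ n b bK] unfolding e_def c_def
    by (intro sum_mono mult_left_mono cw_mu_nonneg) auto
  also have "\<dots> = 0"
    using glauber_op_stationary[OF n, of \<beta> "\<lambda>\<rho>. (mag n \<rho>)\<^sup>2"] by (simp add: right_diff_distrib sum_subtractf)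
  finally show ?thesis by (simp add: c_def)
qed

lemma cw_mu_uminus:
  assumes "\<sigma> \<in> config n"
  shows "map uminus \<sigma> \<in> config n" "mag n (map uminus \<sigma>) = - mag n \<sigma>" "cw_mu \<beta> n (map uminus \<sigma>) = cw_mu \<beta> n \<sigma>"
proof -
  show c: "map uminus \<sigma> \<in> config n" using assms by (auto simp: config_def)
  show m: "mag n (map uminus \<sigma>) = - mag n \<sigma>"
    using config_length[OF assms] by (simp add: mag_def flip: sum_negf)
  show "cw_mu \<beta> n (map uminus \<sigma>) = cw_mu \<beta> n \<sigma>"
    using assms c m by (simp add: cw_mu_def cw_weight_def cw_energy_eq)
qed

text \<open>Flipping all spins preserves the measure and negates the magnetization.\<close>

lemma sum_cw_mu_odd:
  assumes "\<And>x. F (- x) = - F (x::real)"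
  shows "(\<Sum>\<sigma>\<in>config n. cw_mu \<beta> n \<sigma> * F (mag n \<sigma>)) = 0"
proof -
  have inv: "map uminus (map uminus \<sigma>) = \<sigma>" for \<sigma> :: "int list" by (simp add: comp_def)
  have "(\<Sum>\<sigma>\<in>config n. cw_mu \<beta> n \<sigma> * F (mag n \<sigma>)) = (\<Sum>\<sigma>\<in>config n. - (cw_mu \<beta> n \<sigma> * F (mag n \<sigma>)))"
    by (rule sum.reindex_bij_witness[of _ "map uminus" "map uminus"])
      (auto simp: inv cw_mu_uminus assms simp del: map_map)
  then show ?thesis by (simp add: sum_negf)
qed

lemma abs_square_diff_le:
  fixes a b :: real
  assumes "\<bar>a - b\<bar> \<le> 2"
  shows "(b * \<bar>b\<bar> - a * \<bar>a\<bar>)\<^sup>2 \<le> 32 * (a\<^sup>2 + 1)"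
proof -
  have "\<bar>b * \<bar>b\<bar> - a * \<bar>a\<bar>\<bar> \<le> \<bar>a - b\<bar> * (\<bar>a\<bar> + \<bar>b\<bar>)"
  proof -
    have "b * \<bar>b\<bar> - a * \<bar>a\<bar> = (b - a) * \<bar>b\<bar> + a * (\<bar>b\<bar> - \<bar>a\<bar>)" by (simp add: algebra_simps)
    also have "\<bar>\<dots>\<bar> \<le> \<bar>(b - a) * \<bar>b\<bar>\<bar> + \<bar>a * (\<bar>b\<bar> - \<bar>a\<bar>)\<bar>" by (rule abs_triangle_ineq)
    also have "\<dots> \<le> \<bar>b - a\<bar> * \<bar>b\<bar> + \<bar>a\<bar> * \<bar>b - a\<bar>"
      unfolding abs_mult by (intro add_mono mult_left_mono) auto
    finally show ?thesis by (simp add: algebra_simps abs_minus_commute)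
  qed
  also have "\<dots> \<le> 2 * (2 * \<bar>a\<bar> + 2)" using assms by (intro mult_mono) auto
  finally have "\<bar>b * \<bar>b\<bar> - a * \<bar>a\<bar>\<bar>\<^sup>2 \<le> (2 * (2 * \<bar>a\<bar> + 2))\<^sup>2" by (intro power_mono) auto
  moreover have "(2 * (2 * \<bar>a\<bar> + 2))\<^sup>2 \<le> 32 * (a\<^sup>2 + 1)"
  proof -
    have "0 \<le> (\<bar>a\<bar> - 1)\<^sup>2" by simp
    then show ?thesis by (simp add: power2_eq_square algebra_simps)
  qed
  ultimately show ?thesis by simp
qed

text \<open>Uses \<open>f * P f = (f^2 + P (f^2)) / 2\<close> minus half the mean squared increment.
  By stationarity the bracket averages to \<open>E S^4\<close>; a step changes \<open>S |S|\<close>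
  by at most a multiple of \<open>|S| + 1\<close>.\<close>

lemma dirichlet_mag_abs:
  assumes n: "n \<ge> 1"
  defines "f \<equiv> \<lambda>\<sigma>. mag n \<sigma> * \<bar>mag n \<sigma>\<bar>"
  shows "moment \<beta> n 4 - 16 * (moment \<beta> n 2 + 1) \<le> (\<Sum>\<sigma>\<in>config n. cw_mu \<beta> n \<sigma> * f \<sigma> * glauber_op \<beta> n f \<sigma>)"
proof -
  have f2: "(f \<sigma>)\<^sup>2 = mag n \<sigma> ^ 4" for \<sigma>
    by (simp add: f_def power_mult_distrib power4_eq_xxxx power2_eq_square)
  define F2 where "F2 = (\<lambda>\<sigma>. (f \<sigma>)\<^sup>2)"
  have pt: "cw_mu \<beta> n \<sigma> * (F2 \<sigma> / 2 + glauber_op \<beta> n F2 \<sigma> / 2 - 16 * ((mag n \<sigma>)\<^sup>2 + 1))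
      \<le> cw_mu \<beta> n \<sigma> * f \<sigma> * glauber_op \<beta> n f \<sigma>" if s: "\<sigma> \<in> config n" for \<sigma>
  proof -
    have "(\<Sum>\<tau>\<in>config n. glauber \<beta> n \<sigma> \<tau> * (f \<tau> - f \<sigma>)\<^sup>2) \<le> (\<Sum>\<tau>\<in>config n. glauber \<beta> n \<sigma> \<tau> * (32 * ((mag n \<sigma>)\<^sup>2 + 1)))"
    proof (rule sum_mono)
      fix \<tau> assume t: "\<tau> \<in> config n"
      show "glauber \<beta> n \<sigma> \<tau> * (f \<tau> - f \<sigma>)\<^sup>2 \<le> glauber \<beta> n \<sigma> \<tau> * (32 * ((mag n \<sigma>)\<^sup>2 + 1))"
      proof (cases "glauber \<beta> n \<sigma> \<tau> = 0")
        case False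
        then have "\<bar>mag n \<sigma> - mag n \<tau>\<bar> \<le> 2" using glauber_mag_support[OF s n t] by (simp add: abs_minus_commute)
        then show ?thesis unfolding f_def by (intro mult_left_mono abs_square_diff_le glauber_nonneg)
      qed simp
    qed
    also have "\<dots> = 32 * ((mag n \<sigma>)\<^sup>2 + 1)" unfolding sum_distrib_right[symmetric] sum_glauber[OF s n] by simp
    finally have 1: "(\<Sum>\<tau>\<in>config n. glauber \<beta> n \<sigma> \<tau> * (f \<tau> - f \<sigma>)\<^sup>2) \<le> 32 * ((mag n \<sigma>)\<^sup>2 + 1)" .
    have "(\<Sum>\<tau>\<in>config n. glauber \<beta> n \<sigma> \<tau> * (f \<tau> - f \<sigma>)\<^sup>2)
        = (\<Sum>\<tau>\<in>config n. glauber \<beta> n \<sigma> \<tau> * F2 \<tau> - 2 * f \<sigma> * (glauber \<beta> n \<sigma> \<tau> * f \<tau>) + F2 \<sigma> * glauber \<beta> n \<sigma> \<tau>)"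
      by (rule sum.cong) (auto simp: F2_def power2_diff algebra_simps)
    also have "\<dots> = glauber_op \<beta> n F2 \<sigma> - 2 * f \<sigma> * glauber_op \<beta> n f \<sigma> + F2 \<sigma>"
      unfolding sum.distrib sum_subtractf sum_distrib_left[symmetric] sum_glauber[OF s n] by (simp add: glauber_op_def)
    finally have "F2 \<sigma> / 2 + glauber_op \<beta> n F2 \<sigma> / 2 - 16 * ((mag n \<sigma>)\<^sup>2 + 1) \<le> f \<sigma> * glauber_op \<beta> n f \<sigma>"
      using 1 by (simp add: field_simps)
    then show ?thesis unfolding mult.assoc by (intro mult_left_mono cw_mu_nonneg)
  qed
  have "(\<Sum>\<sigma>\<in>config n. cw_mu \<beta> n \<sigma> * (F2 \<sigma> / 2 + glauber_op \<beta> n F2 \<sigma> / 2 - 16 * ((mag n \<sigma>)\<^sup>2 + 1)))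
      = (\<Sum>\<sigma>\<in>config n. 1 / 2 * (cw_mu \<beta> n \<sigma> * F2 \<sigma>) + 1 / 2 * (cw_mu \<beta> n \<sigma> * glauber_op \<beta> n F2 \<sigma>)
        - 16 * (cw_mu \<beta> n \<sigma> * (mag n \<sigma>)\<^sup>2) - 16 * cw_mu \<beta> n \<sigma>)"
    by (rule sum.cong) (auto simp: algebra_simps)
  also have "\<dots> = moment \<beta> n 4 - 16 * (moment \<beta> n 2 + 1)"
    unfolding sum.distrib sum_subtractf sum_distrib_left[symmetric] sum_cw_mu glauber_op_stationary[OF n]
    by (simp add: moment_def F2_def f2)
  finally have eq: "(\<Sum>\<sigma>\<in>config n. cw_mu \<beta> n \<sigma> * (F2 \<sigma> / 2 + glauber_op \<beta> n F2 \<sigma> / 2 - 16 * ((mag n \<sigma>)\<^sup>2 + 1)))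
      = moment \<beta> n 4 - 16 * (moment \<beta> n 2 + 1)" .
  show ?thesis unfolding eq[symmetric] using pt by (rule sum_mono)
qed

text \<open>With \<open>R = sqrt (E S^4)\<close> and \<open>X = e R\<close>, the moment inequality
  becomes quadratic in \<open>X\<close> and forces a lower bound on \<open>X\<close> independent of
  \<open>n\<close>.\<close>

lemma large_eigenvalue:
  assumes n: "n \<ge> 1" and b: "0 \<le> \<beta>" "\<beta> \<le> 2" and K: "0 \<le> K" and bK: "\<bar>\<beta> - 1\<bar> \<le> K / sqrt (real n)"
    and large: "1 \<le> min_prob * sqrt (real n)" "K + 4 \<le> min_prob * (real n * sqrt (real n))"
  obtains g r where "(\<Sum>\<sigma>\<in>config n. cw_mu \<beta> n \<sigma> * g \<sigma>) = 0" "\<exists>\<sigma>\<in>config n. g \<sigma> \<noteq> 0"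
    "\<And>\<sigma>. \<sigma> \<in> config n \<Longrightarrow> (\<Sum>\<tau>\<in>config n. glauber \<beta> n \<sigma> \<tau> * g \<tau>) = r * g \<sigma>"
    "1 - 32 * (K + 4) / min_prob / (real n * sqrt (real n)) \<le> r"
proof -
  define e where "e = 1 / (real n * sqrt (real n))"
  define R where "R = sqrt (moment \<beta> n 4)"
  define X where "X = e * R"
  define f where "f = (\<lambda>\<sigma>. mag n \<sigma> * \<bar>mag n \<sigma>\<bar>)"
  have sq: "sqrt (real n) > 0" using n by simp
  have e: "e > 0" using n by (simp add: e_def)
  have m4: "0 \<le> moment \<beta> n 4" using moment_2_sq_le_4[of \<beta> n] zero_le_power2 order_trans by blast
  have R: "0 \<le> R" "R\<^sup>2 = moment \<beta> n 4" using m4 by (auto simp: R_def)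
  have X0: "0 \<le> X" using R e by (simp add: X_def)
  have "1 / sqrt (real n) \<le> min_prob" using large(1) sq by (simp add: pos_divide_le_eq)
  then have "2 * min_prob \<le> 4 * min_prob - 2 / sqrt (real n)" by simp
  also have "\<dots> \<le> (2 * K + 2) * e * moment \<beta> n 2 + 6 * e\<^sup>2 * moment \<beta> n 4"
    using moment_inequality[OF n b bK] by (simp add: e_def)
  also have "\<dots> \<le> (2 * K + 2) * e * R + 6 * e\<^sup>2 * R\<^sup>2"
    unfolding R(2) using moment_2_le_sqrt[of \<beta> n] K e by (intro add_right_mono mult_left_mono) (auto simp: R_def)
  also have "\<dots> = (2 * K + 2) * X + 6 * X\<^sup>2" by (simp add: X_def power_mult_distrib algebra_simps)
  finally have qX: "2 * min_prob \<le> (2 * K + 2) * X + 6 * X\<^sup>2" .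
  \<comment> \<open>If \<open>X \<le> 1\<close>, then \<open>X^2 \<le> X\<close> makes the right
    side at most \<open>(2 K + 8) X\<close>; otherwise the claimed bound is below 1 anyway.\<close>
  have Xlow: "min_prob / (K + 4) \<le> X"
  proof (cases "X \<le> 1")
    case True
    then have "X\<^sup>2 \<le> X" using X0 by (simp add: power2_eq_square mult_left_le)
    then have "min_prob \<le> (K + 4) * X" using qX by (simp add: algebra_simps)
    then show ?thesis using K by (simp add: pos_divide_le_eq mult.commute)
  next
    case False
    have "min_prob / (K + 4) \<le> 1" using K min_prob_le by (simp add: pos_divide_le_eq)
    then show ?thesis using False by simp
  qed
  have RX: "R = X * (real n * sqrt (real n))" using n by (simp add: X_def e_def)
  \<comment> \<open>Allows the additive 1 in the Dirichlet bound to be absorbed into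
    \<open>R\<close>.\<close>
  have R1: "1 \<le> R"
  proof -
    have "1 \<le> min_prob / (K + 4) * (real n * sqrt (real n))" using large(2) K by (simp add: pos_le_divide_eq)
    also have "\<dots> \<le> R" unfolding RX using Xlow by (intro mult_right_mono) auto
    finally show ?thesis .
  qed
  have f2: "(\<Sum>\<sigma>\<in>config n. cw_mu \<beta> n \<sigma> * (f \<sigma>)\<^sup>2) = moment \<beta> n 4"
    unfolding moment_def f_def by (rule sum.cong) (auto simp: power_mult_distrib power4_eq_xxxx power2_eq_square)
  have m4pos: "0 < moment \<beta> n 4" using R R1 by (smt (verit) zero_less_power)
  show ?thesis
  proof (rule reversible_top_eigenfunction[of "config n" "cw_mu \<beta> n" "glauber \<beta> n" f])
    show "finite (config n)" by (rule finite_config)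
    show "0 < cw_mu \<beta> n \<sigma>" if "\<sigma> \<in> config n" for \<sigma> using that by (rule cw_mu_pos)
    show "cw_mu \<beta> n \<sigma> * glauber \<beta> n \<sigma> \<tau> = cw_mu \<beta> n \<tau> * glauber \<beta> n \<tau> \<sigma>" if "\<sigma> \<in> config n" "\<tau> \<in> config n" for \<sigma> \<tau>
      using that by (rule glauber_reversible)
    show "(\<Sum>\<tau>\<in>config n. glauber \<beta> n \<sigma> \<tau>) = 1" if "\<sigma> \<in> config n" for \<sigma> using that n by (rule sum_glauber)
    show "(\<Sum>\<sigma>\<in>config n. cw_mu \<beta> n \<sigma> * f \<sigma>) = 0"
      unfolding f_def by (rule sum_cw_mu_odd[where F = "\<lambda>x. x * \<bar>x\<bar>"]) simp
    show "0 < (\<Sum>\<sigma>\<in>config n. cw_mu \<beta> n \<sigma> * (f \<sigma>)\<^sup>2)" unfolding f2 by (rule m4pos)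
  next
    fix g r
    assume g: "(\<Sum>\<sigma>\<in>config n. cw_mu \<beta> n \<sigma> * g \<sigma>) = 0" "\<exists>\<sigma>\<in>config n. g \<sigma> \<noteq> 0"
      "\<And>\<sigma>. \<sigma> \<in> config n \<Longrightarrow> (\<Sum>\<tau>\<in>config n. glauber \<beta> n \<sigma> \<tau> * g \<tau>) = r * g \<sigma>"
      and gr: "(\<Sum>\<sigma>\<in>config n. cw_mu \<beta> n \<sigma> * f \<sigma> * (\<Sum>\<tau>\<in>config n. glauber \<beta> n \<sigma> \<tau> * f \<tau>))
        \<le> r * (\<Sum>\<sigma>\<in>config n. cw_mu \<beta> n \<sigma> * (f \<sigma>)\<^sup>2)"
    have "moment \<beta> n 4 - 16 * (moment \<beta> n 2 + 1) \<le> r * moment \<beta> n 4"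
    proof -
      have fs: "mag n \<sigma> * \<bar>mag n \<sigma>\<bar> = f \<sigma>" for \<sigma> by (simp add: f_def)
      show ?thesis using dirichlet_mag_abs[OF n, of \<beta>] gr unfolding f2 glauber_op_def fs by linarith
    qed
    then have "(1 - r) * R\<^sup>2 \<le> 16 * (moment \<beta> n 2 + 1)" unfolding R(2) by (simp add: algebra_simps)
    also have "\<dots> \<le> 16 * (R + R)"
      using moment_2_le_sqrt[of \<beta> n, folded R_def] R1 by (intro mult_left_mono add_mono) auto
    also have "\<dots> = 32 * R" by simp
    finally have "(1 - r) * R * R \<le> 32 * R" by (simp add: power2_eq_square mult_ac)
    then have 1: "(1 - r) * R \<le> 32" using R1 by simp
    have "1 - r \<le> 32 * (K + 4) / min_prob / (real n * sqrt (real n))"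
    proof (cases "1 - r \<le> 0")
      case True
      moreover have "0 \<le> 32 * (K + 4) / min_prob / (real n * sqrt (real n))" using K min_prob_pos by simp
      ultimately show ?thesis by linarith
    next
      case False
      have "(1 - r) * (min_prob / (K + 4) * (real n * sqrt (real n))) \<le> (1 - r) * R"
        unfolding RX using Xlow False by (intro mult_left_mono mult_right_mono) auto
      then have "(1 - r) * (min_prob / (K + 4) * (real n * sqrt (real n))) \<le> 32" using 1 by linarith
      then show ?thesis using K min_prob_pos n sq by (simp add: field_simps)
    qed
    then show thesis using g by (intro that[of g r]) auto
  qed
qed

section \<open>Mixing time, spectral gap and cutoff\<close>

lemma glauber_eigenvalue_power_le:
  assumes "n \<ge> 1" "glauber_eigenvalue \<beta> n z" "z \<noteq> 1"
  shows "cmod z ^ t \<le> 2 * dist_n \<beta> n t"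
proof -
  obtain f where f: "\<exists>\<sigma>\<in>config n. f \<sigma> \<noteq> 0"
    "\<And>\<sigma>. \<sigma> \<in> config n \<Longrightarrow> (\<Sum>\<tau>\<in>config n. complex_of_real (glauber \<beta> n \<sigma> \<tau>) * f \<tau>) = z * f \<sigma>"
    using assms(2) unfolding glauber_eigenvalue_def by blast
  show ?thesis
    using mean_zero_eigenvalue_le[OF assms(1) f] eigenvalue_mean_zero[OF assms(1,3) f(2)] by blast
qed

text \<open>The inequality \<open>|z|^t \<le> 2 d(t)\<close> is used twice: with
  \<open>z = r\<close> it bounds mixing times from below, and at time \<open>T\<close> it keeps all
  eigenvalues other than 1 away from modulus 1. Assumption \<open>ex\<close> guarantees that the
  \<open>LEAST\<close> in \<open>tmix\<close> is attained.\<close>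

lemma mixing_and_gap_bounds:
  assumes n: "n \<ge> 1" and T: "T \<ge> 1" "dist_n \<beta> n T \<le> 1 / 4"
    and ex: "\<forall>\<epsilon>>0. \<exists>t. dist_n \<beta> n t \<le> \<epsilon>"
    and g: "(\<Sum>\<sigma>\<in>config n. cw_mu \<beta> n \<sigma> * g \<sigma>) = 0" "\<exists>\<sigma>\<in>config n. g \<sigma> \<noteq> 0"
      "\<forall>\<sigma>\<in>config n. (\<Sum>\<tau>\<in>config n. glauber \<beta> n \<sigma> \<tau> * g \<tau>) = r * g \<sigma>"
    and r: "1 - x \<le> r" and x: "0 < x" "x \<le> 1 / 2"
  shows "tmix \<beta> n (1/4) \<le> T"
    and "0 < \<epsilon> \<Longrightarrow> dist_n \<beta> n (tmix \<beta> n \<epsilon>) \<le> \<epsilon>"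
    and "0 < \<epsilon> \<Longrightarrow> - ln (2 * \<epsilon>) \<le> 2 * x * real (tmix \<beta> n \<epsilon>)"
    and "1 / (2 * real T) \<le> spectral_gap \<beta> n" and "spectral_gap \<beta> n \<le> x"
proof -
  show "tmix \<beta> n (1/4) \<le> T" unfolding tmix_def using T(2) by (rule Least_le)
  show at: "dist_n \<beta> n (tmix \<beta> n \<epsilon>) \<le> \<epsilon>" if "0 < \<epsilon>" for \<epsilon>
    unfolding tmix_def using ex[rule_format, OF that] by (rule LeastI_ex)
  have eigc: "(\<Sum>\<tau>\<in>config n. complex_of_real (glauber \<beta> n \<sigma> \<tau>) * complex_of_real (g \<tau>)) = complex_of_real r * complex_of_real (g \<sigma>)"
    if "\<sigma> \<in> config n" for \<sigma>
    using arg_cong[OF g(3)[rule_format, OF that], of complex_of_real] by simp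
  have meanc: "(\<Sum>\<sigma>\<in>config n. complex_of_real (cw_mu \<beta> n \<sigma>) * complex_of_real (g \<sigma>)) = 0"
    using arg_cong[OF g(1), of complex_of_real] by simp
  have nz: "\<exists>\<sigma>\<in>config n. complex_of_real (g \<sigma>) \<noteq> 0" using g(2) by simp
  have rt: "\<bar>r\<bar> ^ t \<le> 2 * dist_n \<beta> n t" for t
    using mean_zero_eigenvalue_le[OF n nz eigc meanc, of t] by simp
  have expx: "exp (- (2 * x)) \<le> 1 - x"
  proof -
    have "exp (- (2 * x)) = 1 / exp (2 * x)" by (simp add: exp_minus inverse_eq_divide)
    also have "\<dots> \<le> 1 / (1 + 2 * x)" using x exp_ge_add_one_self[of "2 * x"] by (intro divide_left_mono) auto
    also have "\<dots> \<le> 1 - x"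
    proof -
      have "0 \<le> x * (1 - 2 * x)" using x by (intro mult_nonneg_nonneg) auto
      then have "1 \<le> (1 - x) * (1 + 2 * x)" by (simp add: algebra_simps)
      then show ?thesis using x by (simp add: pos_divide_le_eq)
    qed
    finally show ?thesis .
  qed
  show "- ln (2 * \<epsilon>) \<le> 2 * x * real (tmix \<beta> n \<epsilon>)" if e: "0 < \<epsilon>" for \<epsilon>
  proof -
    define t where "t = tmix \<beta> n \<epsilon>"
    have "exp (- (2 * x * real t)) = exp (- (2 * x)) ^ t" by (simp add: mult_ac flip: exp_of_nat_mult)
    also have "\<dots> \<le> \<bar>r\<bar> ^ t" using expx r by (intro power_mono) auto
    also have "\<dots> \<le> 2 * \<epsilon>" using rt[of t] at[OF e] by (simp add: t_def)
    finally have "ln (exp (- (2 * x * real t))) \<le> ln (2 * \<epsilon>)" using e by (subst ln_le_cancel_iff) auto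
    then show ?thesis by (simp add: t_def)
  qed
  have bound: "cmod z \<le> 1 - 1 / (2 * real T)" if "glauber_eigenvalue \<beta> n z" "z \<noteq> 1" for z
  proof (rule ccontr)
    assume "\<not> ?thesis"
    then have lt: "1 - 1 / (2 * real T) < cmod z" by simp
    have T2: "1 / (2 * real T) \<le> 1" using T by simp
    \<comment> \<open>By Bernoulli \<open>(1 - 1 / (2 T))^T \<ge> 1/2\<close>, so a larger modulus
      would contradict \<open>|z|^T \<le> 2 d(T) \<le> 1/2\<close>.\<close>
    have "1 / 2 = 1 + real T * (- (1 / (2 * real T)))" using T by simp
    also have "\<dots> \<le> (1 + (- (1 / (2 * real T)))) ^ T" using T2 by (intro Bernoulli_inequality) simp
    also have "\<dots> < cmod z ^ T" using lt T T2 by (intro power_strict_mono) auto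
    also have "\<dots> \<le> 2 * dist_n \<beta> n T" using glauber_eigenvalue_power_le[OF n that] .
    also have "\<dots> \<le> 1 / 2" using T by simp
    finally show False by simp
  qed
  define Z where "Z = {cmod z | z. glauber_eigenvalue \<beta> n z \<and> z \<noteq> 1}"
  have rZ: "\<bar>r\<bar> \<in> Z"
  proof -
    have "glauber_eigenvalue \<beta> n (complex_of_real r)"
      unfolding glauber_eigenvalue_def using nz eigc by (intro exI[of _ "\<lambda>\<sigma>. complex_of_real (g \<sigma>)"]) blast
    moreover have "r \<noteq> 1"
    proof
      assume "r = 1"
      then show False using rt[of T] T by simp
    qed
    ultimately show ?thesis unfolding Z_def by (auto intro!: exI[of _ "complex_of_real r"])
  qed
  have "Sup Z \<le> 1 - 1 / (2 * real T)"
    using rZ bound by (intro cSup_least) (auto simp: Z_def)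
  then show "1 / (2 * real T) \<le> spectral_gap \<beta> n" by (simp add: spectral_gap_def lambda_star_def Z_def)
  have "\<bar>r\<bar> \<le> Sup Z"
    using rZ bound by (intro cSup_upper bdd_aboveI[of _ "1 - 1 / (2 * real T)"]) (auto simp: Z_def)
  then show "spectral_gap \<beta> n \<le> x" using r by (simp add: spectral_gap_def lambda_star_def Z_def)
qed

section \<open>Assembling the bounds in the critical window\<close>

lemma powr_three_halves: "real n powr (3/2) = real n * sqrt (real n)"
proof -
  have "real n powr (3/2) = real n powr 1 * real n powr (1/2)" by (subst powr_add[symmetric]) simp
  then show ?thesis by (simp add: powr_half_sqrt)
qed

lemma powr_minus_three_halves: "real n powr (-(3/2)) = 1 / (real n * sqrt (real n))"
  unfolding powr_minus powr_three_halves by (rule inverse_eq_divide)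

lemma critical_window_bounds:
  assumes K: "0 \<le> K" and bK: "\<forall>\<^sub>F n in sequentially. \<bar>\<beta> n - 1\<bar> \<le> K / sqrt (real n)"
  obtains C1 C2 :: real where "0 < C1" "0 < C2"
    "\<forall>\<^sub>F n in sequentially. real (tmix (\<beta> n) n (1/4)) \<le> C1 * real n powr (3/2)
      \<and> (\<forall>\<epsilon>>0. dist_n (\<beta> n) n (tmix (\<beta> n) n \<epsilon>) \<le> \<epsilon>)
      \<and> (\<forall>\<epsilon>>0. - ln (2 * \<epsilon>) * real n powr (3/2) \<le> 2 * C2 * real (tmix (\<beta> n) n \<epsilon>))
      \<and> real n powr (-(3/2)) / (2 * C1) \<le> spectral_gap (\<beta> n) n
      \<and> spectral_gap (\<beta> n) n \<le> C2 * real n powr (-(3/2))"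
proof (rule dist_n_upper[OF K])
  fix M :: real and N
  assume M: "1 \<le> M" and N: "1 \<le> N"
    and up: "\<And>n \<beta> t. n \<ge> N \<Longrightarrow> \<bar>\<beta> - 1\<bar> \<le> K / sqrt (real n) \<Longrightarrow> 1 / 2 \<le> \<beta> \<Longrightarrow> \<beta> \<le> 2 \<Longrightarrow>
      dist_n \<beta> n (t + t) \<le> real n * (1 - 2 * min_prob / real n) ^ t + M * (1 - real n powr (-(3/2)) / M) ^ t"
  \<comment> \<open>After \<open>a m\<close> steps with \<open>m = n^(3/2)\<close> the slow term is
    at most \<open>M exp (- ln (8 M)) = 1/8\<close>.\<close>
  define a where "a = M * ln (8 * M)"
  \<comment> \<open>In the same time the swap term decays to at most
    \<open>n exp (- (k sqrt n))\<close>, because \<open>m / n = sqrt n\<close>; it is eventually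
    below 1/8 as well.\<close>
  define k where "k = 2 * min_prob * a"
  define C2 where "C2 = 32 * (K + 4) / min_prob"
  define C1 where "C1 = 2 * (a + 1)"
  have a: "a > 0" using M by (simp add: a_def)
  have k: "k > 0" using a min_prob_pos by (simp add: k_def)
  have C1: "C1 > 0" using a by (simp add: C1_def)
  have C2: "C2 > 0" using K min_prob_pos by (simp add: C2_def)
  note c = min_prob_pos
  have "((\<lambda>n. real n * exp (- (k * sqrt (real n)))) \<longlongrightarrow> 0) sequentially" using k by real_asymp
  then have ev1: "\<forall>\<^sub>F n in sequentially. real n * exp (- (k * sqrt (real n))) < 1 / 8"
    by (rule order_tendstoD) simp
  have "((\<lambda>n. K / sqrt (real n)) \<longlongrightarrow> 0) sequentially" by real_asymp
  then have ev2: "\<forall>\<^sub>F n in sequentially. K / sqrt (real n) < 1 / 2" by (rule order_tendstoD) simp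
  have "filterlim (\<lambda>n. sqrt (real n)) at_top sequentially" by real_asymp
  then have ev3: "\<forall>\<^sub>F n in sequentially. 1 / min_prob \<le> sqrt (real n)" by (simp add: filterlim_at_top)
  have "filterlim (\<lambda>n. real n * sqrt (real n)) at_top sequentially" by real_asymp
  then have ev4: "\<forall>\<^sub>F n in sequentially. max ((K + 4) / min_prob) (2 * C2) \<le> real n * sqrt (real n)"
    unfolding filterlim_at_top by blast
  have "\<forall>\<^sub>F n in sequentially. real (tmix (\<beta> n) n (1/4)) \<le> C1 * real n powr (3/2)
      \<and> (\<forall>\<epsilon>>0. dist_n (\<beta> n) n (tmix (\<beta> n) n \<epsilon>) \<le> \<epsilon>)
      \<and> (\<forall>\<epsilon>>0. - ln (2 * \<epsilon>) * real n powr (3/2) \<le> 2 * C2 * real (tmix (\<beta> n) n \<epsilon>))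
      \<and> real n powr (-(3/2)) / (2 * C1) \<le> spectral_gap (\<beta> n) n
      \<and> spectral_gap (\<beta> n) n \<le> C2 * real n powr (-(3/2))"
    using bK ev1 ev2 ev3 ev4 eventually_ge_at_top[of N]
  proof eventually_elim
    case (elim n)
    define b where "b = \<beta> n"
    define m where "m = real n * sqrt (real n)"
    have n: "n \<ge> 1" using N elim by simp
    have b: "\<bar>b - 1\<bar> \<le> K / sqrt (real n)" "1 / 2 \<le> b" "b \<le> 2"
      using elim(1,3) unfolding b_def by linarith+
    have m1: "m \<ge> 1" unfolding m_def using n mult_mono[of 1 "real n" 1 "sqrt (real n)"] by simp
    have m: "real n powr (3/2) = m" "real n powr (-(3/2)) = 1 / m"
      unfolding powr_minus_three_halves powr_three_halves m_def by auto
    define t where "t = nat \<lceil>a * m\<rceil>"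
    have am: "0 < a * m" using a m1 by simp
    have t: "a * m \<le> real t" "real t \<le> a * m + 1" "1 \<le> t" using am unfolding t_def by linarith+
    have dist_up: "dist_n b n (s + s) \<le> real n * (1 - 2 * min_prob / real n) ^ s + M * (1 - 1 / m / M) ^ s" for s
      using up[OF _ b] elim m by simp
    have p1: "0 \<le> 1 - 2 * min_prob / real n" using min_prob_le n by (simp add: field_simps)
    have p2: "0 \<le> 1 - 1 / m / M"
    proof -
      have "1 / m \<le> 1" "1 / M \<le> 1" using m1 M by simp_all
      then have "1 / m * (1 / M) \<le> 1 * 1" using m1 M by (intro mult_mono) auto
      then show ?thesis by simp
    qed
    have pow_exp: "(1 - y) ^ s \<le> exp (- (y * real s))" if "0 \<le> 1 - y" for y :: real and s
    proof -
      have "(1 - y) ^ s \<le> exp (- y) ^ s" using that exp_ge_add_one_self[of "- y"] by (intro power_mono) auto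
      also have "\<dots> = exp (- (y * real s))" by (simp add: mult_ac flip: exp_of_nat_mult)
      finally show ?thesis .
    qed
    have dT: "dist_n b n (t + t) \<le> 1 / 4"
    proof -
      have "real n * (1 - 2 * min_prob / real n) ^ t \<le> real n * exp (- (k * sqrt (real n)))"
      proof (rule mult_left_mono)
        have "k * sqrt (real n) = 2 * min_prob / real n * (a * m)" using n by (simp add: k_def m_def)
        also have "\<dots> \<le> 2 * min_prob / real n * real t" using t c by (intro mult_left_mono) auto
        finally have "exp (- (2 * min_prob / real n * real t)) \<le> exp (- (k * sqrt (real n)))" by simp
        then show "(1 - 2 * min_prob / real n) ^ t \<le> exp (- (k * sqrt (real n)))"
          using pow_exp[OF p1, of t] by linarith
      qed simp
      moreover have "M * (1 - 1 / m / M) ^ t \<le> M * (1 / (8 * M))"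
      proof (rule mult_left_mono)
        have "ln (8 * M) = 1 / m / M * (a * m)" using M m1 by (simp add: a_def)
        also have "\<dots> \<le> 1 / m / M * real t" using t m1 M by (intro mult_left_mono) auto
        finally have "exp (- (1 / m / M * real t)) \<le> exp (- ln (8 * M))" by simp
        also have "\<dots> = 1 / (8 * M)" using M by (simp add: exp_minus inverse_eq_divide)
        finally show "(1 - 1 / m / M) ^ t \<le> 1 / (8 * M)" using pow_exp[OF p2, of t] by linarith
      qed (use M in simp)
      moreover have "M * (1 / (8 * M)) = 1 / 8" using M by simp
      ultimately show ?thesis using dist_up[of t] elim(2) by linarith
    qed
    \<comment> \<open>For fixed \<open>n\<close> both geometric terms tend to 0, so every precision
      is reached and \<open>tmix\<close> is a genuine minimum.\<close>
    have ex: "\<exists>s. dist_n b n s \<le> \<epsilon>" if e: "0 < \<epsilon>" for \<epsilon>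
    proof -
      have "(\<lambda>s. (1 - 2 * min_prob / real n) ^ s) \<longlonglongrightarrow> 0"
        using p1 c n by (intro LIMSEQ_power_zero) auto
      moreover have "(\<lambda>s. (1 - 1 / m / M) ^ s) \<longlonglongrightarrow> 0"
        using p2 m1 M by (intro LIMSEQ_power_zero) auto
      ultimately have "(\<lambda>s. real n * (1 - 2 * min_prob / real n) ^ s + M * (1 - 1 / m / M) ^ s) \<longlonglongrightarrow> real n * 0 + M * 0"
        by (intro tendsto_add tendsto_mult tendsto_const)
      then have "\<forall>\<^sub>F s in sequentially. real n * (1 - 2 * min_prob / real n) ^ s + M * (1 - 1 / m / M) ^ s < \<epsilon>"
        using e by (intro order_tendstoD) auto
      then obtain s where "real n * (1 - 2 * min_prob / real n) ^ s + M * (1 - 1 / m / M) ^ s < \<epsilon>"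
        by (auto simp: eventually_sequentially)
      then show ?thesis using dist_up[of s] by (intro exI[of _ "s + s"]) linarith
    qed
    have l1: "1 \<le> min_prob * sqrt (real n)" using elim(4) c by (simp add: pos_divide_le_eq mult.commute)
    have l2: "K + 4 \<le> min_prob * (real n * sqrt (real n))" using elim(5) c by (simp add: pos_divide_le_eq mult.commute)
    have b0: "0 \<le> b" using b by simp
    obtain g r where g: "(\<Sum>\<sigma>\<in>config n. cw_mu b n \<sigma> * g \<sigma>) = 0" "\<exists>\<sigma>\<in>config n. g \<sigma> \<noteq> 0"
      "\<forall>\<sigma>\<in>config n. (\<Sum>\<tau>\<in>config n. glauber b n \<sigma> \<tau> * g \<tau>) = r * g \<sigma>"
      and r: "1 - 32 * (K + 4) / min_prob / (real n * sqrt (real n)) \<le> r"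
      by (rule large_eigenvalue[OF n b0 b(3) K b(1) l1 l2]) blast
    define x where "x = C2 / m"
    have x: "0 < x" "x \<le> 1 / 2" "1 - x \<le> r"
    proof -
      show "0 < x" using C2 m1 by (simp add: x_def)
      have "2 * C2 \<le> m" using elim(5) by (simp add: m_def)
      then show "x \<le> 1 / 2" using m1 by (simp add: x_def pos_divide_le_eq)
      show "1 - x \<le> r" using r by (simp add: x_def C2_def m_def)
    qed
    have T: "t + t \<ge> 1" using t by simp
    have tt: "real (t + t) \<le> C1 * m"
    proof -
      have "real (t + t) \<le> 2 * (a * m + 1)" using t by simp
      also have "\<dots> \<le> 2 * (a * m + m)" using m1 by simp
      finally show ?thesis by (simp add: C1_def algebra_simps)
    qed
    have ex': "\<forall>\<epsilon>>0. \<exists>s. dist_n b n s \<le> \<epsilon>" using ex by blast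
    note res = mixing_and_gap_bounds[OF n T dT ex' g x(3) x(1,2)]
    have "real (tmix b n (1/4)) \<le> C1 * m" using res(1) tt by linarith
    moreover have "- ln (2 * \<epsilon>) * m \<le> 2 * C2 * real (tmix b n \<epsilon>)" if "0 < \<epsilon>" for \<epsilon>
      using res(3)[OF that] m1 by (simp add: x_def pos_le_divide_eq)
    moreover have "1 / m / (2 * C1) \<le> spectral_gap b n"
    proof -
      have "1 / m / (2 * C1) = 1 / (2 * (C1 * m))" by (simp add: mult_ac)
      also have "\<dots> \<le> 1 / (2 * real (t + t))" using tt T C1 m1 by (intro divide_left_mono) auto
      finally show ?thesis using res(4) by linarith
    qed
    moreover have "spectral_gap b n \<le> C2 * (1 / m)" using res(5) by (simp add: x_def)
    ultimately show ?case unfolding m b_def[symmetric] using res(2) by blast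
  qed
  then show thesis using C1 C2 that by blast
qed

theorem theorem2:
  fixes \<delta> \<beta> :: "nat \<Rightarrow> real"
  assumes "\<delta> \<in> O(\<lambda>n. 1 / sqrt (real n))"
    and "\<forall>n. \<beta> n = 1 + \<delta> n \<or> \<beta> n = 1 - \<delta> n"
    and "\<forall>n. \<beta> n \<ge> 0"
  shows "has_order (\<lambda>n. real (tmix (\<beta> n) n (1/4))) (\<lambda>n. real n powr (3/2))
         \<and> \<not> has_cutoff \<beta>
         \<and> has_order (\<lambda>n. spectral_gap (\<beta> n) n) (\<lambda>n. real n powr (-(3/2)))"
proof -
  obtain K where K: "K > 0" and d: "\<forall>\<^sub>F n in sequentially. norm (\<delta> n) \<le> K * norm (1 / sqrt (real n))"
    using assms(1) by (rule landau_o.bigE)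
  have bK: "\<forall>\<^sub>F n in sequentially. \<bar>\<beta> n - 1\<bar> \<le> K / sqrt (real n)"
    using d
  proof eventually_elim
    case (elim n)
    have "\<bar>\<beta> n - 1\<bar> = \<bar>\<delta> n\<bar>" using assms(2)[rule_format, of n] by auto
    then show ?case using elim by simp
  qed
  obtain C1 C2 :: real where C: "0 < C1" "0 < C2" and ev:
    "\<forall>\<^sub>F n in sequentially. real (tmix (\<beta> n) n (1/4)) \<le> C1 * real n powr (3/2)
      \<and> (\<forall>\<epsilon>>0. dist_n (\<beta> n) n (tmix (\<beta> n) n \<epsilon>) \<le> \<epsilon>)
      \<and> (\<forall>\<epsilon>>0. - ln (2 * \<epsilon>) * real n powr (3/2) \<le> 2 * C2 * real (tmix (\<beta> n) n \<epsilon>))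
      \<and> real n powr (-(3/2)) / (2 * C1) \<le> spectral_gap (\<beta> n) n
      \<and> spectral_gap (\<beta> n) n \<le> C2 * real n powr (-(3/2))"
    using critical_window_bounds[OF less_imp_le[OF K] bK] by blast
  have "has_order (\<lambda>n. real (tmix (\<beta> n) n (1/4))) (\<lambda>n. real n powr (3/2))"
    unfolding has_order_def
  proof (intro exI conjI)
    define c where "c = ln 2 / (2 * C2)"
    show c: "0 < c" using C by (simp add: c_def)
    \<comment> \<open>\<open>has_order\<close> asks for strictly ordered constants, hence the upper
      constant is enlarged by \<open>c\<close>.\<close>
    show "c < C1 + c" using C by simp
    show "\<forall>\<^sub>F n in sequentially. c * real n powr (3/2) \<le> real (tmix (\<beta> n) n (1/4))
        \<and> real (tmix (\<beta> n) n (1/4)) \<le> (C1 + c) * real n powr (3/2)"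
      using ev
    proof eventually_elim
      case (elim n)
      then have "- ln (2 * (1/4)) * real n powr (3/2) \<le> 2 * C2 * real (tmix (\<beta> n) n (1/4))"
        by (metis zero_less_divide_1_iff zero_less_numeral)
      moreover have ln2: "- ln (2 * (1/4)) = ln (2::real)" by (simp add: ln_div)
      ultimately have "ln 2 * real n powr (3/2) \<le> 2 * C2 * real (tmix (\<beta> n) n (1/4))" by (simp only: ln2)
      then have "c * real n powr (3/2) \<le> real (tmix (\<beta> n) n (1/4))"
        using C by (simp add: c_def pos_divide_le_eq mult_ac)
      moreover have "0 \<le> c * real n powr (3/2)" using c by simp
      ultimately show ?case using elim by (auto simp: distrib_right)
    qed
  qed
  moreover have "\<not> has_cutoff \<beta>"
  proof
    assume "has_cutoff \<beta>"
    then obtain w where w: "w \<in> o(\<lambda>n. real (tmix (\<beta> n) n (1/4)))"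
      and cut: "\<And>\<epsilon>. 0 < \<epsilon> \<Longrightarrow> \<epsilon> < 1 \<Longrightarrow> \<exists>c>0. \<forall>n\<ge>1.
         real (tmix (\<beta> n) n \<epsilon>) - real (tmix (\<beta> n) n (1 - \<epsilon>)) \<le> c * w n"
      unfolding has_cutoff_def by blast
    \<comment> \<open>Chosen so that \<open>- ln (2 \<epsilon>) = 4 C1 C2 + 2\<close>. Under cutoff
      the mixing time at \<epsilon> would be at most \<open>2 C1 n^(3/2)\<close>, which allows only
      \<open>4 C1 C2\<close>.\<close>
    define \<epsilon> where "\<epsilon> = exp (- (4 * C1 * C2 + 2)) / 2"
    have e0: "0 < \<epsilon>" by (simp add: \<epsilon>_def)
    have "exp (- (4 * C1 * C2 + 2)) \<le> exp 0"
      using mult_pos_pos[OF C] by (subst exp_le_cancel_iff) simp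
    then have e1: "\<epsilon> \<le> 1 / 2" by (simp add: \<epsilon>_def)
    obtain c where c: "c > 0" and cn: "\<And>n. n \<ge> 1 \<Longrightarrow> real (tmix (\<beta> n) n \<epsilon>) - real (tmix (\<beta> n) n (1 - \<epsilon>)) \<le> c * w n"
      using cut[OF e0] e1 by auto
    have "1 / c > 0" using c by simp
    from landau_o.smallD[OF w this]
    have wev: "\<forall>\<^sub>F n in sequentially. norm (w n) \<le> 1 / c * norm (real (tmix (\<beta> n) n (1/4)))" .
    have "\<forall>\<^sub>F n in sequentially. False"
      using ev wev eventually_ge_at_top[of 1]
    proof eventually_elim
      case (elim n)
      define m where "m = real n powr (3/2)"
      have m: "m > 0" using elim(3) by (simp add: m_def)
      \<comment> \<open>Since \<open>1/4 \<le> 1 - \<epsilon>\<close>, the time that achieves 1/4 is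
        a candidate for the minimum at \<open>1 - \<epsilon>\<close>.\<close>
      have mono: "tmix (\<beta> n) n (1 - \<epsilon>) \<le> tmix (\<beta> n) n (1/4)"
      proof -
        have "dist_n (\<beta> n) n (tmix (\<beta> n) n (1/4)) \<le> 1/4" using elim(1) by (metis zero_less_divide_1_iff zero_less_numeral)
        also have "\<dots> \<le> 1 - \<epsilon>" using e1 by simp
        finally show ?thesis unfolding tmix_def[of _ _ "1 - \<epsilon>"] by (rule Least_le)
      qed
      have "c * \<bar>w n\<bar> \<le> real (tmix (\<beta> n) n (1/4))" using elim(2) c by (simp add: pos_le_divide_eq mult.commute)
      moreover have "c * w n \<le> c * \<bar>w n\<bar>" using c by (intro mult_left_mono) auto
      ultimately have "real (tmix (\<beta> n) n \<epsilon>) \<le> 2 * real (tmix (\<beta> n) n (1/4))"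
        using cn[OF elim(3)] mono by linarith
      also have "\<dots> \<le> 2 * (C1 * m)" using elim(1) by (simp add: m_def)
      finally have up: "2 * C2 * real (tmix (\<beta> n) n \<epsilon>) \<le> 2 * C2 * (2 * (C1 * m))" using C by (intro mult_left_mono) auto
      have "(4 * C1 * C2 + 2) * m = - ln (2 * \<epsilon>) * m" by (simp add: \<epsilon>_def)
      also have "\<dots> \<le> 2 * C2 * real (tmix (\<beta> n) n \<epsilon>)" using elim(1) e0 by (simp add: m_def)
      also note up
      finally have "(4 * C1 * C2 + 2) * m \<le> 2 * C2 * (2 * (C1 * m))" .
      then show ?case using m by (simp add: algebra_simps)
    qed
    then show False by simp
  qed
  moreover have "has_order (\<lambda>n. spectral_gap (\<beta> n) n) (\<lambda>n. real n powr (-(3/2)))"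
    unfolding has_order_def
  proof (intro exI conjI)
    define c where "c = 1 / (2 * C1)"
    show c: "0 < c" using C by (simp add: c_def)
    show "c < C2 + c" using C by simp
    show "\<forall>\<^sub>F n in sequentially. c * real n powr (-(3/2)) \<le> spectral_gap (\<beta> n) n
        \<and> spectral_gap (\<beta> n) n \<le> (C2 + c) * real n powr (-(3/2))"
      using ev
    proof eventually_elim
      case (elim n)
      have "0 \<le> c * real n powr (-(3/2))" using c by simp
      moreover have "c * real n powr (-(3/2)) = real n powr (-(3/2)) / (2 * C1)" by (simp add: c_def)
      ultimately show ?case using elim unfolding distrib_right by linarith
    qed
  qed
  ultimately show ?thesis by blast
qed

end
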